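(* There exist universal constants $\beta_0>0$, $C_1>0$ and $C_2>0$ such that the following holds for every $\beta\ge\beta_0$. Let $\gamma$ be a nonempty generalized loop in $\mathbb{Z}^4$, let $\ell$ be the number of edges in $\gamma$, and let $\ell_0$ be the number of corner edges of $\gamma$. Then $$\left|\langle W_\gamma\rangle_\beta - e^{-2\ell e^{-12\beta}}\right| \le C_1\left(e^{-2\beta}+\sqrt{\frac{\ell_0}{\ell}}\right)^{C_2}.$$
   Context: For $N\ge 1$ let $B_N=[-N,N]^4\cap\mathbb{Z}^4$, let $E_N$ be the set of undirected nearest-neighbor edges of $B_N$, and let $\Sigma_N=\{-1,1\}^{E_N}$. A plaquette in $\mathbb{Z}^4$ is a (unit) square bounded by four edges; $P_N$ is the set of plaquettes all of whose edges are in $E_N$. For $\sigma\in\Sigma_N$ and a plaquette $p\in P_N$ with edges $e_1,e_2,e_3,e_4$, let $\sigma_p=\sigma_{e_1}\sigma_{e_2}\sigma_{e_3}\sigma_{e_4}$. Ising lattice gauge theory on $B_N$ with free boundary condition at inverse coupling strength $\beta>0$ is the probability measure on $\Sigma_N$ with probability mass function proportional to $\exp(\beta\sum_{p\in P_N}\sigma_p)$; $\langle\cdot\rangle_{N,\beta}$ denotes expectation under it. A loop is a closed nearest-neighbor path; it is self-avoiding if no edge is repeated. Two loops are disjoint if they share no common edge. A generalized loop is a finite collection of disjoint self-avoiding loops; it is identified with its set of edges. An edge $e\in\gamma$ is a corner edge of $\gamma$ if there is some other edge $e'\in\gamma$ such that $e$ and $e'$ are edges of a common plaquette. The Wilson loop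 variable is $W_\gamma=\prod_{e\in\gamma}\sigma_e$, and $\langle W_\gamma\rangle_\beta:=\lim_{N\to\infty}\langle W_\gamma\rangle_{N,\beta}$, a limit which exists for all sufficiently large $\beta$ (in particular for $\beta\ge\beta_0$). *)

theory Defs
  imports "HOL-Probability.Probability"
begin

type_synonym site = "int ^ 4"
type_synonym edge = "site set"
type_synonym plaquette = "edge set"
type_synonym spin_config = "edge \<Rightarrow> real"

definition neighbors :: "site \<Rightarrow> site \<Rightarrow> bool" where
  "neighbors x y \<longleftrightarrow> (\<Sum>i\<in>UNIV. \<bar>x $ i - y $ i\<bar>) = 1"

definition edges :: "edge set" where
  "edges = {{x, y} | x y. neighbors x y}"

(* A plaquette is represented by the set of its four bounding edges, which determines it. *)
definition plaquettes :: "plaquette set" where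
  "plaquettes =
     {{{x, x + axis i 1}, {x + axis i 1, x + axis i 1 + axis j 1},
       {x + axis i 1 + axis j 1, x + axis j 1}, {x + axis j 1, x}} | x i j. i \<noteq> j}"

definition box :: "nat \<Rightarrow> site set" where
  "box N = {x. \<forall>i. - int N \<le> x $ i \<and> x $ i \<le> int N}"

definition box_edges :: "nat \<Rightarrow> edge set" where
  "box_edges N = {e \<in> edges. e \<subseteq> box N}"

definition box_plaquettes :: "nat \<Rightarrow> plaquette set" where
  "box_plaquettes N = {p \<in> plaquettes. p \<subseteq> box_edges N}"

definition configs :: "nat \<Rightarrow> spin_config set" where
  "configs N = box_edges N \<rightarrow>\<^sub>E {-1, 1}"

definition plaquette_spin :: "spin_config \<Rightarrow> plaquette \<Rightarrow> real" where
  "plaquette_spin \<sigma> p = (\<Prod>e\<in>p. \<sigma> e)"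

definition boltzmann_weight :: "nat \<Rightarrow> real \<Rightarrow> spin_config \<Rightarrow> real" where
  "boltzmann_weight N \<beta> \<sigma> = exp (\<beta> * (\<Sum>p\<in>box_plaquettes N. plaquette_spin \<sigma> p))"

definition partition_fn :: "nat \<Rightarrow> real \<Rightarrow> real" where
  "partition_fn N \<beta> = (\<Sum>\<sigma>\<in>configs N. boltzmann_weight N \<beta> \<sigma>)"

definition ising_gauge_measure :: "nat \<Rightarrow> real \<Rightarrow> spin_config measure" where
  "ising_gauge_measure N \<beta> =
     point_measure (configs N) (\<lambda>\<sigma>. ennreal (boltzmann_weight N \<beta> \<sigma> / partition_fn N \<beta>))"

definition box_expectation :: "nat \<Rightarrow> real \<Rightarrow> (spin_config \<Rightarrow> real) \<Rightarrow> real" where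
  "box_expectation N \<beta> f = (LINT \<sigma>|ising_gauge_measure N \<beta>. f \<sigma>)"

definition path_edges :: "site list \<Rightarrow> edge list" where
  "path_edges xs = map (\<lambda>(x, y). {x, y}) (zip xs (tl xs))"

(* A loop is listed with its base point at both ends. *)
definition is_loop :: "site list \<Rightarrow> bool" where
  "is_loop xs \<longleftrightarrow> xs \<noteq> [] \<and> successively neighbors xs \<and> hd xs = last xs"

(* Sites may be revisited; only edges may not. *)
definition self_avoiding :: "site list \<Rightarrow> bool" where
  "self_avoiding xs \<longleftrightarrow> distinct (path_edges xs)"

definition generalized_loop :: "edge set \<Rightarrow> bool" where
  "generalized_loop \<gamma> \<longleftrightarrow>
     (\<exists>L. finite L \<and> (\<forall>xs\<in>L. is_loop xs \<and> self_avoiding xs) \<and>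
          disjoint_family_on (\<lambda>xs. set (path_edges xs)) L \<and>
          \<gamma> = (\<Union>xs\<in>L. set (path_edges xs)))"

definition corner_edges :: "edge set \<Rightarrow> edge set" where
  "corner_edges \<gamma> =
     {e \<in> \<gamma>. \<exists>e'\<in>\<gamma>. e' \<noteq> e \<and> (\<exists>p\<in>plaquettes. e \<in> p \<and> e' \<in> p)}"

(* If \<gamma> is not contained in the box of size N, then \<sigma> takes the value undefined on
   some edges of \<gamma>; for fixed \<gamma> this affects only finitely many N. *)
definition wilson_loop :: "edge set \<Rightarrow> spin_config \<Rightarrow> real" where
  "wilson_loop \<gamma> \<sigma> = (\<Prod>e\<in>\<gamma>. \<sigma> e)"

definition wilson_expectation :: "real \<Rightarrow> edge set \<Rightarrow> real" where
  "wilson_expectation \<beta> \<gamma> = lim (\<lambda>N. box_expectation N \<beta> (wilson_loop \<gamma>))"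

lemma finite_box: "finite (box N)"
proof -
  have "inj_on vec_nth (box N)" by (auto simp: inj_on_def vec_eq_iff)
  moreover have "vec_nth ` box N \<subseteq> UNIV \<rightarrow>\<^sub>E {- int N..int N}" by (auto simp: box_def)
  ultimately show ?thesis
    by (meson finite_PiE finite finite_atLeastAtMost_int finite_imageD finite_subset)
qed

lemma finite_configs: "finite (configs N)"
proof -
  have "finite (box_edges N)"
    by (rule finite_subset[of _ "Pow (box N)"]) (auto simp: box_edges_def finite_box)
  thus ?thesis by (auto simp: configs_def intro: finite_PiE)
qed

lemma partition_fn_pos: "partition_fn N \<beta> > 0"
proof -
  have "configs N \<noteq> {}" by (simp add: configs_def PiE_eq_empty_iff)
  thus ?thesis unfolding partition_fn_def
    by (intro sum_pos finite_configs) (auto simp: boltzmann_weight_def)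
qed

lemma prob_space_ising_gauge_measure: "prob_space (ising_gauge_measure N \<beta>)"
proof
  have "emeasure (ising_gauge_measure N \<beta>) (space (ising_gauge_measure N \<beta>)) =
        (\<Sum>\<sigma>\<in>configs N. ennreal (boltzmann_weight N \<beta> \<sigma> / partition_fn N \<beta>))"
    by (simp add: ising_gauge_measure_def space_point_measure emeasure_point_measure_finite
          finite_configs)
  also have "\<dots> = ennreal (\<Sum>\<sigma>\<in>configs N. boltzmann_weight N \<beta> \<sigma> / partition_fn N \<beta>)"
    by (rule sum_ennreal) (simp add: boltzmann_weight_def partition_fn_pos less_imp_le)
  also have "(\<Sum>\<sigma>\<in>configs N. boltzmann_weight N \<beta> \<sigma> / partition_fn N \<beta>) = 1"
    using partition_fn_pos[of N \<beta>]
    by (simp add: sum_divide_distrib[symmetric] partition_fn_def[symmetric])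
  finally show "emeasure (ising_gauge_measure N \<beta>) (space (ising_gauge_measure N \<beta>)) = 1"
    by simp
qed

lemma box_expectation_eq:
  "box_expectation N \<beta> f =
     (\<Sum>\<sigma>\<in>configs N. f \<sigma> * boltzmann_weight N \<beta> \<sigma>) / partition_fn N \<beta>"
  unfolding box_expectation_def ising_gauge_measure_def
  by (subst lebesgue_integral_point_measure_finite)
     (auto simp: finite_configs boltzmann_weight_def partition_fn_pos less_imp_le
        sum_divide_distrib mult.commute)

end

theory Submission
  imports Defs "HOL-Library.Groups_Big_Fun"
begin

text \<open>
Write \<open>t = exp (-12 \<beta>)\<close>, the cost of reversing a single spin in the ordered state, since an edge lies in six
plaquettes; let \<open>\<ell>\<close> and \<open>\<ell>\<^sub>0\<close> be the numbers of edges and of corner edges of the loop, and \<open>r = \<ell>\<^sub>0 / \<ell>\<close>. The theorem says that the Wilson loop decays as if the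
edges of the loop were reversed independently of each other with odds \<open>t\<close>. The proof has an exact part, a
geometric part and a combinatorial part.

The infinite-volume limit exists because adding plaquettes to the box increases the expectation of a Wilson loop
(Griffiths' second inequality, \<open>griffiths_mono\<close>), and the limit is nonnegative by Griffiths' first inequality.

For the upper bound, the spins of the straight (non-corner) edges of the loop are integrated out exactly: no
plaquette contains two of them, so given all other spins they are independent, and each spin \<open>\<sigma> e\<close> may be replaced
by the conditional mean \<open>tanh (\<beta> s)\<close>, where \<open>s\<close> is a sum of six signs (\<open>heat_bath\<close>). Hence the expectation is at
most \<open>tanh (6 \<beta>) ^ n\<close> for \<open>n\<close> straight edges, and \<open>tanh (6 \<beta>) = (1 - t) / (1 + t) \<le> exp (-2 t)\<close>.

For the lower bound, the same formula shows that it is enough to prove that, outside an event of small probability,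
the Wilson loop variable equals the product over the straight edges of the signs of the local sums, and that nearly all
local sums have absolute value 6. The set of plaquettes with sign -1 is a closed 2-cochain modulo 2. It
splits into components, the vortices, each of which is again closed, hence the coboundary of a spin configuration
(\<open>closed_on_box_exact\<close>). Three facts about vortices are used.

\<^item> A vortex that is far from the loop compared with its own size does not change the Wilson loop variable: outside a
cube around the vortex the spin configuration is a gradient, because the complement of a cube in dimension at least 3 has no
first cohomology; and a loop variable of a gradient is 1 (\<open>wilson_loop_unlinked\<close>).

\<^item> The smallest closed sets away from the boundary have six plaquettes and are the sets of plaquettes
around a single edge (\<open>small_closed_is_star\<close>).

\<^item> Peierls' argument: a given closed set \<open>V\<close> consists of negative plaquettes with probability at most
\<open>exp (-2 \<beta> |V|)\<close>, since multiplication by a configuration with coboundary \<open>V\<close> removes it (\<open>peierls\<close>).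

Since a connected set of given size can be chosen in exponentially many ways only, the expected number of vortices
with at least seven plaquettes that are close to the loop is of order \<open>\<ell> exp (-14 \<beta>)\<close>, and that of single-edge vortices
at corner edges is at most \<open>\<ell>\<^sub>0 t\<close>. If there are none of these, every vortex close to the loop
sits around one edge, the loop variable is the product of \<open>-1\<close> over the straight edges that carry such a vortex
(\<open>typical_wilson_loop\<close>), and this agrees with the signs of the local sums (\<open>typical_edge\<close>). Altogether the expectation is
\<open>exp (-2 \<ell> t)\<close> up to an error of order \<open>\<ell> t (exp (-2 \<beta>) + r)\<close>. This is useful if \<open>\<ell> t\<close> is not large; if it is
large, then \<open>exp (-2 \<ell> t)\<close> is itself small, and nonnegativity of the expectation suffices. Balancing the two cases gives the
exponent \<open>1 / 2\<close> (\<open>two_sided_bound\<close>).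
\<close>

section \<open>Closed cochains on the integer lattice\<close>

text \<open>A discrete primitive of a sign-valued function on the integers: it solves \<open>F (s + 1) = F s * f s\<close> with
\<open>F 0 = 1\<close>. The sign group is written multiplicatively, so integration becomes a product.\<close>

definition line_prod :: "(int \<Rightarrow> real) \<Rightarrow> int \<Rightarrow> real" where
  "line_prod f s = (if 0 \<le> s then \<Prod>r\<in>{0..<s}. f r else \<Prod>r\<in>{s..<0}. f r)"

lemma sign_square: "s \<in> {-1, 1::real} \<Longrightarrow> s * s = 1"
  by auto

lemma sign_cancel: "s \<in> {-1, 1::real} \<Longrightarrow> s * (s * b) = b"
  by auto

lemma sign_mult: "s \<in> {-1, 1::real} \<Longrightarrow> t \<in> {-1, 1} \<Longrightarrow> s * t \<in> {-1, 1}"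
  by auto

lemma prod_sign: "(\<And>x. x \<in> A \<Longrightarrow> f x \<in> {-1, 1::real}) \<Longrightarrow> prod f A \<in> {-1, 1}"
proof (induction A rule: infinite_finite_induct)
  case (insert x F)
  then have "prod f F \<in> {-1, 1}" "f x \<in> {-1, 1}" by auto
  then show ?case using insert.hyps by auto
qed auto

lemma line_prod_sign:
  assumes "\<And>r. f r \<in> {-1, 1}"
  shows "line_prod f s \<in> {-1, 1}"
  unfolding line_prod_def using assms prod_sign[of _ f] by presburger

lemma line_prod_step:
  assumes "\<And>r. f r \<in> {-1, 1}"
  shows "line_prod f (s + 1) = line_prod f s * f s"
proof -
  consider "0 \<le> s" | "s = -1" | "s < -1" by linarith
  then show ?thesis
  proof cases
    case 1
    then have "{0..<s+1} = insert s {0..<s}" by auto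
    with 1 show ?thesis by (simp add: line_prod_def)
  next
    case 2
    have "{-1..<0::int} = {-1}" by auto
    with 2 show ?thesis using assms[of "-1"] by (auto simp: line_prod_def)
  next
    case 3
    then have "{s..<0} = insert s {s+1..<0}" by auto
    with 3 show ?thesis using assms[of s] by (auto simp: line_prod_def)
  qed
qed

definition set_coord :: "int ^ 'n \<Rightarrow> 'n \<Rightarrow> int \<Rightarrow> int ^ 'n" where
  "set_coord x i s = (\<chi> k. if k = i then s else x $ k)"

lemma set_coord_nth [simp]: "set_coord x i s $ k = (if k = i then s else x $ k)"
  by (simp add: set_coord_def)

lemma set_coord_same [simp]: "set_coord x i (x $ i) = x"
  by (simp add: vec_eq_iff)

lemma set_coord_add_axis_same [simp]: "set_coord (x + axis i t) i s = set_coord x i s"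
  by (simp add: vec_eq_iff axis_def)

lemma set_coord_add_axis: "k \<noteq> i \<Longrightarrow> set_coord (x + axis k t) i s = set_coord x i s + axis k t"
  by (auto simp: vec_eq_iff axis_def)

lemma axis_nth_int [simp]: "(axis i t :: int ^ 'n) $ k = (if k = i then t else 0)"
  by (simp add: axis_def)

text \<open>The Poincare lemma in degree 1. One direction is eliminated at a time: subtracting the gradient of
the line integral in direction \<open>i\<close> makes the cochain trivial in direction \<open>i\<close>, and closedness shows that directions in which
the cochain is already trivial remain so, because the line integral does not depend on those coordinates. The induction
runs over the set of directions that are not yet trivial.\<close>

lemma closed_1cochain_exact:
  fixes a :: "int ^ 'n \<Rightarrow> 'n \<Rightarrow> real"
  assumes "\<And>x i. a x i \<in> {-1, 1}"
    and "\<And>x i j. a x i * a (x + axis i 1) j * a (x + axis j 1) i * a x j = 1"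
  shows "\<exists>g. (\<forall>x. g x \<in> {-1, 1}) \<and> (\<forall>x i. a x i = g x * g (x + axis i 1))"
proof -
  have "\<exists>g. (\<forall>x. g x \<in> {-1, 1}) \<and> (\<forall>x i. a x i = g x * g (x + axis i 1))"
    if "finite K" "\<And>k x. k \<notin> K \<Longrightarrow> a x k = 1"
       "\<And>x i. a x i \<in> {-1, 1}"
       "\<And>x i j. a x i * a (x + axis i 1) j * a (x + axis j 1) i * a x j = 1"
    for K and a :: "int ^ 'n \<Rightarrow> 'n \<Rightarrow> real"
    using that
  proof (induction K arbitrary: a rule: finite_induct)
    case empty
    then show ?case by (intro exI[of _ "\<lambda>_. 1"]) auto
  next
    case (insert i K)
    note triv = insert.prems(1) and sgn = insert.prems(2) and closed = insert.prems(3)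
    note sq = sign_square[OF sgn] sign_cancel[OF sgn]
    define g where "g x = line_prod (\<lambda>s. a (set_coord x i s) i) (x $ i)" for x
    have g_sign: "g x \<in> {-1, 1}" for x
      unfolding g_def by (rule line_prod_sign[OF sgn])
    note sqg = sign_square[OF g_sign] sign_cancel[OF g_sign]
    have g_step: "g (x + axis i 1) = g x * a x i" for x
      unfolding g_def using line_prod_step[of "\<lambda>s. a (set_coord x i s) i" "x $ i", OF sgn] by simp
    define a' where "a' x k = a x k * g x * g (x + axis k 1)" for x k
    have a'_sign: "a' x k \<in> {-1, 1}" for x k
      unfolding a'_def by (intro sign_mult sgn g_sign)
    have triv': "a' x k = 1" if "k \<notin> K" for x k
    proof (cases "k = i")
      case True
      then show ?thesis by (simp add: a'_def g_step sq sqg ac_simps)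
    next
      case False
      with that have k: "k \<notin> insert i K" by simp
      have "a y i = a (y + axis k 1) i" for y
        using closed[of y i k] triv[OF k] sgn[of y i] sgn[of "y + axis k 1" i] by auto
      then have "g (x + axis k 1) = g x"
        unfolding g_def using False by (simp add: set_coord_add_axis)
      then show ?thesis by (simp add: a'_def triv[OF k] sqg)
    qed
    have closed': "a' x k * a' (x + axis k 1) j * a' (x + axis j 1) k * a' x j = 1" for x k j
      using closed[of x k j] by (simp add: a'_def sqg ac_simps)
    from insert.IH[of a', OF triv' a'_sign closed'] obtain h where
      h: "\<And>x. h x \<in> {-1, 1}" "\<And>x k. a' x k = h x * h (x + axis k 1)"
      by blast
    have "a x k = (g x * h x) * (g (x + axis k 1) * h (x + axis k 1))" for x k
    proof -
      have "a x k = a' x k * g x * g (x + axis k 1)"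
        by (simp add: a'_def sqg ac_simps)
      then show ?thesis by (simp add: h(2) ac_simps)
    qed
    moreover have "g x * h x \<in> {-1, 1}" for x by (intro sign_mult g_sign h(1))
    ultimately show ?case by (intro exI[of _ "\<lambda>x. g x * h x"]) auto
  qed
  from this[of UNIV a] assms show ?thesis by auto
qed

text \<open>The coboundary of a 1-cochain at the square with lower corner \<open>x\<close> and directions \<open>i\<close>, \<open>j\<close>.\<close>

definition cobound :: "(int ^ 'n \<Rightarrow> 'n \<Rightarrow> real) \<Rightarrow> int ^ 'n \<Rightarrow> 'n \<Rightarrow> 'n \<Rightarrow> real" where
  "cobound a x i j = a x i * a (x + axis i 1) j * a (x + axis j 1) i * a x j"

text \<open>The coboundary of a 2-cochain: the product over the six faces of the cube with lower corner \<open>x\<close>.\<close>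

definition cube_prod :: "(int ^ 'n \<Rightarrow> 'n \<Rightarrow> 'n \<Rightarrow> real) \<Rightarrow> int ^ 'n \<Rightarrow> 'n \<Rightarrow> 'n \<Rightarrow> 'n \<Rightarrow> real" where
  "cube_prod v x i j k = v x i j * v (x + axis k 1) i j * v x i k * v (x + axis j 1) i k
     * v x j k * v (x + axis i 1) j k"

lemma cobound_sign: "(\<And>x i. a x i \<in> {-1, 1}) \<Longrightarrow> cobound a x i j \<in> {-1, 1}"
  unfolding cobound_def by (intro sign_mult)

lemma cobound_sym: "cobound a x i j = cobound a x j i"
  by (simp add: cobound_def ac_simps)

text \<open>Each of the twelve edges of a cube lies in two of its faces.\<close>

lemma cube_prod_cobound:
  assumes sgn: "\<And>x i. a x i \<in> {-1, 1}"
  shows "cube_prod (cobound a) x i j k = 1"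
  by (simp add: cube_prod_def cobound_def sign_square[OF sgn] sign_cancel[OF sgn] ac_simps)

lemma cube_prod_mult:
  "cube_prod (\<lambda>x i j. v x i j * w x i j) x i j k = cube_prod v x i j k * cube_prod w x i j k"
  by (simp add: cube_prod_def ac_simps)

text \<open>The Poincare lemma in degree 2, by the same elimination of directions: the potential for the components
\<open>v x i j\<close> with fixed \<open>i\<close> is obtained by integrating along direction \<open>i\<close>, and subtracting its coboundary kills all
components that involve \<open>i\<close>.\<close>

lemma closed_2cochain_exact:
  fixes v :: "int ^ 'n \<Rightarrow> 'n \<Rightarrow> 'n \<Rightarrow> real"
  assumes "\<And>x i j. v x i j \<in> {-1, 1}"
    and "\<And>x i j. v x i j = v x j i"
    and "\<And>x i j k. distinct [i, j, k] \<Longrightarrow> cube_prod v x i j k = 1"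
  shows "\<exists>a. (\<forall>x i. a x i \<in> {-1, 1}) \<and> (\<forall>x i j. i \<noteq> j \<longrightarrow> v x i j = cobound a x i j)"
proof -
  have "\<exists>a. (\<forall>x i. a x i \<in> {-1, 1}) \<and> (\<forall>x i j. i \<noteq> j \<longrightarrow> v x i j = cobound a x i j)"
    if "finite K" "\<And>k x j. k \<notin> K \<Longrightarrow> k \<noteq> j \<Longrightarrow> v x k j = 1"
       "\<And>x i j. v x i j \<in> {-1, 1}"
       "\<And>x i j. v x i j = v x j i"
       "\<And>x i j k. distinct [i, j, k] \<Longrightarrow> cube_prod v x i j k = 1"
    for K and v :: "int ^ 'n \<Rightarrow> 'n \<Rightarrow> 'n \<Rightarrow> real"
    using that
  proof (induction K arbitrary: v rule: finite_induct)
    case empty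
    then show ?case by (intro exI[of _ "\<lambda>_ _. 1"]) (auto simp: cobound_def)
  next
    case (insert i K)
    note triv = insert.prems(1) and sgn = insert.prems(2) and sym = insert.prems(3)
      and closed = insert.prems(4)
    note sq = sign_square[OF sgn] sign_cancel[OF sgn]
    define b where
      "b x j = (if j = i then 1 else line_prod (\<lambda>s. v (set_coord x i s) i j) (x $ i))" for x j
    have b_sign: "b x j \<in> {-1, 1}" for x j
      unfolding b_def using line_prod_sign[OF sgn] by auto
    note sqb = sign_square[OF b_sign] sign_cancel[OF b_sign]
    have b_step: "b (x + axis i 1) j = b x j * v x i j" if "j \<noteq> i" for x j
      unfolding b_def
      using line_prod_step[of "\<lambda>s. v (set_coord x i s) i j" "x $ i", OF sgn] that by simp
    define v' where "v' x k j = v x k j * cobound b x k j" for x k j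
    have v'_sign: "v' x k j \<in> {-1, 1}" for x k j
      unfolding v'_def by (intro sign_mult sgn cobound_sign b_sign)
    have v'_sym: "v' x k j = v' x j k" for x k j
      using sym cobound_sym unfolding v'_def by metis
    have triv': "v' x k j = 1" if "k \<notin> K" "k \<noteq> j" for x k j
    proof -
      have bi: "b z i = 1" for z by (simp add: b_def)
      have i_triv: "v' x i j = 1" if "j \<noteq> i" for x j
      proof -
        have "cobound b x i j = v x i j"
          using that by (simp add: cobound_def b_step bi sqb ac_simps)
        then show ?thesis by (simp add: v'_def sq)
      qed
      consider "k = i" | "k \<noteq> i" "j = i" | "k \<noteq> i" "j \<noteq> i" by blast
      then show ?thesis
      proof cases
        case 1
        with that i_triv show ?thesis by simp
      next
        case 2
        then show ?thesis using i_triv[of k x] v'_sym by metis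
      next
        case 3
        with that have k: "k \<notin> insert i K" by simp
        have bk: "b y k = 1" for y
        proof -
          have "v z i k = 1" for z
            using triv[OF k, of i z] sym[of z i k] 3 by simp
          then show ?thesis using line_prod_def[of "\<lambda>_. 1"] by (simp add: b_def 3)
        qed
        have "v (y + axis k 1) i j = v y i j" for y
        proof -
          have "cube_prod v y i j k = 1" using closed 3 that by auto
          moreover have "v z i k = 1" "v z j k = 1" for z
            using triv[OF k, of i z] triv[OF k, of j z] sym[of z i k] sym[of z j k] 3 that by auto
          ultimately show ?thesis
            using sgn[of y i j] sgn[of "y + axis k 1" i j] by (auto simp: cube_prod_def)
        qed
        then have "b (x + axis k 1) j = b x j"
          unfolding b_def using 3 by (simp add: set_coord_add_axis)
        then show ?thesis using that by (simp add: v'_def cobound_def bk sqb triv[OF k])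
      qed
    qed
    have closed': "cube_prod v' x k j l = 1" if "distinct [k, j, l]" for x k j l
      using closed[OF that] cube_prod_cobound[of b x k j l, OF b_sign]
      unfolding v'_def by (simp add: cube_prod_mult)
    from insert.IH[of v', OF triv' v'_sign v'_sym closed'] obtain c where
      "(\<forall>x k. c x k \<in> {-1, 1}) \<and> (\<forall>x k j. k \<noteq> j \<longrightarrow> v' x k j = cobound c x k j)"
      by (rule exE)
    then have c: "\<And>x k. c x k \<in> {-1, 1}" "\<And>x k j. k \<noteq> j \<Longrightarrow> v' x k j = cobound c x k j"
      by auto
    have "v x k j = cobound (\<lambda>x k. b x k * c x k) x k j" if "k \<noteq> j" for x k j
    proof -
      have "v x k j = v' x k j * cobound b x k j"
        by (simp add: v'_def sign_square[OF cobound_sign[OF b_sign]] ac_simps)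
      also have "\<dots> = cobound (\<lambda>x k. b x k * c x k) x k j"
        by (simp add: c(2)[OF that]) (simp add: cobound_def ac_simps)
      finally show ?thesis .
    qed
    moreover have "b x k * c x k \<in> {-1, 1}" for x k by (intro sign_mult b_sign c(1))
    ultimately show ?case by (intro exI[of _ "\<lambda>x k. b x k * c x k"]) auto
  qed
  from this[of UNIV v] assms show ?thesis by auto
qed

section \<open>Cochains on boxes and outside cubes\<close>

definition lattice_box :: "int ^ 'n \<Rightarrow> int ^ 'n \<Rightarrow> (int ^ 'n) set" where
  "lattice_box lo hi = {x. \<forall>k. lo $ k \<le> x $ k \<and> x $ k \<le> hi $ k}"

lemma lattice_box_Int:
  "lattice_box a b \<inter> lattice_box c d
     = lattice_box (\<chi> k. max (a $ k) (c $ k)) (\<chi> k. min (b $ k) (d $ k))"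
  by (auto simp: lattice_box_def)

text \<open>Boxes are connected.\<close>

lemma lattice_box_const:
  fixes h :: "int ^ 'n \<Rightarrow> 'a"
  assumes step: "\<And>x i. x \<in> lattice_box lo hi \<Longrightarrow> x + axis i 1 \<in> lattice_box lo hi \<Longrightarrow>
      h (x + axis i 1) = h x"
    and x: "x \<in> lattice_box lo hi" and y: "y \<in> lattice_box lo hi"
  shows "h x = h y"
proof -
  have coord: "h (set_coord x i s) = h x"
    if x: "x \<in> lattice_box lo hi" and s: "lo $ i \<le> s" "s \<le> hi $ i" for x i s
  proof -
    have mem: "set_coord x i s \<in> lattice_box lo hi" if "lo $ i \<le> s" "s \<le> hi $ i" for s
      using that x by (auto simp: lattice_box_def)
    have low: "s \<le> hi $ i \<longrightarrow> h (set_coord x i s) = h (set_coord x i (lo $ i))"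
      if "lo $ i \<le> s" for s
      using that
    proof (induction s rule: int_ge_induct)
      case (step s)
      have eq: "set_coord x i (s + 1) = set_coord x i s + axis i 1"
        by (simp add: vec_eq_iff)
      show ?case
      proof
        assume "s + 1 \<le> hi $ i"
        then have "h (set_coord x i s + axis i 1) = h (set_coord x i s)"
          using assms(1)[of "set_coord x i s" i] mem[of s] mem[of "s + 1"] step.hyps by (simp add: eq)
        then show "h (set_coord x i (s + 1)) = h (set_coord x i (lo $ i))"
          using step.IH \<open>s + 1 \<le> hi $ i\<close> by (simp add: eq)
      qed
    qed simp
    have "lo $ i \<le> x $ i" "x $ i \<le> hi $ i" using x by (auto simp: lattice_box_def)
    then show ?thesis using low[of s] low[of "x $ i"] s by simp
  qed
  have "\<forall>y\<in>lattice_box lo hi. (\<forall>k. k \<notin> K \<longrightarrow> y $ k = x $ k) \<longrightarrow> h y = h x" if "finite K" for K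
    using that
  proof (induction K rule: finite_induct)
    case empty
    then show ?case by (metis emptyE vec_eq_iff)
  next
    case (insert i K)
    show ?case
    proof (intro ballI impI)
      fix y assume y: "y \<in> lattice_box lo hi" "\<forall>k. k \<notin> insert i K \<longrightarrow> y $ k = x $ k"
      have xi: "lo $ i \<le> x $ i" "x $ i \<le> hi $ i" using x by (auto simp: lattice_box_def)
      have "h (set_coord y i (x $ i)) = h x"
        using insert.IH y xi by (auto simp: lattice_box_def)
      then show "h y = h x" using coord[OF y(1) xi] by simp
    qed
  qed
  from this[of UNIV] y show ?thesis by simp
qed

text \<open>The coordinatewise retraction of the lattice onto a box. Pulling cochains back along it extends closed cochains on
a box to closed cochains on the whole lattice, which makes boundaries invisible to the Poincare lemmas.\<close>

definition clamp_to :: "int ^ 'n \<Rightarrow> int ^ 'n \<Rightarrow> int ^ 'n \<Rightarrow> int ^ 'n" where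
  "clamp_to lo hi x = (\<chi> k. max (lo $ k) (min (x $ k) (hi $ k)))"

lemma clamp_to_add_axis:
  assumes "\<And>k. lo $ k \<le> hi $ k"
  shows "clamp_to lo hi (x + axis j 1)
    = (if lo $ j \<le> x $ j \<and> x $ j < hi $ j then clamp_to lo hi x + axis j 1 else clamp_to lo hi x)"
  using assms[of j] by (auto simp: clamp_to_def vec_eq_iff)

lemma clamp_to_id: "x \<in> lattice_box lo hi \<Longrightarrow> clamp_to lo hi x = x"
  by (auto simp: clamp_to_def lattice_box_def vec_eq_iff max_def min_def)

lemma lattice_box_nonempty_iff: "x \<in> lattice_box lo hi \<Longrightarrow> lo $ k \<le> hi $ k"
  by (auto simp: lattice_box_def intro: order_trans)

text \<open>The pullback of the cochain along the retraction onto the box is closed everywhere: edges that the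
retraction collapses carry the value 1, and a square with a collapsed direction has two equal sides left.\<close>

lemma closed_1cochain_exact_on_box:
  fixes a :: "int ^ 'n \<Rightarrow> 'n \<Rightarrow> real"
  assumes sgn: "\<And>x i. a x i \<in> {-1, 1}"
    and closed: "\<And>x i j. i \<noteq> j \<Longrightarrow> x \<in> lattice_box lo hi \<Longrightarrow>
      x + axis i 1 + axis j 1 \<in> lattice_box lo hi \<Longrightarrow> cobound a x i j = 1"
  shows "\<exists>g. (\<forall>x. g x \<in> {-1, 1}) \<and>
    (\<forall>x i. x \<in> lattice_box lo hi \<and> x + axis i 1 \<in> lattice_box lo hi \<longrightarrow>
      a x i = g x * g (x + axis i 1))"
proof (cases "\<forall>k. lo $ k \<le> hi $ k")
  case False
  then show ?thesis using lattice_box_nonempty_iff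
    by (intro exI[of _ "\<lambda>_. 1"]) blast
next
  case True
  then have le: "\<And>k. lo $ k \<le> hi $ k" by simp
  define a' where
    "a' x i = (if lo $ i \<le> x $ i \<and> x $ i < hi $ i then a (clamp_to lo hi x) i else 1)" for x i
  have sgn': "a' x i \<in> {-1, 1}" for x i using sgn by (auto simp: a'_def)
  have closed': "a' x i * a' (x + axis i 1) j * a' (x + axis j 1) i * a' x j = 1" for x i j
  proof (cases "i = j")
    case True
    then show ?thesis using sgn'[of x i] sgn'[of "x + axis i 1" i] by auto
  next
    case False
    define c where "c = clamp_to lo hi x"
    show ?thesis
    proof (cases "lo $ i \<le> x $ i \<and> x $ i < hi $ i \<and> lo $ j \<le> x $ j \<and> x $ j < hi $ j")
      case True
      then have "c \<in> lattice_box lo hi" "c + axis i 1 + axis j 1 \<in> lattice_box lo hi"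
        using le False by (auto simp: c_def clamp_to_def lattice_box_def)
      then show ?thesis
        using closed[OF False, of c] True False
        by (simp add: a'_def clamp_to_add_axis[OF le] cobound_def c_def)
    next
      case 2: False
      show ?thesis
        using 2 False sign_square[OF sgn, of c i] sign_square[OF sgn, of c j]
        by (auto simp: a'_def clamp_to_add_axis[OF le] c_def)
    qed
  qed
  from closed_1cochain_exact[of a', OF sgn' closed'] obtain g where
    g: "\<And>x. g x \<in> {-1, 1}" "\<And>x i. a' x i = g x * g (x + axis i 1)"
    by blast
  have "a x i = g x * g (x + axis i 1)"
    if "x \<in> lattice_box lo hi" "x + axis i 1 \<in> lattice_box lo hi" for x i
  proof -
    have "lo $ i \<le> x $ i" "x $ i + 1 \<le> hi $ i"
      using that(1) that(2)[unfolded lattice_box_def] by (auto simp: lattice_box_def dest: spec[of _ i])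
    then have "a' x i = a x i" using that by (simp add: a'_def clamp_to_id)
    then show ?thesis using g(2) by simp
  qed
  with g(1) show ?thesis by blast
qed

lemma closed_2cochain_exact_on_box:
  fixes v :: "int ^ 'n \<Rightarrow> 'n \<Rightarrow> 'n \<Rightarrow> real"
  assumes sgn: "\<And>x i j. v x i j \<in> {-1, 1}"
    and sym: "\<And>x i j. v x i j = v x j i"
    and closed: "\<And>x i j k. distinct [i, j, k] \<Longrightarrow> x \<in> lattice_box lo hi \<Longrightarrow>
      x + axis i 1 + axis j 1 + axis k 1 \<in> lattice_box lo hi \<Longrightarrow> cube_prod v x i j k = 1"
  shows "\<exists>a. (\<forall>x i. a x i \<in> {-1, 1}) \<and>
    (\<forall>x i j. i \<noteq> j \<and> x \<in> lattice_box lo hi \<and> x + axis i 1 + axis j 1 \<in> lattice_box lo hi \<longrightarrow>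
      v x i j = cobound a x i j)"
proof (cases "\<forall>k. lo $ k \<le> hi $ k")
  case False
  then show ?thesis using lattice_box_nonempty_iff
    by (intro exI[of _ "\<lambda>_ _. 1"]) blast
next
  case True
  then have le: "\<And>k. lo $ k \<le> hi $ k" by simp
  define inn where "inn x i \<longleftrightarrow> lo $ i \<le> x $ i \<and> x $ i < hi $ i" for x i
  define v' where
    "v' x i j = (if inn x i \<and> inn x j then v (clamp_to lo hi x) i j else 1)" for x i j
  have sgn': "v' x i j \<in> {-1, 1}" for x i j using sgn by (auto simp: v'_def)
  have sym': "v' x i j = v' x j i" for x i j
    unfolding v'_def using sym[of "clamp_to lo hi x" i j] by auto
  have inn_add: "inn (x + axis i 1) j = inn x j" if "i \<noteq> j" for x i j
    using that by (simp add: inn_def)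
  have clamp: "clamp_to lo hi (x + axis j 1) = (if inn x j then clamp_to lo hi x + axis j 1 else clamp_to lo hi x)"
    for x j using clamp_to_add_axis[OF le] by (simp add: inn_def)
  have closed': "cube_prod v' x i j k = 1" if ijk: "distinct [i, j, k]" for x i j k
  proof -
    have ne: "i \<noteq> j" "j \<noteq> i" "i \<noteq> k" "k \<noteq> i" "j \<noteq> k" "k \<noteq> j" using ijk by auto
    define c where "c = clamp_to lo hi x"
    show ?thesis
    proof (cases "inn x i \<and> inn x j \<and> inn x k")
      case True
      then have "c \<in> lattice_box lo hi" "c + axis i 1 + axis j 1 + axis k 1 \<in> lattice_box lo hi"
        using le ijk by (auto simp: c_def clamp_to_def lattice_box_def inn_def)
      from closed[OF ijk this] show ?thesis
        using True ne by (simp add: cube_prod_def v'_def clamp inn_add c_def)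
    next
      case False
      have "v c i j * v c i j = 1" "v c i k * v c i k = 1" "v c j k * v c j k = 1"
        using sign_square[OF sgn] by auto
      with False ne show ?thesis
        by (auto simp: cube_prod_def v'_def clamp inn_add c_def)
    qed
  qed
  have "\<exists>a. (\<forall>x i. a x i \<in> {-1, 1}) \<and> (\<forall>x i j. i \<noteq> j \<longrightarrow> v' x i j = cobound a x i j)"
    by (rule closed_2cochain_exact[of v', OF sgn' sym' closed'])
  then obtain a where
    "(\<forall>x i. a x i \<in> {-1, 1}) \<and> (\<forall>x i j. i \<noteq> j \<longrightarrow> v' x i j = cobound a x i j)"
    by (rule exE)
  then have a: "\<forall>x i. a x i \<in> {-1, 1}" "\<And>x i j. i \<noteq> j \<Longrightarrow> v' x i j = cobound a x i j"
    by auto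
  have "v x i j = cobound a x i j"
    if "i \<noteq> j" "x \<in> lattice_box lo hi" "x + axis i 1 + axis j 1 \<in> lattice_box lo hi" for x i j
  proof -
    have "lo $ i \<le> x $ i" "x $ i + 1 \<le> hi $ i" "lo $ j \<le> x $ j" "x $ j + 1 \<le> hi $ j"
      using that(1,2) that(3)[unfolded lattice_box_def]
      by (auto simp: lattice_box_def dest: spec[of _ i] spec[of _ j])
    then have "v' x i j = v x i j" using that by (simp add: v'_def inn_def clamp_to_id)
    then show ?thesis using a(2)[OF that(1)] by simp
  qed
  with a(1) show ?thesis by blast
qed

text \<open>The part of the box on one side of a cube with centre \<open>c\<close>: coordinate \<open>fst \<alpha>\<close> exceeds that of the centre by at least
\<open>r\<close>, or falls below it by at least \<open>r\<close>, according to \<open>snd \<alpha>\<close>. These slabs cover the complement of the open cube and are boxes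
themselves.\<close>

definition outer_slab :: "int ^ 'n \<Rightarrow> int ^ 'n \<Rightarrow> int ^ 'n \<Rightarrow> int \<Rightarrow> 'n \<times> bool \<Rightarrow> (int ^ 'n) set" where
  "outer_slab lo hi c r \<alpha> = lattice_box
     (\<chi> k. if k = fst \<alpha> \<and> snd \<alpha> then max (lo $ k) (c $ k + r) else lo $ k)
     (\<chi> k. if k = fst \<alpha> \<and> \<not> snd \<alpha> then min (hi $ k) (c $ k - r) else hi $ k)"

lemma mem_outer_slab:
  "x \<in> outer_slab lo hi c r \<alpha> \<longleftrightarrow> x \<in> lattice_box lo hi \<and>
     (if snd \<alpha> then c $ fst \<alpha> + r \<le> x $ fst \<alpha> else x $ fst \<alpha> \<le> c $ fst \<alpha> - r)"
  by (cases \<alpha>) (auto simp: outer_slab_def lattice_box_def split: if_splits)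

text \<open>The first cohomology of the part of a box outside a cube vanishes in dimension at least 3. Each slab is a box, so the cochain
has a primitive there, unique up to sign. The primitives can be matched: slabs in three different directions have a common point as soon as
they are nonempty, and opposite slabs are disjoint. Therefore one fixes a nonempty slab in each direction,
normalises these against one of them, and normalises every slab against a fixed slab in another direction; a triple intersection
shows that the choice of that direction is irrelevant. The assumption \<open>room\<close> provides a nonempty slab in every direction;
on the other side the cube may extend beyond the box.\<close>

lemma exact_outside_cube:
  fixes a :: "int ^ 'n \<Rightarrow> 'n \<Rightarrow> real"
  assumes card: "CARD('n) \<ge> 3"
    and sgn: "\<And>x i. a x i \<in> {-1, 1}"
    and r: "r > 0"
    and lohi: "\<And>k. lo $ k \<le> hi $ k"
    and room: "\<And>k. c $ k + r \<le> hi $ k \<or> lo $ k \<le> c $ k - r"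
    and closed: "\<And>x i j \<alpha>. i \<noteq> j \<Longrightarrow> x \<in> outer_slab lo hi c r \<alpha> \<Longrightarrow>
      x + axis i 1 + axis j 1 \<in> outer_slab lo hi c r \<alpha> \<Longrightarrow> cobound a x i j = 1"
  shows "\<exists>g. (\<forall>x. g x \<in> {-1, 1}) \<and>
    (\<forall>\<alpha> x i. x \<in> outer_slab lo hi c r \<alpha> \<and> x + axis i 1 \<in> outer_slab lo hi c r \<alpha> \<longrightarrow>
      a x i = g x * g (x + axis i 1))"
proof -
  let ?U = "outer_slab lo hi c r"
  define prim where "prim g \<alpha> \<longleftrightarrow> (\<forall>x. g x \<in> {-1, 1}) \<and>
    (\<forall>x i. x \<in> ?U \<alpha> \<and> x + axis i 1 \<in> ?U \<alpha> \<longrightarrow> a x i = g x * g (x + axis i 1))"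
    for g :: "int ^ 'n \<Rightarrow> real" and \<alpha>
  define agree where "agree g \<alpha> g' \<beta> \<longleftrightarrow> (\<forall>x \<in> ?U \<alpha> \<inter> ?U \<beta>. g x = g' x)"
    for g g' :: "int ^ 'n \<Rightarrow> real" and \<alpha> \<beta>
  have prim_ex: "\<exists>g. prim g \<alpha>" for \<alpha>
    unfolding prim_def outer_slab_def
    by (rule closed_1cochain_exact_on_box[OF sgn closed[of _ _ _ \<alpha>, unfolded outer_slab_def]])
  have agreeI: "agree g \<alpha> g' \<beta>"
    if p: "prim g \<alpha>" "prim g' \<beta>" and z: "z \<in> ?U \<alpha>" "z \<in> ?U \<beta>" "g z = g' z" for g g' \<alpha> \<beta> z
    unfolding agree_def
  proof
    fix x assume x: "x \<in> ?U \<alpha> \<inter> ?U \<beta>"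
    have g: "g y \<in> {-1, 1}" "g' y \<in> {-1, 1}" for y using p by (auto simp: prim_def)
    obtain l u where lu: "?U \<alpha> \<inter> ?U \<beta> = lattice_box l u"
      unfolding outer_slab_def lattice_box_Int by blast
    have "g x * g' x = g z * g' z"
    proof (rule lattice_box_const[where h = "\<lambda>x. g x * g' x"])
      show "x \<in> lattice_box l u" "z \<in> lattice_box l u" using x z(1,2) lu by auto
      fix y i
      assume "y \<in> lattice_box l u" "y + axis i 1 \<in> lattice_box l u"
      then have "y \<in> ?U \<alpha> \<inter> ?U \<beta>" "y + axis i 1 \<in> ?U \<alpha> \<inter> ?U \<beta>" using lu by auto
      then have "a y i = g y * g (y + axis i 1)" and "a y i = g' y * g' (y + axis i 1)"
        using p unfolding prim_def by blast+
      then show "g (y + axis i 1) * g' (y + axis i 1) = g y * g' y"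
        using g(1)[of y] g(1)[of "y + axis i 1"] g(2)[of y] g(2)[of "y + axis i 1"] by auto
    qed
    then show "g x = g' x" using z(3) g(1)[of x] g(2)[of x] g(1)[of z] g(2)[of z] by auto
  qed
  have normalise: "\<exists>g. prim g \<alpha> \<and> agree g \<alpha> g' \<beta>"
    if "prim g' \<beta>" "z \<in> ?U \<alpha>" "z \<in> ?U \<beta>" for g' \<alpha> \<beta> z
  proof -
    obtain g where g: "prim g \<alpha>" using prim_ex by blast
    define s where "s = g z * g' z"
    have sg: "g y \<in> {-1, 1}" "g' y \<in> {-1, 1}" for y using g that(1) by (auto simp: prim_def)
    have s: "s \<in> {-1, 1}" unfolding s_def by (intro sign_mult sg)
    have "prim (\<lambda>x. s * g x) \<alpha>"
      using g s sign_mult[OF s sg(1)] by (auto simp: prim_def)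
    moreover have "s * g z = g' z" using sg(1)[of z] sg(2)[of z] by (auto simp: s_def)
    ultimately show ?thesis using agreeI[OF _ that(1,2,3)] by blast
  qed
  have triple: "\<exists>z. z \<in> ?U \<alpha> \<and> z \<in> ?U \<beta> \<and> z \<in> ?U \<gamma>"
    if ne: "?U \<alpha> \<noteq> {}" "?U \<beta> \<noteq> {}" "?U \<gamma> \<noteq> {}"
      and d: "fst \<alpha> \<noteq> fst \<beta>" "fst \<alpha> \<noteq> fst \<gamma>" "fst \<beta> \<noteq> fst \<gamma>" for \<alpha> \<beta> \<gamma>
  proof -
    obtain x y z where xyz: "x \<in> ?U \<alpha>" "y \<in> ?U \<beta>" "z \<in> ?U \<gamma>" using ne by blast
    define w where "w = (\<chi> k. if k = fst \<alpha> then x $ k else if k = fst \<beta> then y $ k else z $ k)"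
    have "w \<in> ?U \<alpha> \<and> w \<in> ?U \<beta> \<and> w \<in> ?U \<gamma>"
      using xyz d unfolding mem_outer_slab by (auto simp: w_def lattice_box_def)
    then show ?thesis by blast
  qed
  \<comment> \<open>The only use of the dimension: two directions always leave a third one.\<close>
  have third: "\<exists>k. k \<noteq> i \<and> k \<noteq> j" for i j :: 'n
  proof (rule ccontr)
    assume "\<not> ?thesis"
    then have "(UNIV :: 'n set) \<subseteq> {i, j}" by auto
    then have "CARD('n) \<le> card {i, j}" by (intro card_mono) auto
    then show False using card card_insert_le_m1[of 2 "{j}" i] by simp
  qed
  have "\<exists>s. ?U (k, s) \<noteq> {}" for k
  proof -
    consider "c $ k + r \<le> hi $ k" | "lo $ k \<le> c $ k - r" using room by blast
    then show ?thesis
    proof cases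
      case 1
      then have "hi \<in> ?U (k, True)" using lohi by (auto simp: mem_outer_slab lattice_box_def)
      then show ?thesis by blast
    next
      case 2
      then have "lo \<in> ?U (k, False)" using lohi by (auto simp: mem_outer_slab lattice_box_def)
      then show ?thesis by blast
    qed
  qed
  then obtain s where s: "\<And>k. ?U (k, s k) \<noteq> {}" by metis
  define B where "B k = (k, s k)" for k
  have B: "?U (B k) \<noteq> {}" "fst (B k) = k" for k using s by (auto simp: B_def)
  have pair: "\<exists>z. z \<in> ?U \<alpha> \<and> z \<in> ?U \<beta>"
    if "?U \<alpha> \<noteq> {}" "?U \<beta> \<noteq> {}" "fst \<alpha> \<noteq> fst \<beta>" for \<alpha> \<beta>
  proof -
    obtain k where "k \<noteq> fst \<alpha>" "k \<noteq> fst \<beta>" using third by blast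
    then show ?thesis using triple[of \<alpha> \<beta> "B k"] that B by force
  qed
  define k0 :: 'n where "k0 = undefined"
  obtain g0 where g0: "prim g0 (B k0)" using prim_ex by blast
  have "\<exists>g. prim g (B k) \<and> agree g (B k) g0 (B k0)" for k
  proof (cases "k = k0")
    case True
    then show ?thesis using g0 by (auto simp: agree_def)
  next
    case False
    then obtain z where "z \<in> ?U (B k)" "z \<in> ?U (B k0)" using pair[of "B k" "B k0"] B by auto
    from normalise[OF g0 this] show ?thesis .
  qed
  then obtain G where G: "\<And>k. prim (G k) (B k)" "\<And>k. agree (G k) (B k) g0 (B k0)" by metis
  have GG: "agree (G k) (B k) (G l) (B l)" if kl: "k \<noteq> l" for k l
  proof (cases "k = k0 \<or> l = k0")
    case True
    have gk0: "G k0 x = g0 x" if "x \<in> ?U (B k0)" for x using G(2)[of k0] that by (auto simp: agree_def)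
    show ?thesis using True G(2)[of k] G(2)[of l] gk0 by (auto simp: agree_def)
  next
    case False
    then obtain z where z: "z \<in> ?U (B k)" "z \<in> ?U (B l)" "z \<in> ?U (B k0)"
      using triple[of "B k" "B l" "B k0"] B kl by auto
    then have "G k z = G l z" using G(2)[of k] G(2)[of l] by (auto simp: agree_def)
    then show ?thesis using agreeI[OF G(1) G(1) z(1,2)] by blast
  qed
  have "\<exists>g. prim g \<alpha> \<and> (\<forall>k. k \<noteq> fst \<alpha> \<longrightarrow> agree g \<alpha> (G k) (B k))" for \<alpha>
  proof (cases "?U \<alpha> = {}")
    case True
    then show ?thesis using prim_ex by (auto simp: agree_def)
  next
    case False
    obtain l where l: "l \<noteq> fst \<alpha>" using third by blast
    then obtain z where z: "z \<in> ?U \<alpha>" "z \<in> ?U (B l)" using pair[OF False B(1)[of l]] B(2) by auto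
    obtain g where g: "prim g \<alpha>" "agree g \<alpha> (G l) (B l)" using normalise[OF G(1) z] by blast
    have "agree g \<alpha> (G k) (B k)" if k: "k \<noteq> fst \<alpha>" for k
    proof (cases "k = l")
      case False
      then obtain z where z: "z \<in> ?U \<alpha>" "z \<in> ?U (B l)" "z \<in> ?U (B k)"
        using triple[OF \<open>?U \<alpha> \<noteq> {}\<close> B(1)[of l] B(1)[of k]] B(2) k l by auto
      then have "g z = G k z" using g(2) GG[of l k] False by (auto simp: agree_def)
      then show ?thesis using agreeI[OF g(1) G(1) z(1,3)] by blast
    qed (use g in simp)
    with g show ?thesis by blast
  qed
  then obtain H where H: "\<And>\<alpha>. prim (H \<alpha>) \<alpha>"
    "\<And>\<alpha> k. k \<noteq> fst \<alpha> \<Longrightarrow> agree (H \<alpha>) \<alpha> (G k) (B k)" by metis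
  have HH: "H \<alpha> x = H \<beta> x" if x: "x \<in> ?U \<alpha>" "x \<in> ?U \<beta>" for \<alpha> \<beta> x
  proof (cases "fst \<alpha> = fst \<beta>")
    case True
    then have "snd \<alpha> = snd \<beta>" using x r unfolding mem_outer_slab by (auto split: if_splits)
    then have "\<alpha> = \<beta>" using True by (simp add: prod_eq_iff)
    then show ?thesis by simp
  next
    case False
    obtain k where k: "k \<noteq> fst \<alpha>" "k \<noteq> fst \<beta>" using third by blast
    obtain z where z: "z \<in> ?U \<alpha>" "z \<in> ?U \<beta>" "z \<in> ?U (B k)"
      using triple[of \<alpha> \<beta> "B k"] B x False k by force
    then have "H \<alpha> z = H \<beta> z" using H(2)[OF k(1)] H(2)[OF k(2)] by (auto simp: agree_def)
    then show ?thesis using agreeI[OF H(1) H(1) z(1,2)] x by (auto simp: agree_def)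
  qed
  define g where "g x = (if \<exists>\<alpha>. x \<in> ?U \<alpha> then H (SOME \<alpha>. x \<in> ?U \<alpha>) x else 1)" for x
  have g_eq: "g x = H \<alpha> x" if "x \<in> ?U \<alpha>" for x \<alpha>
  proof -
    have "x \<in> ?U (SOME \<alpha>. x \<in> ?U \<alpha>)" using someI[of "\<lambda>\<alpha>. x \<in> ?U \<alpha>" \<alpha>, OF that] .
    moreover have "\<exists>\<alpha>. x \<in> ?U \<alpha>" using that by (rule exI)
    ultimately show ?thesis using HH[of x "SOME \<alpha>. x \<in> ?U \<alpha>" \<alpha>] that
      by (simp only: g_def if_True)
  qed
  have "g x \<in> {-1, 1}" for x
    using H(1) by (auto simp: g_def prim_def)
  moreover have "a x i = g x * g (x + axis i 1)"
    if "x \<in> ?U \<alpha>" "x + axis i 1 \<in> ?U \<alpha>" for \<alpha> x i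
    using H(1)[of \<alpha>] that g_eq[OF that(1)] g_eq[OF that(2)] by (simp add: prim_def)
  ultimately show ?thesis by blast
qed

section \<open>Faces of closed two-cochains of finite support\<close>

text \<open>The positions of the negative faces with orientation \<open>{i, j}\<close>.\<close>

definition neg_sites :: "(int ^ 'n \<Rightarrow> 'n \<Rightarrow> 'n \<Rightarrow> real) \<Rightarrow> 'n \<Rightarrow> 'n \<Rightarrow> (int ^ 'n) set" where
  "neg_sites v i j = {x. v x i j = -1}"

lemma Prod_any_shift: "Prod_any (\<lambda>x. f (x + c)) = Prod_any (f :: int ^ 'n \<Rightarrow> real)"
proof (rule Prod_any.reindex_cong[of "\<lambda>x. x - c"])
  show "bij (\<lambda>x. x - c :: int ^ 'n)"
    by (rule o_bij[of "\<lambda>x. x + c"]) (simp_all add: fun_eq_iff)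
  show "(\<lambda>x. f (x + c)) \<circ> (\<lambda>x. x - c) = f" by (simp add: fun_eq_iff)
qed

text \<open>The number of negative \<open>{i, j}\<close>-faces at a fixed height in a third direction \<open>l\<close> is even. Multiplying the
closedness relation over all cubes between two heights cancels the side faces, each of which occurs twice, so the parity does not depend on the height; and
there is a height without negative faces. Here it is used for two consecutive heights, the first with one face and the
second with none.\<close>

lemma neg_sites_not_single:
  fixes v :: "int ^ 'n \<Rightarrow> 'n \<Rightarrow> 'n \<Rightarrow> real"
  assumes sgn: "\<And>x i j. v x i j \<in> {-1, 1}"
    and closed: "\<And>x. cube_prod v x i j l = 1"
    and ijl: "distinct [i, j, l]"
    and fin: "\<And>i j. i \<noteq> j \<Longrightarrow> finite (neg_sites v i j)"
    and x: "x \<in> neg_sites v i j"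
  shows "\<exists>y. y \<in> neg_sites v i j \<and> y \<noteq> x"
proof (rule ccontr)
  assume "\<not> ?thesis"
  with x have N: "neg_sites v i j = {x}" by blast
  define w where "w a b t y = (if y $ l = t then v y a b else 1)" for a b t y
  have w_sign: "w a b t y \<in> {-1, 1}" for a b t y unfolding w_def using sgn[of y a b] by (cases "y $ l = t") simp_all
  have fin_w: "finite {y. w a b t (y + c) \<noteq> 1}" if "a \<noteq> b" for a b t c
  proof -
    have "{y. w a b t (y + c) \<noteq> 1} \<subseteq> (\<lambda>y. y - c) ` neg_sites v a b"
    proof
      fix y assume "y \<in> {y. w a b t (y + c) \<noteq> 1}"
      then have "v (y + c) a b = -1" using sgn[of "y + c" a b] by (auto simp: w_def split: if_splits)
      then show "y \<in> (\<lambda>y. y - c) ` neg_sites v a b"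
        by (intro image_eqI[of _ _ "y + c"]) (auto simp: neg_sites_def)
    qed
    then show ?thesis using finite_imageI[OF fin[OF that]] by (rule finite_subset)
  qed
  have fin_w0: "finite {y. w a b t y \<noteq> 1}" if "a \<noteq> b" for a b t
    using fin_w[OF that, of t 0] by (simp only: add_0_right)
  have fin_mult: "finite {y. f y * g y \<noteq> 1}"
    if "finite {y. f y \<noteq> 1}" "finite {y. g y \<noteq> 1}" for f g :: "int ^ 'n \<Rightarrow> real"
  proof (rule finite_subset)
    show "{y. f y * g y \<noteq> 1} \<subseteq> {y. f y \<noteq> 1} \<union> {y. g y \<noteq> 1}" by auto
    show "finite ({y. f y \<noteq> 1} \<union> {y. g y \<noteq> 1})" using that by (rule finite_UnI)
  qed
  define f where "f t = Prod_any (w i j t)" for t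
  \<comment> \<open>Side faces occur in pairs of translates with equal products, so their contributions cancel.\<close>
  have prod_sq: "Prod_any (w a b t) * Prod_any (w a b t) = 1" for a b t
    unfolding Prod_any.expand_set by (intro sign_square prod_sign w_sign)
  have neq: "i \<noteq> j" "i \<noteq> l" "j \<noteq> l" using ijl by auto
  have step: "f t * f (t + 1) = 1" for t
  proof -
    have "1 = Prod_any (\<lambda>y. w i j t y * w i j (t+1) (y + axis l 1) * (w i l t y * w i l t (y + axis j 1))
      * (w j l t y * w j l t (y + axis i 1)))"
    proof -
      have "w i j t y * w i j (t+1) (y + axis l 1) * (w i l t y * w i l t (y + axis j 1))
        * (w j l t y * w j l t (y + axis i 1)) = 1" for y
        using closed[of y] neq by (simp add: w_def cube_prod_def mult.assoc)
      then show ?thesis by (simp only: Prod_any.neutral)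
    qed
    also have "\<dots> = Prod_any (w i j t) * Prod_any (\<lambda>y. w i j (t+1) (y + axis l 1))
       * (Prod_any (w i l t) * Prod_any (\<lambda>y. w i l t (y + axis j 1)))
       * (Prod_any (w j l t) * Prod_any (\<lambda>y. w j l t (y + axis i 1)))"
    proof -
      note fa = fin_w0[OF neq(1), of t] and fa' = fin_w[OF neq(1), of "t + 1" "axis l 1"]
      note fb = fin_w0[OF neq(2), of t] and fb' = fin_w[OF neq(2), of t "axis j 1"]
      note fc = fin_w0[OF neq(3), of t] and fc' = fin_w[OF neq(3), of t "axis i 1"]
      show ?thesis
        by (simp only: Prod_any.distrib[OF fa fa'] Prod_any.distrib[OF fb fb'] Prod_any.distrib[OF fc fc']
            Prod_any.distrib[OF fin_mult[OF fa fa'] fin_mult[OF fb fb']]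
            Prod_any.distrib[OF fin_mult[OF fin_mult[OF fa fa'] fin_mult[OF fb fb']] fin_mult[OF fc fc']])
    qed
    also have "\<dots> = Prod_any (w i j t) * Prod_any (w i j (t+1))"
      by (simp only: Prod_any_shift[of "w i j (t+1)"] Prod_any_shift[of "w i l t"]
          Prod_any_shift[of "w j l t"] prod_sq mult_1_right)
    finally show ?thesis by (simp add: f_def)
  qed
  have f_sq: "f t * f t = 1" for t using prod_sq by (simp add: f_def)
  have eq: "f (t + 1) = f t" for t
  proof -
    have "f (t + 1) = f t * f t * f (t + 1)" by (simp add: f_sq)
    also have "\<dots> = f t" using step[of t] by (simp add: mult.assoc)
    finally show ?thesis .
  qed
  have "f (x $ l) = f (x $ l + 1)" by (simp add: eq)
  moreover have "w i j (x $ l + 1) = (\<lambda>_. 1)"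
  proof
    fix y
    show "w i j (x $ l + 1) y = 1"
    proof (cases "y = x")
      case False
      then have "v y i j \<noteq> -1" using N by (auto simp: neg_sites_def)
      then show ?thesis using sgn[of y i j] by (auto simp: w_def)
    qed (simp add: w_def)
  qed
  moreover have "w i j (x $ l) = (\<lambda>y. if y = x then -1 else 1)"
  proof
    fix y
    show "w i j (x $ l) y = (if y = x then -1 else 1)"
    proof (cases "y = x")
      case True
      then show ?thesis using x by (simp add: w_def neg_sites_def)
    next
      case False
      then have "v y i j \<noteq> -1" using N by (auto simp: neg_sites_def)
      then show ?thesis using False sgn[of y i j] by (auto simp: w_def)
    qed
  qed
  ultimately have "Prod_any (\<lambda>y. if y = x then -1 else 1) = (Prod_any (\<lambda>_ :: int ^ 'n. 1) :: real)"
    by (simp only: f_def)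
  then show False by (simp only: Prod_any.delta[of x "\<lambda>_. -1"] Prod_any.neutral)
qed

lemma side_face_at_change:
  fixes v :: "int ^ 'n \<Rightarrow> 'n \<Rightarrow> 'n \<Rightarrow> real"
  assumes sgn: "\<And>x i j. v x i j \<in> {-1, 1}" and closed: "cube_prod v z i j l = 1"
    and change: "v z i j \<noteq> v (z + axis l 1) i j"
  shows "z \<in> neg_sites v i l \<or> z + axis j 1 \<in> neg_sites v i l \<or>
     z \<in> neg_sites v j l \<or> z + axis i 1 \<in> neg_sites v j l"
proof -
  have "v z i j * v (z + axis l 1) i j = -1"
    using change sgn[of z i j] sgn[of "z + axis l 1" i j] by auto
  then show ?thesis
    using closed sgn[of z i l] sgn[of "z + axis j 1" i l] sgn[of z j l] sgn[of "z + axis i 1" j l]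
    by (auto simp: cube_prod_def neg_sites_def)
qed

text \<open>Following a negative face in direction \<open>l\<close> up to the last negative translate, the cube on top of it must have another
negative face, which is a side face.\<close>

lemma side_face_above:
  fixes v :: "int ^ 'n \<Rightarrow> 'n \<Rightarrow> 'n \<Rightarrow> real"
  assumes sgn: "\<And>x i j. v x i j \<in> {-1, 1}"
    and closed: "\<And>x. cube_prod v x i j l = 1"
    and ijl: "distinct [i, j, l]"
    and fin: "finite (neg_sites v i j)"
    and x: "x \<in> neg_sites v i j"
  shows "\<exists>s z. x $ l \<le> s \<and> z = set_coord x l s \<and>
    (z \<in> neg_sites v i l \<or> z + axis j 1 \<in> neg_sites v i l \<or>
     z \<in> neg_sites v j l \<or> z + axis i 1 \<in> neg_sites v j l)"
proof -
  define S where "S = {s. set_coord x l s \<in> neg_sites v i j}"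
  have "finite S"
  proof (rule finite_imageD)
    show "finite (set_coord x l ` S)" by (rule finite_subset[OF _ fin]) (auto simp: S_def)
    show "inj_on (set_coord x l) S" by (auto simp: inj_on_def vec_eq_iff split: if_splits)
  qed
  have xS: "x $ l \<in> S" using x by (simp add: S_def)
  define s where "s = Max S"
  have s: "s \<in> S" "x $ l \<le> s" "s + 1 \<notin> S"
    unfolding s_def using Max_in[OF \<open>finite S\<close>] Max_ge[OF \<open>finite S\<close>] xS by fastforce+
  define z where "z = set_coord x l s"
  have "set_coord x l (s + 1) = z + axis l 1" by (simp add: z_def vec_eq_iff)
  with s have "v z i j \<noteq> v (z + axis l 1) i j"
    by (auto simp: S_def neg_sites_def z_def)
  from side_face_at_change[OF sgn closed this] s(2) show ?thesis unfolding z_def by blast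
qed

lemma side_face_below:
  fixes v :: "int ^ 'n \<Rightarrow> 'n \<Rightarrow> 'n \<Rightarrow> real"
  assumes sgn: "\<And>x i j. v x i j \<in> {-1, 1}"
    and closed: "\<And>x. cube_prod v x i j l = 1"
    and ijl: "distinct [i, j, l]"
    and fin: "finite (neg_sites v i j)"
    and x: "x \<in> neg_sites v i j"
  shows "\<exists>s z. s < x $ l \<and> z = set_coord x l s \<and>
    (z \<in> neg_sites v i l \<or> z + axis j 1 \<in> neg_sites v i l \<or>
     z \<in> neg_sites v j l \<or> z + axis i 1 \<in> neg_sites v j l)"
proof -
  define S where "S = {s. set_coord x l s \<in> neg_sites v i j}"
  have "finite S"
  proof (rule finite_imageD)
    show "finite (set_coord x l ` S)" by (rule finite_subset[OF _ fin]) (auto simp: S_def)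
    show "inj_on (set_coord x l) S" by (auto simp: inj_on_def vec_eq_iff split: if_splits)
  qed
  have xS: "x $ l \<in> S" using x by (simp add: S_def)
  define s where "s = Min S - 1"
  have s: "s + 1 \<in> S" "s < x $ l" "s \<notin> S"
    unfolding s_def using Min_in[OF \<open>finite S\<close>] Min_le[OF \<open>finite S\<close>] xS by fastforce+
  define z where "z = set_coord x l s"
  have "set_coord x l (s + 1) = z + axis l 1" by (simp add: z_def vec_eq_iff)
  with s have "v z i j \<noteq> v (z + axis l 1) i j"
    by (auto simp: S_def neg_sites_def z_def)
  from side_face_at_change[OF sgn closed this] s(2) show ?thesis unfolding z_def by blast
qed

lemma two_side_faces:
  fixes v :: "int ^ 'n \<Rightarrow> 'n \<Rightarrow> 'n \<Rightarrow> real"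
  assumes sgn: "\<And>x i j. v x i j \<in> {-1, 1}"
    and closed: "\<And>x. cube_prod v x i j l = 1"
    and ijl: "distinct [i, j, l]"
    and fin: "\<And>i j. i \<noteq> j \<Longrightarrow> finite (neg_sites v i j)"
    and ne: "neg_sites v i j \<noteq> {}"
  shows "card (neg_sites v i l) + card (neg_sites v j l) \<ge> 2"
proof -
  obtain x where x: "x \<in> neg_sites v i j" using ne by blast
  note nd = ijl[simplified]
  have at_l: "set_coord x l s $ l = s" "(set_coord x l s + axis j 1) $ l = s"
    "(set_coord x l s + axis i 1) $ l = s" for s
    using nd by auto
  obtain s where "x $ l \<le> s" "set_coord x l s \<in> neg_sites v i l \<or>
      set_coord x l s + axis j 1 \<in> neg_sites v i l \<or>
      set_coord x l s \<in> neg_sites v j l \<or> set_coord x l s + axis i 1 \<in> neg_sites v j l"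
    using side_face_above[OF sgn closed ijl fin x] nd by blast
  then have up: "\<exists>y. x $ l \<le> y $ l \<and> (y \<in> neg_sites v i l \<or> y \<in> neg_sites v j l)"
    using at_l[of s] by metis
  obtain s where "s < x $ l" "set_coord x l s \<in> neg_sites v i l \<or>
      set_coord x l s + axis j 1 \<in> neg_sites v i l \<or>
      set_coord x l s \<in> neg_sites v j l \<or> set_coord x l s + axis i 1 \<in> neg_sites v j l"
    using side_face_below[OF sgn closed ijl fin x] nd by blast
  then have down: "\<exists>y. y $ l < x $ l \<and> (y \<in> neg_sites v i l \<or> y \<in> neg_sites v j l)"
    using at_l[of s] by metis
  let ?A = "Inl ` neg_sites v i l \<union> Inr ` neg_sites v j l"
  have finA: "finite (neg_sites v i l)" "finite (neg_sites v j l)" using fin nd by auto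
  obtain y where y: "x $ l \<le> y $ l" "Inl y \<in> ?A \<or> Inr y \<in> ?A" using up by blast
  obtain y' where y': "y' $ l < x $ l" "Inl y' \<in> ?A \<or> Inr y' \<in> ?A" using down by blast
  have yy: "y \<noteq> y'" using y(1) y'(1) by auto
  obtain a where a: "a \<in> ?A" "a = Inl y \<or> a = Inr y" using y(2) by blast
  obtain b where b: "b \<in> ?A" "b = Inl y' \<or> b = Inr y'" using y'(2) by blast
  have "{a, b} \<subseteq> ?A" "a \<noteq> b" using a b yy by auto
  then have "2 \<le> card ?A" using finA card_mono[of ?A "{a, b}"] by simp
  also have "card ?A = card (neg_sites v i l) + card (neg_sites v j l)"
    using finA by (subst card_Un_disjoint) (auto simp: card_image)
  finally show ?thesis .
qed

text \<open>A rigidity statement for two pairs of faces of different orientation. Each face of the first kind is flanked, above and below in direction \<open>l\<close>, by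
faces of the second kind that are at most one step away in direction \<open>j\<close>, and conversely. Comparing coordinates forces both
pairs to be attached to one common site \<open>z\<close>.\<close>

lemma interlocked_pairs:
  fixes A B :: "(int ^ 'n) set"
  assumes jl: "j \<noteq> l" and cA: "card A = 2" and cB: "card B = 2"
    and AB: "\<And>x. x \<in> A \<Longrightarrow> \<exists>y\<in>B. x $ l \<le> y $ l \<and> y $ j \<in> {x $ j, x $ j + 1} \<and>
              (\<forall>m. m \<noteq> j \<and> m \<noteq> l \<longrightarrow> y $ m = x $ m)"
            "\<And>x. x \<in> A \<Longrightarrow> \<exists>y\<in>B. y $ l < x $ l \<and> y $ j \<in> {x $ j, x $ j + 1} \<and>
              (\<forall>m. m \<noteq> j \<and> m \<noteq> l \<longrightarrow> y $ m = x $ m)"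
    and BA: "\<And>y. y \<in> B \<Longrightarrow> \<exists>x\<in>A. y $ j \<le> x $ j \<and> x $ l \<in> {y $ l, y $ l + 1} \<and>
              (\<forall>m. m \<noteq> j \<and> m \<noteq> l \<longrightarrow> x $ m = y $ m)"
            "\<And>y. y \<in> B \<Longrightarrow> \<exists>x\<in>A. x $ j < y $ j \<and> x $ l \<in> {y $ l, y $ l + 1} \<and>
              (\<forall>m. m \<noteq> j \<and> m \<noteq> l \<longrightarrow> x $ m = y $ m)"
  shows "\<exists>z. A = {z, z - axis j 1} \<and> B = {z, z - axis l 1}"
proof -
  have two: "C = {a, b}" if "card C = 2" "a \<in> C" "b \<in> C" "a \<noteq> b" for C :: "(int ^ 'n) set" and a b
    using that by (auto simp: card_2_iff)
  obtain x0 where x0: "x0 \<in> A" using cA by fastforce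
  obtain p where p: "p \<in> B" "x0 $ l \<le> p $ l" using AB(1)[OF x0] by blast
  obtain q where q: "q \<in> B" "q $ l < x0 $ l" using AB(2)[OF x0] by blast
  have B: "B = {p, q}" using two[OF cB p(1) q(1)] p q by fastforce
  obtain z where z: "z \<in> A" "p $ j \<le> z $ j" using BA(1)[OF p(1)] by blast
  obtain w where w: "w \<in> A" "w $ j < p $ j" using BA(2)[OF p(1)] by blast
  have A: "A = {z, w}" using two[OF cA z(1) w(1)] z w by fastforce
  have pq: "q $ l < p $ l" and wz: "w $ j < z $ j" using p q w z by auto
  have up: "(\<forall>m. m \<noteq> j \<and> m \<noteq> l \<longrightarrow> y $ m = x $ m) \<and> y $ j \<in> {x $ j, x $ j + 1} \<and>
      x $ l \<in> {y $ l, y $ l + 1} \<and> q $ l < x $ l \<and> x $ l \<le> p $ l \<and> w $ j < y $ j \<and> y $ j \<le> z $ j"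
    if xy: "x \<in> A" "y \<in> B" for x y
  proof -
    obtain y1 where y1: "y1 \<in> B" "x $ l \<le> y1 $ l" "y1 $ j \<in> {x $ j, x $ j + 1}"
      "\<forall>m. m \<noteq> j \<and> m \<noteq> l \<longrightarrow> y1 $ m = x $ m" using AB(1)[OF xy(1)] by blast
    obtain y2 where y2: "y2 \<in> B" "y2 $ l < x $ l" "y2 $ j \<in> {x $ j, x $ j + 1}"
      "\<forall>m. m \<noteq> j \<and> m \<noteq> l \<longrightarrow> y2 $ m = x $ m" using AB(2)[OF xy(1)] by blast
    obtain x1 where x1: "x1 \<in> A" "y $ j \<le> x1 $ j" "x1 $ l \<in> {y $ l, y $ l + 1}"
      "\<forall>m. m \<noteq> j \<and> m \<noteq> l \<longrightarrow> x1 $ m = y $ m" using BA(1)[OF xy(2)] by blast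
    obtain x2 where x2: "x2 \<in> A" "x2 $ j < y $ j" "x2 $ l \<in> {y $ l, y $ l + 1}"
      "\<forall>m. m \<noteq> j \<and> m \<noteq> l \<longrightarrow> x2 $ m = y $ m" using BA(2)[OF xy(2)] by blast
    have e: "y1 = p" "y2 = q" using y1(1,2) y2(1,2) pq by (auto simp: B)
    have e': "x1 = z" "x2 = w" using x1(1,2) x2(1,2) wz by (auto simp: A)
    show ?thesis using y1 y2 x1 x2 e e' xy by (auto simp: A B)
  qed
  have zp: "z = p"
  proof -
    have "z $ l = p $ l" "z $ j = p $ j"
      using up[OF z(1) p(1)] up[OF z(1) q(1)] up[OF w(1) p(1)] by auto
    moreover have "\<forall>m. m \<noteq> j \<and> m \<noteq> l \<longrightarrow> p $ m = z $ m" using up[OF z(1) p(1)] by blast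
    ultimately show ?thesis by (metis vec_eq_iff)
  qed
  have "w = z - axis j 1"
  proof -
    have "w $ l = z $ l" "w $ j = z $ j - 1"
      using up[OF w(1) p(1)] up[OF w(1) q(1)] zp by auto
    moreover have "\<forall>m. m \<noteq> j \<and> m \<noteq> l \<longrightarrow> p $ m = w $ m" using up[OF w(1) p(1)] by blast
    ultimately show ?thesis using zp jl by (auto simp: vec_eq_iff)
  qed
  moreover have "q = z - axis l 1"
  proof -
    have "q $ j = z $ j" "q $ l = z $ l - 1"
      using up[OF z(1) q(1)] up[OF w(1) q(1)] zp by auto
    moreover have "\<forall>m. m \<noteq> j \<and> m \<noteq> l \<longrightarrow> q $ m = z $ m" using up[OF z(1) q(1)] by blast
    ultimately show ?thesis using jl by (auto simp: vec_eq_iff)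
  qed
  ultimately show ?thesis using A B zp by blast
qed

section \<open>Ising spins: Griffiths inequalities, heat bath and Peierls bound\<close>

definition spins :: "'e set \<Rightarrow> ('e \<Rightarrow> real) set" where
  "spins E = E \<rightarrow>\<^sub>E {-1, 1}"

text \<open>Multiplication of spin configurations, restricted to \<open>E\<close> so that the result is again extensional.\<close>

definition twist :: "'e set \<Rightarrow> ('e \<Rightarrow> real) \<Rightarrow> ('e \<Rightarrow> real) \<Rightarrow> 'e \<Rightarrow> real" where
  "twist E \<tau> \<sigma> = restrict (\<lambda>e. \<sigma> e * \<tau> e) E"

lemma finite_spins: "finite E \<Longrightarrow> finite (spins E)"
  by (simp add: spins_def finite_PiE)

lemma spins_sign: "\<sigma> \<in> spins E \<Longrightarrow> e \<in> E \<Longrightarrow> \<sigma> e \<in> {-1, 1}"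
  by (auto simp: spins_def)

lemma prod_spins_sign: "\<sigma> \<in> spins E \<Longrightarrow> A \<subseteq> E \<Longrightarrow> (\<Prod>e\<in>A. \<sigma> e) \<in> {-1, 1}"
  by (rule prod_sign, erule spins_sign) auto

lemma twist_spins:
  assumes "\<sigma> \<in> spins E" "\<And>e. e \<in> E \<Longrightarrow> \<tau> e \<in> {-1, 1}"
  shows "twist E \<tau> \<sigma> \<in> spins E"
  using sign_mult[OF spins_sign[OF assms(1)] assms(2)] by (auto simp: spins_def twist_def)

lemma prod_twist: "A \<subseteq> E \<Longrightarrow> (\<Prod>e\<in>A. twist E \<tau> \<sigma> e) = (\<Prod>e\<in>A. \<sigma> e) * (\<Prod>e\<in>A. \<tau> e)"
  by (subst prod.distrib[symmetric], rule prod.cong) (auto simp: twist_def)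

lemma twist_twist:
  assumes "\<sigma> \<in> spins E" "\<And>e. e \<in> E \<Longrightarrow> \<tau> e \<in> {-1, 1}"
  shows "twist E \<tau> (twist E \<tau> \<sigma>) = \<sigma>"
proof
  fix e
  show "twist E \<tau> (twist E \<tau> \<sigma>) e = \<sigma> e"
  proof (cases "e \<in> E")
    case True
    then show ?thesis by (simp add: twist_def mult.assoc sign_square[OF assms(2)[OF True]])
  next
    case False
    then show ?thesis using PiE_arb[OF assms(1)[unfolded spins_def] False] by (simp add: twist_def)
  qed
qed

lemma sum_twist:
  assumes "\<And>e. e \<in> E \<Longrightarrow> \<tau> e \<in> {-1, 1}"
  shows "(\<Sum>\<sigma>\<in>spins E. f (twist E \<tau> \<sigma>)) = (\<Sum>\<sigma>\<in>spins E. f \<sigma>)"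
  by (rule sum.reindex_bij_witness[of _ "twist E \<tau>" "twist E \<tau>"])
     (simp_all only: twist_twist[OF _ assms] twist_spins[OF _ assms])

text \<open>Reversing a spin in \<open>A\<close> shows that the sum vanishes unless the product is empty.\<close>

lemma sum_prod_spins_nonneg:
  assumes "A \<subseteq> E"
  shows "(\<Sum>\<sigma>\<in>spins E. \<Prod>e\<in>A. \<sigma> e) \<ge> (0::real)"
proof (cases "A = {} \<or> infinite A")
  case True
  then have "(\<Prod>e\<in>A. \<sigma> e) = 1" for \<sigma> :: "'a \<Rightarrow> real" by auto
  then show ?thesis by simp
next
  case False
  then obtain e where e: "e \<in> A" "finite A" by blast
  define \<tau> where "\<tau> = (\<lambda>e'. if e' = e then -1 else 1 :: real)"
  have "(\<Prod>e\<in>A. \<tau> e) = -1" using e by (simp add: \<tau>_def prod.delta)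
  then have "(\<Sum>\<sigma>\<in>spins E. \<Prod>e\<in>A. \<sigma> e) = - (\<Sum>\<sigma>\<in>spins E. \<Prod>e\<in>A. \<sigma> e)"
    using sum_twist[of E \<tau> "\<lambda>\<sigma>. \<Prod>e\<in>A. \<sigma> e"] assms
    by (simp add: prod_twist sum_negf \<tau>_def)
  then show ?thesis by simp
qed

lemma prod_mult_sym_diff:
  assumes "\<sigma> \<in> spins E" "A \<subseteq> E" "B \<subseteq> E" "finite E"
  shows "(\<Prod>e\<in>A. \<sigma> e) * (\<Prod>e\<in>B. \<sigma> e) = (\<Prod>e\<in>(A - B) \<union> (B - A). \<sigma> e)"
proof -
  have fin: "finite A" "finite B" using assms finite_subset by blast+
  have sq: "(\<Prod>e\<in>A \<inter> B. \<sigma> e) * (\<Prod>e\<in>A \<inter> B. \<sigma> e) = 1"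
    by (intro sign_square prod_spins_sign[OF assms(1)]) (use assms in auto)
  have A: "(\<Prod>e\<in>A. \<sigma> e) = (\<Prod>e\<in>A - B. \<sigma> e) * (\<Prod>e\<in>A \<inter> B. \<sigma> e)"
    using fin by (subst prod.union_disjoint[symmetric]) (auto simp: Un_Diff_Int)
  have B: "(\<Prod>e\<in>B. \<sigma> e) = (\<Prod>e\<in>B - A. \<sigma> e) * (\<Prod>e\<in>A \<inter> B. \<sigma> e)"
    using fin by (subst prod.union_disjoint[symmetric]) (auto intro!: prod.cong)
  have "(\<Prod>e\<in>(A - B) \<union> (B - A). \<sigma> e) = (\<Prod>e\<in>A - B. \<sigma> e) * (\<Prod>e\<in>B - A. \<sigma> e)"
    using fin by (subst prod.union_disjoint) auto
  then show ?thesis using sq by (simp add: A B algebra_simps)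
qed

lemma exp_sign: "s \<in> {-1, 1::real} \<Longrightarrow> exp (K * s) = cosh K + sinh K * s"
  by (auto simp: cosh_def sinh_def field_simps)

text \<open>Expanding each factor \<open>exp (K s) = cosh K + sinh K * s\<close> for a sign \<open>s\<close> writes the weight as a combination with
nonnegative coefficients of products of spins, and the sum of a product of spins is nonnegative.\<close>

lemma griffiths_first:
  fixes K :: "'e set \<Rightarrow> real"
  assumes E: "finite E" and P: "finite P" "\<And>p. p \<in> P \<Longrightarrow> p \<subseteq> E" "\<And>p. p \<in> P \<Longrightarrow> K p \<ge> 0"
    and A: "A \<subseteq> E"
  shows "(\<Sum>\<sigma>\<in>spins E. (\<Prod>e\<in>A. \<sigma> e) * exp (\<Sum>p\<in>P. K p * (\<Prod>e\<in>p. \<sigma> e))) \<ge> 0"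
  using P A
proof (induction P arbitrary: A rule: finite_induct)
  case empty
  then show ?case using sum_prod_spins_nonneg by simp
next
  case (insert p P)
  let ?w = "\<lambda>\<sigma>. exp (\<Sum>p\<in>P. K p * (\<Prod>e\<in>p. \<sigma> e))"
  define B where "B = (A - p) \<union> (p - A)"
  have pE: "p \<subseteq> E" and BE: "B \<subseteq> E" using insert.prems by (auto simp: B_def)
  have "(\<Prod>e\<in>A. \<sigma> e) * exp (\<Sum>p\<in>insert p P. K p * (\<Prod>e\<in>p. \<sigma> e))
     = cosh (K p) * ((\<Prod>e\<in>A. \<sigma> e) * ?w \<sigma>) + sinh (K p) * ((\<Prod>e\<in>B. \<sigma> e) * ?w \<sigma>)"
    if "\<sigma> \<in> spins E" for \<sigma>
  proof -
    have "exp (\<Sum>p\<in>insert p P. K p * (\<Prod>e\<in>p. \<sigma> e))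
      = (cosh (K p) + sinh (K p) * (\<Prod>e\<in>p. \<sigma> e)) * ?w \<sigma>"
      using insert.hyps exp_sign[OF prod_spins_sign[OF that pE], of "K p"] by (simp add: exp_add)
    then show ?thesis
      unfolding B_def prod_mult_sym_diff[OF that insert.prems(3) pE E, symmetric]
      by (simp add: algebra_simps)
  qed
  then have "(\<Sum>\<sigma>\<in>spins E. (\<Prod>e\<in>A. \<sigma> e) * exp (\<Sum>p\<in>insert p P. K p * (\<Prod>e\<in>p. \<sigma> e)))
    = cosh (K p) * (\<Sum>\<sigma>\<in>spins E. (\<Prod>e\<in>A. \<sigma> e) * ?w \<sigma>)
      + sinh (K p) * (\<Sum>\<sigma>\<in>spins E. (\<Prod>e\<in>B. \<sigma> e) * ?w \<sigma>)"
    by (simp add: sum.distrib sum_distrib_left)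
  moreover have "(\<Sum>\<sigma>\<in>spins E. (\<Prod>e\<in>A. \<sigma> e) * ?w \<sigma>) \<ge> 0"
    "(\<Sum>\<sigma>\<in>spins E. (\<Prod>e\<in>B. \<sigma> e) * ?w \<sigma>) \<ge> 0"
    using insert.prems BE by (auto intro!: insert.IH)
  moreover have "cosh (K p) \<ge> 0" "sinh (K p) \<ge> 0" using insert.prems by auto
  ultimately show ?case by simp
qed

text \<open>Ginibre's duplication: in the product system of two independent copies, substitute \<open>\<sigma>' = \<sigma> \<rho>\<close>. For fixed \<open>\<rho>\<close> the combined
weight is again of the same form with nonnegative couplings \<open>K p (1 + \<rho>_p)\<close>, and the difference of the two sides is a sum of first
Griffiths sums with the nonnegative coefficients \<open>1 - \<rho>_B\<close>.\<close>

lemma griffiths_second: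
  fixes K :: "'e set \<Rightarrow> real"
  assumes E: "finite E" and P: "finite P" "\<And>p. p \<in> P \<Longrightarrow> p \<subseteq> E" "\<And>p. p \<in> P \<Longrightarrow> K p \<ge> 0"
    and A: "A \<subseteq> E" and B: "B \<subseteq> E"
  defines "w \<equiv> \<lambda>\<sigma>. exp (\<Sum>p\<in>P. K p * (\<Prod>e\<in>p. \<sigma> e))"
  shows "(\<Sum>\<sigma>\<in>spins E. (\<Prod>e\<in>A. \<sigma> e) * w \<sigma>) * (\<Sum>\<sigma>\<in>spins E. (\<Prod>e\<in>B. \<sigma> e) * w \<sigma>)
    \<le> (\<Sum>\<sigma>\<in>spins E. (\<Prod>e\<in>A. \<sigma> e) * (\<Prod>e\<in>B. \<sigma> e) * w \<sigma>) * (\<Sum>\<sigma>\<in>spins E. w \<sigma>)"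
proof -
  let ?S = "spins E"
  let ?c = "\<lambda>A \<sigma>. \<Prod>e\<in>A. \<sigma> e :: real"
  \<comment> \<open>The summand of the difference of the two sides, written over two independent copies.\<close>
  define G where "G \<sigma> \<rho> = ?c A \<sigma> * ?c B \<sigma> * (w \<sigma> * w \<rho>) - ?c A \<sigma> * ?c B \<rho> * (w \<sigma> * w \<rho>)" for \<sigma> \<rho>
  define C where "C = (A - B) \<union> (B - A)"
  have C: "C \<subseteq> E" using A B by (auto simp: C_def)
  have sgn: "e \<in> E \<Longrightarrow> \<sigma> e \<in> {-1, 1}" if "\<sigma> \<in> ?S" for \<sigma> e by (rule spins_sign[OF that])
  have "(\<Sum>\<sigma>\<in>?S. ?c A \<sigma> * ?c B \<sigma> * w \<sigma>) * (\<Sum>\<sigma>\<in>?S. w \<sigma>)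
      - (\<Sum>\<sigma>\<in>?S. ?c A \<sigma> * w \<sigma>) * (\<Sum>\<sigma>\<in>?S. ?c B \<sigma> * w \<sigma>) = (\<Sum>\<sigma>\<in>?S. \<Sum>\<rho>\<in>?S. G \<sigma> \<rho>)"
    unfolding G_def sum_product sum_subtractf by (simp add: mult_ac)
  also have "\<dots> = (\<Sum>\<sigma>\<in>?S. \<Sum>\<rho>\<in>?S. G \<sigma> (twist E \<sigma> \<rho>))"
    by (rule sum.cong[OF refl], rule sum_twist[symmetric], rule sgn)
  also have "\<dots> = (\<Sum>\<rho>\<in>?S. \<Sum>\<sigma>\<in>?S. G \<sigma> (twist E \<sigma> \<rho>))"
    by (rule sum.swap)
  also have "\<dots> = (\<Sum>\<rho>\<in>?S. (1 - ?c B \<rho>) *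
      (\<Sum>\<sigma>\<in>?S. ?c C \<sigma> * exp (\<Sum>p\<in>P. (K p * (1 + ?c p \<rho>)) * ?c p \<sigma>)))"
    unfolding sum_distrib_left
  proof (intro sum.cong refl)
    fix \<rho> \<sigma> assume \<rho>: "\<rho> \<in> ?S" and \<sigma>: "\<sigma> \<in> ?S"
    have "w \<sigma> * w (twist E \<sigma> \<rho>) = exp (\<Sum>p\<in>P. (K p * (1 + ?c p \<rho>)) * ?c p \<sigma>)"
      unfolding w_def exp_add[symmetric] sum.distrib[symmetric]
      by (intro arg_cong[of _ _ exp] sum.cong refl) (simp add: prod_twist P(2) algebra_simps)
    moreover have "?c C \<sigma> = ?c A \<sigma> * ?c B \<sigma>"
      unfolding C_def using prod_mult_sym_diff[OF \<sigma> A B E] by simp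
    moreover have "?c B (twist E \<sigma> \<rho>) = ?c B \<rho> * ?c B \<sigma>" by (rule prod_twist[OF B])
    ultimately show "G \<sigma> (twist E \<sigma> \<rho>) = (1 - ?c B \<rho>) *
        (?c C \<sigma> * exp (\<Sum>p\<in>P. (K p * (1 + ?c p \<rho>)) * ?c p \<sigma>))"
      unfolding G_def by (simp add: algebra_simps)
  qed
  also have "\<dots> \<ge> 0"
  proof (rule sum_nonneg)
    fix \<rho> assume \<rho>: "\<rho> \<in> ?S"
    have "0 \<le> 1 - ?c B \<rho>" using prod_spins_sign[OF \<rho> B] by auto
    moreover have "0 \<le> (\<Sum>\<sigma>\<in>?S. ?c C \<sigma> * exp (\<Sum>p\<in>P. (K p * (1 + ?c p \<rho>)) * ?c p \<sigma>))"
    proof (rule griffiths_first[OF E P(1,2) _ C])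
      fix p assume "p \<in> P"
      then show "0 \<le> K p * (1 + ?c p \<rho>)"
        using P(3) prod_spins_sign[OF \<rho> P(2)] by force
    qed
    ultimately show "0 \<le> (1 - ?c B \<rho>) *
      (\<Sum>\<sigma>\<in>?S. ?c C \<sigma> * exp (\<Sum>p\<in>P. (K p * (1 + ?c p \<rho>)) * ?c p \<sigma>))"
      by (rule mult_nonneg_nonneg)
  qed
  finally show ?thesis by simp
qed

text \<open>Adding one coupling \<open>p\<close> replaces the expectation \<open>\<langle>A\<rangle>\<close> by \<open>(\<langle>A\<rangle> + tanh K \<langle>A p\<rangle>) / (1 + tanh K \<langle>p\<rangle>)\<close>,
which is at least \<open>\<langle>A\<rangle>\<close> by the second inequality.\<close>

lemma griffiths_mono:
  fixes K :: "'e set \<Rightarrow> real"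
  assumes E: "finite E" and Q: "finite Q" "\<And>p. p \<in> Q \<Longrightarrow> p \<subseteq> E" "\<And>p. p \<in> Q \<Longrightarrow> K p \<ge> 0"
    and PQ: "P \<subseteq> Q" and A: "A \<subseteq> E"
  defines "w \<equiv> \<lambda>P \<sigma>. exp (\<Sum>p\<in>P. K p * (\<Prod>e\<in>p. \<sigma> e))"
  shows "(\<Sum>\<sigma>\<in>spins E. (\<Prod>e\<in>A. \<sigma> e) * w P \<sigma>) / (\<Sum>\<sigma>\<in>spins E. w P \<sigma>)
     \<le> (\<Sum>\<sigma>\<in>spins E. (\<Prod>e\<in>A. \<sigma> e) * w Q \<sigma>) / (\<Sum>\<sigma>\<in>spins E. w Q \<sigma>)"
proof -
  let ?c = "\<lambda>A \<sigma>. \<Prod>e\<in>A. \<sigma> e :: real"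
  let ?Z = "\<lambda>P. \<Sum>\<sigma>\<in>spins E. w P \<sigma>"
  have "(\<lambda>e\<in>E. 1) \<in> spins E" by (auto simp: spins_def)
  then have Zpos: "?Z P > 0" for P
    using finite_spins[OF E] by (intro sum_pos) (auto simp: w_def)
  have "finite R \<Longrightarrow> R \<subseteq> Q - P \<Longrightarrow>
    (\<Sum>\<sigma>\<in>spins E. ?c A \<sigma> * w P \<sigma>) / ?Z P \<le> (\<Sum>\<sigma>\<in>spins E. ?c A \<sigma> * w (P \<union> R) \<sigma>) / ?Z (P \<union> R)"
    for R
  proof (induction R rule: finite_induct)
    case (insert p R)
    define D where "D = P \<union> R"
    have D: "finite D" "p \<notin> D" "D \<subseteq> Q" "p \<in> Q"
      using insert.prems insert.hyps PQ Q(1) finite_subset by (auto simp: D_def)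
    define S where "S f = (\<Sum>\<sigma>\<in>spins E. f \<sigma> * w D \<sigma>)" for f
    have w: "w (insert p D) \<sigma> = (cosh (K p) + sinh (K p) * ?c p \<sigma>) * w D \<sigma>"
      if "\<sigma> \<in> spins E" for \<sigma>
      using D exp_sign[OF prod_spins_sign[OF that Q(2)[OF D(4)]], of "K p"]
      by (simp add: w_def exp_add)
    have Z': "?Z (insert p D) = cosh (K p) * ?Z D + sinh (K p) * S (?c p)"
      unfolding S_def sum_distrib_left sum.distrib[symmetric]
      by (rule sum.cong[OF refl]) (simp add: w algebra_simps)
    have A': "(\<Sum>\<sigma>\<in>spins E. ?c A \<sigma> * w (insert p D) \<sigma>)
        = cosh (K p) * S (?c A) + sinh (K p) * S (\<lambda>\<sigma>. ?c A \<sigma> * ?c p \<sigma>)"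
      unfolding S_def sum_distrib_left sum.distrib[symmetric]
      by (rule sum.cong[OF refl]) (simp add: w algebra_simps)
    have corr: "S (?c A) * S (?c p) \<le> S (\<lambda>\<sigma>. ?c A \<sigma> * ?c p \<sigma>) * ?Z D"
      unfolding S_def w_def
      by (rule griffiths_second[OF E D(1) _ _ A]) (use D Q in auto)
    have "sinh (K p) \<ge> 0" using Q(3) D by simp
    from mult_left_mono[OF corr this]
    have "S (?c A) * ?Z (insert p D) \<le> (\<Sum>\<sigma>\<in>spins E. ?c A \<sigma> * w (insert p D) \<sigma>) * ?Z D"
      unfolding Z' A' by (simp add: algebra_simps)
    then have "S (?c A) / ?Z D \<le> (\<Sum>\<sigma>\<in>spins E. ?c A \<sigma> * w (insert p D) \<sigma>) / ?Z (insert p D)"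
      using Zpos[of D] Zpos[of "insert p D"] by (simp add: field_simps)
    moreover have "P \<union> insert p R = insert p D" by (simp add: D_def)
    ultimately show ?case using insert.IH insert.prems by (simp add: S_def D_def)
  qed simp
  from this[of "Q - P"] show ?thesis using Q(1) PQ by (simp add: Un_absorb1 Un_absorb2)
qed

lemma sum_spins_insert:
  assumes "e \<notin> E" and f: "\<And>\<sigma> s. f (\<sigma>(e := s)) = f \<sigma>"
  shows "(\<Sum>\<sigma>\<in>spins (insert e E). f \<sigma>) = 2 * (\<Sum>\<sigma>\<in>spins E. f \<sigma> :: real)"
proof -
  have "spins (insert e E) = (\<lambda>(s, \<sigma>). \<sigma>(e := s)) ` ({-1, 1} \<times> spins E)"
    unfolding spins_def PiE_insert_eq by simp
  moreover have "inj_on (\<lambda>(s, \<sigma>). \<sigma>(e := s)) ({-1, 1::real} \<times> spins E)"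
    unfolding spins_def using inj_combinator[OF assms(1), of "\<lambda>_. {-1, 1::real}"] .
  ultimately have "(\<Sum>\<sigma>\<in>spins (insert e E). f \<sigma>) = (\<Sum>(s, \<sigma>)\<in>{-1, 1::real} \<times> spins E. f \<sigma>)"
    by (simp add: sum.reindex f case_prod_unfold)
  also have "\<dots> = (\<Sum>s\<in>{-1, 1::real}. \<Sum>\<sigma>\<in>spins E. f \<sigma>)" by (rule sum.cartesian_product[symmetric])
  also have "\<dots> = 2 * (\<Sum>\<sigma>\<in>spins E. f \<sigma>)" by simp
  finally show ?thesis .
qed

lemma sum_spins_extend:
  assumes "finite D" "D \<inter> E = {}" and f: "\<And>\<sigma> e s. e \<in> D \<Longrightarrow> f (\<sigma>(e := s)) = f \<sigma>"
  shows "(\<Sum>\<sigma>\<in>spins (E \<union> D). f \<sigma>) = 2 ^ card D * (\<Sum>\<sigma>\<in>spins E. f \<sigma> :: real)"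
  using assms
proof (induction D rule: finite_induct)
  case (insert e D)
  have "(\<Sum>\<sigma>\<in>spins (insert e (E \<union> D)). f \<sigma>) = 2 * (\<Sum>\<sigma>\<in>spins (E \<union> D). f \<sigma>)"
  proof (rule sum_spins_insert)
    show "e \<notin> E \<union> D" using insert by auto
    show "f (\<sigma>(e := s)) = f \<sigma>" for \<sigma> s by (rule insert.prems(2)) simp
  qed
  moreover have "(\<Sum>\<sigma>\<in>spins (E \<union> D). f \<sigma>) = 2 ^ card D * (\<Sum>\<sigma>\<in>spins E. f \<sigma>)"
  proof (rule insert.IH)
    show "D \<inter> E = {}" using insert.prems by auto
    show "f (\<sigma>(e' := s)) = f \<sigma>" if "e' \<in> D" for \<sigma> e' s
      by (rule insert.prems(2)) (use that in simp)
  qed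
  ultimately show ?case using insert.hyps by simp
qed simp

definition gibbs_weight :: "real \<Rightarrow> 'e set set \<Rightarrow> ('e \<Rightarrow> real) \<Rightarrow> real" where
  "gibbs_weight \<beta> P \<sigma> = exp (\<beta> * (\<Sum>p\<in>P. \<Prod>e\<in>p. \<sigma> e))"

text \<open>The conditional mean of the spin at \<open>e\<close> given the others, in the form of an identity that follows by pairing each
configuration with the one in which that spin is reversed.\<close>

lemma heat_bath_edge:
  assumes e: "e \<in> E" and P: "finite P" "\<And>p. p \<in> P \<Longrightarrow> p \<subseteq> E \<and> finite p"
    and f: "\<And>\<sigma> s. f (\<sigma>(e := s)) = f \<sigma>"
  shows "(\<Sum>\<sigma>\<in>spins E. f \<sigma> * \<sigma> e * gibbs_weight \<beta> P \<sigma>)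
    = (\<Sum>\<sigma>\<in>spins E. f \<sigma> * tanh (\<beta> * (\<Sum>p | p \<in> P \<and> e \<in> p. \<Prod>e'\<in>p - {e}. \<sigma> e')) * gibbs_weight \<beta> P \<sigma>)"
proof -
  define \<tau> where "\<tau> = (\<lambda>e'. if e' = e then -1 else 1 :: real)"
  have \<tau>: "\<tau> e' \<in> {-1, 1}" for e' by (simp add: \<tau>_def)
  define s where "s \<sigma> = (\<Sum>p | p \<in> P \<and> e \<in> p. \<Prod>e'\<in>p - {e}. \<sigma> e')" for \<sigma> :: "'a \<Rightarrow> real"
  define R where "R \<sigma> = exp (\<beta> * (\<Sum>p | p \<in> P \<and> e \<notin> p. \<Prod>e'\<in>p. \<sigma> e'))" for \<sigma> :: "'a \<Rightarrow> real"
  have w: "gibbs_weight \<beta> P \<sigma> = R \<sigma> * exp (\<beta> * \<sigma> e * s \<sigma>)" for \<sigma>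
  proof -
    have "(\<Sum>p\<in>P. \<Prod>e\<in>p. \<sigma> e) = (\<Sum>p | p \<in> P \<and> e \<notin> p. \<Prod>e\<in>p. \<sigma> e) + (\<Sum>p | p \<in> P \<and> e \<in> p. \<Prod>e\<in>p. \<sigma> e)"
      using P(1) by (subst sum.union_disjoint[symmetric]) (auto intro!: sum.cong)
    also have "(\<Sum>p | p \<in> P \<and> e \<in> p. \<Prod>e\<in>p. \<sigma> e) = \<sigma> e * s \<sigma>"
      unfolding s_def sum_distrib_left using P(2)
      by (intro sum.cong refl) (auto simp: prod.remove)
    finally show ?thesis by (simp add: gibbs_weight_def R_def distrib_left exp_add[symmetric] mult_ac)
  qed
  have tw: "twist E \<tau> \<sigma> = \<sigma>(e := - \<sigma> e)" if "\<sigma> \<in> spins E" for \<sigma>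
  proof
    fix x
    show "twist E \<tau> \<sigma> x = (\<sigma>(e := - \<sigma> e)) x"
    proof (cases "x \<in> E")
      case True
      then show ?thesis by (simp add: twist_def \<tau>_def)
    next
      case False
      then have "x \<noteq> e" using e by auto
      with False show ?thesis
        using PiE_arb[OF that[unfolded spins_def] False] by (simp add: twist_def)
    qed
  qed
  have s_inv: "s (\<sigma>(e := t)) = s \<sigma>" for \<sigma> t
    unfolding s_def by (intro sum.cong prod.cong refl) auto
  have R_inv: "R (\<sigma>(e := t)) = R \<sigma>" for \<sigma> t
    unfolding R_def by (intro arg_cong[of _ _ exp] arg_cong[of _ _ "\<lambda>x. \<beta> * x"] sum.cong prod.cong refl) auto
  define F where "F \<sigma> = f \<sigma> * \<sigma> e * gibbs_weight \<beta> P \<sigma>" for \<sigma>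
  define G where "G \<sigma> = f \<sigma> * tanh (\<beta> * s \<sigma>) * gibbs_weight \<beta> P \<sigma>" for \<sigma>
  have FG: "F \<sigma> + F (twist E \<tau> \<sigma>) = G \<sigma> + G (twist E \<tau> \<sigma>)" if "\<sigma> \<in> spins E" for \<sigma>
  proof -
    have "exp x - exp (- x) = tanh x * (exp x + exp (- x))" for x :: real
      using add_pos_pos[OF exp_gt_zero[of x] exp_gt_zero[of "-x"]]
      by (simp add: tanh_altdef)
    from this[of "\<beta> * s \<sigma>"] have key:
      "exp (\<beta> * s \<sigma>) - exp (- (\<beta> * s \<sigma>)) = tanh (\<beta> * s \<sigma>) * (exp (\<beta> * s \<sigma>) + exp (- (\<beta> * s \<sigma>)))" .
    have "\<sigma> e = 1 \<or> \<sigma> e = -1" using spins_sign[OF that e] by auto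
    then show ?thesis
    proof
      assume s: "\<sigma> e = 1"
      have "F \<sigma> + F (twist E \<tau> \<sigma>) = f \<sigma> * R \<sigma> * (exp (\<beta> * s \<sigma>) - exp (- (\<beta> * s \<sigma>)))"
        unfolding tw[OF that] F_def w s_inv R_inv f by (simp add: s algebra_simps)
      also have "\<dots> = G \<sigma> + G (twist E \<tau> \<sigma>)"
        unfolding key tw[OF that] G_def w s_inv R_inv f by (simp add: s algebra_simps)
      finally show ?thesis .
    next
      assume s: "\<sigma> e = -1"
      have "F \<sigma> + F (twist E \<tau> \<sigma>) = f \<sigma> * R \<sigma> * (exp (\<beta> * s \<sigma>) - exp (- (\<beta> * s \<sigma>)))"
        unfolding tw[OF that] F_def w s_inv R_inv f by (simp add: s algebra_simps)
      also have "\<dots> = G \<sigma> + G (twist E \<tau> \<sigma>)"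
        unfolding key tw[OF that] G_def w s_inv R_inv f by (simp add: s algebra_simps)
      finally show ?thesis .
    qed
  qed
  \<comment> \<open>Each configuration is paired with its image under reversal of the spin at the edge.\<close>
  have "2 * (\<Sum>\<sigma>\<in>spins E. F \<sigma>) = (\<Sum>\<sigma>\<in>spins E. F \<sigma> + F (twist E \<tau> \<sigma>))"
    using sum_twist[of E \<tau> F] \<tau> by (simp add: sum.distrib)
  also have "\<dots> = (\<Sum>\<sigma>\<in>spins E. G \<sigma> + G (twist E \<tau> \<sigma>))"
    by (rule sum.cong[OF refl FG])
  also have "\<dots> = 2 * (\<Sum>\<sigma>\<in>spins E. G \<sigma>)"
    using sum_twist[of E \<tau> G] \<tau> by (simp add: sum.distrib)
  finally show ?thesis by (simp add: F_def G_def s_def)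
qed

text \<open>Successive integration over the spins in \<open>A\<close>. As no \<open>p \<in> P\<close> contains two members of \<open>A\<close>, the factors that have been
introduced for earlier edges do not depend on the spin that is integrated next. The original spin product is kept in front, so that
\<open>tanh\<close> is evaluated at the gauge invariant sum over the full products.\<close>

lemma heat_bath:
  assumes C: "finite C" "C \<subseteq> E" and A: "finite A" "A \<subseteq> C"
    and P: "finite P" "\<And>p. p \<in> P \<Longrightarrow> p \<subseteq> E \<and> finite p"
    and isolated: "\<And>e e' p. e \<in> A \<Longrightarrow> e' \<in> A \<Longrightarrow> p \<in> P \<Longrightarrow> e \<in> p \<Longrightarrow> e' \<in> p \<Longrightarrow> e = e'"
  shows "(\<Sum>\<sigma>\<in>spins E. (\<Prod>e\<in>C. \<sigma> e) * gibbs_weight \<beta> P \<sigma>)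
    = (\<Sum>\<sigma>\<in>spins E. (\<Prod>e\<in>C. \<sigma> e) * (\<Prod>e\<in>A. tanh (\<beta> * (\<Sum>p | p \<in> P \<and> e \<in> p. \<Prod>e'\<in>p. \<sigma> e')))
        * gibbs_weight \<beta> P \<sigma>)"
proof -
  define s where "s e \<sigma> = (\<Sum>p | p \<in> P \<and> e \<in> p. \<Prod>e'\<in>p - {e}. \<sigma> e')" for e and \<sigma> :: "'a \<Rightarrow> real"
  have "finite B \<Longrightarrow> B \<subseteq> A \<Longrightarrow> (\<Sum>\<sigma>\<in>spins E. (\<Prod>e\<in>C. \<sigma> e) * gibbs_weight \<beta> P \<sigma>)
    = (\<Sum>\<sigma>\<in>spins E. (\<Prod>e\<in>C - B. \<sigma> e) * (\<Prod>e\<in>B. tanh (\<beta> * s e \<sigma>)) * gibbs_weight \<beta> P \<sigma>)" for B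
  proof (induction B rule: finite_induct)
    case (insert e B)
    define f where "f \<sigma> = (\<Prod>e\<in>C - insert e B. \<sigma> e) * (\<Prod>e\<in>B. tanh (\<beta> * s e \<sigma>))" for \<sigma> :: "'a \<Rightarrow> real"
    have e: "e \<in> C - B" "e \<in> E" "e \<in> A" using insert A C by auto
    have s_inv: "s e' (\<sigma>(e := t)) = s e' \<sigma>" if "e' \<in> B" for \<sigma> t e'
      unfolding s_def
    proof (intro sum.cong prod.cong refl)
      fix p e'' assume "p \<in> {p \<in> P. e' \<in> p}" "e'' \<in> p - {e'}"
      moreover have "e' \<in> A" "e' \<noteq> e" using that insert by auto
      ultimately have "e'' \<noteq> e" using isolated[of e' e p] e by auto
      then show "(\<sigma>(e := t)) e'' = \<sigma> e''" by simp
    qed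
    have f_inv: "f (\<sigma>(e := t)) = f \<sigma>" for \<sigma> t
      unfolding f_def by (intro arg_cong2[of _ _ _ _ "(*)"] prod.cong refl) (auto simp: s_inv)
    have "(\<Sum>\<sigma>\<in>spins E. (\<Prod>e\<in>C. \<sigma> e) * gibbs_weight \<beta> P \<sigma>)
      = (\<Sum>\<sigma>\<in>spins E. f \<sigma> * \<sigma> e * gibbs_weight \<beta> P \<sigma>)"
    proof -
      have "(\<Prod>e\<in>C - B. \<sigma> e) = \<sigma> e * (\<Prod>e\<in>C - insert e B. \<sigma> e)" for \<sigma> :: "'a \<Rightarrow> real"
        using prod.remove[of "C - B" e \<sigma>] e C(1) by (simp add: Diff_insert[of C e B])
      then show ?thesis using insert by (simp add: f_def mult_ac)
    qed
    also have "\<dots> = (\<Sum>\<sigma>\<in>spins E. f \<sigma> * tanh (\<beta> * s e \<sigma>) * gibbs_weight \<beta> P \<sigma>)"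
      unfolding s_def by (rule heat_bath_edge[OF e(2) P f_inv])
    also have "\<dots> = (\<Sum>\<sigma>\<in>spins E. (\<Prod>e\<in>C - insert e B. \<sigma> e) * (\<Prod>e\<in>insert e B. tanh (\<beta> * s e \<sigma>))
        * gibbs_weight \<beta> P \<sigma>)"
      using insert by (simp add: f_def mult_ac)
    finally show ?case .
  qed simp
  from this[OF A(1) order_refl]
  have "(\<Sum>\<sigma>\<in>spins E. (\<Prod>e\<in>C. \<sigma> e) * gibbs_weight \<beta> P \<sigma>)
    = (\<Sum>\<sigma>\<in>spins E. (\<Prod>e\<in>C - A. \<sigma> e) * (\<Prod>e\<in>A. tanh (\<beta> * s e \<sigma>)) * gibbs_weight \<beta> P \<sigma>)" .
  also have "\<dots> = (\<Sum>\<sigma>\<in>spins E. (\<Prod>e\<in>C. \<sigma> e) *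
    (\<Prod>e\<in>A. tanh (\<beta> * (\<Sum>p | p \<in> P \<and> e \<in> p. \<Prod>e'\<in>p. \<sigma> e'))) * gibbs_weight \<beta> P \<sigma>)"
  proof (rule sum.cong[OF refl])
    fix \<sigma> assume \<sigma>: "\<sigma> \<in> spins E"
    have "\<sigma> e * tanh (\<beta> * (\<Sum>p | p \<in> P \<and> e \<in> p. \<Prod>e'\<in>p. \<sigma> e')) = tanh (\<beta> * s e \<sigma>)" if "e \<in> A" for e
    proof -
      have "(\<Sum>p | p \<in> P \<and> e \<in> p. \<Prod>e'\<in>p. \<sigma> e') = \<sigma> e * s e \<sigma>"
        unfolding s_def sum_distrib_left using P(2)
        by (intro sum.cong refl) (auto simp: prod.remove)
      moreover have "\<sigma> e \<in> {-1, 1}" by (rule spins_sign[OF \<sigma>]) (use that A C in auto)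
      ultimately show ?thesis by auto
    qed
    then have "(\<Prod>e\<in>A. tanh (\<beta> * s e \<sigma>)) = (\<Prod>e\<in>A. \<sigma> e) *
        (\<Prod>e\<in>A. tanh (\<beta> * (\<Sum>p | p \<in> P \<and> e \<in> p. \<Prod>e'\<in>p. \<sigma> e')))"
      unfolding prod.distrib[symmetric] by (intro prod.cong refl) simp
    moreover have "(\<Prod>e\<in>C. \<sigma> e) = (\<Prod>e\<in>C - A. \<sigma> e) * (\<Prod>e\<in>A. \<sigma> e)"
      using prod.subset_diff[OF A(2) C(1)] .
    ultimately show "(\<Prod>e\<in>C - A. \<sigma> e) * (\<Prod>e\<in>A. tanh (\<beta> * s e \<sigma>)) * gibbs_weight \<beta> P \<sigma>
      = (\<Prod>e\<in>C. \<sigma> e) * (\<Prod>e\<in>A. tanh (\<beta> * (\<Sum>p | p \<in> P \<and> e \<in> p. \<Prod>e'\<in>p. \<sigma> e'))) * gibbs_weight \<beta> P \<sigma>"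
      by simp
  qed
  finally show ?thesis .
qed

text \<open>On the event considered, multiplication by \<open>\<tau>\<close> turns exactly the members of \<open>V\<close> from -1 to 1, and so increases the weight by the
factor \<open>exp (2 \<beta> |V|)\<close>; it is a bijection of configurations.\<close>

lemma peierls:
  fixes \<tau> :: "'e \<Rightarrow> real" and \<beta> :: real
  assumes E: "finite E" and P: "finite P" "\<And>p. p \<in> P \<Longrightarrow> p \<subseteq> E"
    and \<tau>: "\<And>e. e \<in> E \<Longrightarrow> \<tau> e \<in> {-1, 1}"
    and V: "V = {p \<in> P. (\<Prod>e\<in>p. \<tau> e) = -1}"
  shows "(\<Sum>\<sigma> | \<sigma> \<in> spins E \<and> (\<forall>p\<in>V. (\<Prod>e\<in>p. \<sigma> e) = -1). gibbs_weight \<beta> P \<sigma>)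
    \<le> exp (- 2 * \<beta> * card V) * (\<Sum>\<sigma>\<in>spins E. gibbs_weight \<beta> P \<sigma>)"
proof -
  let ?w = "gibbs_weight \<beta> P"
  have VP: "V \<subseteq> P" using V by auto
  have "?w \<sigma> = exp (- 2 * \<beta> * card V) * ?w (twist E \<tau> \<sigma>)"
    if "\<forall>p\<in>V. (\<Prod>e\<in>p. \<sigma> e) = -1" for \<sigma>
  proof -
    have t: "(\<Prod>e\<in>p. \<tau> e) = (if p \<in> V then -1 else 1)" if "p \<in> P" for p
    proof -
      have "(\<Prod>e\<in>p. \<tau> e) \<in> {-1, 1}"
        by (rule prod_sign, rule \<tau>) (use P(2)[OF that] in blast)
      then show ?thesis using that by (auto simp: V)
    qed
    have "(\<Sum>p\<in>P. \<Prod>e\<in>p. twist E \<tau> \<sigma> e) = (\<Sum>p\<in>P. (\<Prod>e\<in>p. \<sigma> e) + (if p \<in> V then 2 else 0))"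
      using that by (intro sum.cong refl) (auto simp: prod_twist[OF P(2)] t)
    also have "\<dots> = (\<Sum>p\<in>P. \<Prod>e\<in>p. \<sigma> e) + 2 * card V"
      using P(1) VP by (simp add: sum.distrib sum.If_cases Int_absorb1)
    finally show ?thesis by (simp add: gibbs_weight_def exp_add[symmetric] algebra_simps)
  qed
  then have "(\<Sum>\<sigma> | \<sigma> \<in> spins E \<and> (\<forall>p\<in>V. (\<Prod>e\<in>p. \<sigma> e) = -1). ?w \<sigma>)
    = exp (- 2 * \<beta> * card V) * (\<Sum>\<sigma> | \<sigma> \<in> spins E \<and> (\<forall>p\<in>V. (\<Prod>e\<in>p. \<sigma> e) = -1). ?w (twist E \<tau> \<sigma>))"
    unfolding sum_distrib_left by (intro sum.cong refl) auto
  also have "\<dots> \<le> exp (- 2 * \<beta> * card V) * (\<Sum>\<sigma>\<in>spins E. ?w (twist E \<tau> \<sigma>))"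
    by (intro mult_left_mono sum_mono2 finite_spins[OF E]) (auto simp: gibbs_weight_def)
  also have "(\<Sum>\<sigma>\<in>spins E. ?w (twist E \<tau> \<sigma>)) = (\<Sum>\<sigma>\<in>spins E. ?w \<sigma>)"
    by (rule sum_twist[OF \<tau>])
  finally show ?thesis .
qed

section \<open>Connected sets in graphs of bounded degree\<close>

text \<open>Connectedness of \<open>V\<close> with base point \<open>p\<close>, expressed by cuts; this form follows immediately for
components and allows a walk to be extended by one new vertex at a time.\<close>

definition connected_from :: "('a \<Rightarrow> 'a \<Rightarrow> bool) \<Rightarrow> 'a \<Rightarrow> 'a set \<Rightarrow> bool" where
  "connected_from r p V \<longleftrightarrow> finite V \<and> p \<in> V \<and>
     (\<forall>S. p \<in> S \<and> S \<subset> V \<longrightarrow> (\<exists>a\<in>S. \<exists>b\<in>V - S. r a b))"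

text \<open>A walk that has visited only a part of \<open>V\<close> is extended by an excursion along an edge that leaves this part, which costs two
steps per new vertex.\<close>

lemma connected_from_walk:
  assumes sym: "\<And>a b. r a b \<Longrightarrow> r b a" and conn: "connected_from r p V"
  shows "\<exists>xs. length xs = 2 * card V - 1 \<and> hd xs = p \<and> successively r xs \<and> set xs = V"
proof -
  have V: "finite V" "p \<in> V" using conn by (auto simp: connected_from_def)
  have "n < card V \<longrightarrow> (\<exists>xs. length xs = 2 * n + 1 \<and> hd xs = p \<and> successively r xs \<and>
      set xs \<subseteq> V \<and> card (set xs) = n + 1)" for n
  proof (induction n)
    case 0
    show ?case using V by (intro impI exI[of _ "[p]"]) auto
  next
    case (Suc n)
    show ?case
    proof
      assume n: "Suc n < card V"
      then obtain xs where xs: "length xs = 2 * n + 1" "hd xs = p" "successively r xs"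
        "set xs \<subseteq> V" "card (set xs) = n + 1"
        using Suc by auto
      have "p \<in> set xs" using xs(1,2) by (metis Suc_eq_plus1 length_greater_0_conv list.set_sel(1) zero_less_Suc)
      moreover have "set xs \<subset> V" using xs n by auto
      ultimately obtain a b where ab: "a \<in> set xs" "b \<in> V" "b \<notin> set xs" "r a b"
        using conn unfolding connected_from_def by blast
      obtain ys zs where split: "xs = ys @ a # zs" using ab(1) by (meson split_list)
      let ?ws = "ys @ a # b # a # zs"
      have "successively r ?ws"
        using xs(3) ab(4) sym[OF ab(4)] unfolding split successively_append_iff
        by (cases zs) auto
      moreover have "set ?ws = insert b (set xs)" by (auto simp: split)
      moreover have "hd ?ws = p" using xs(2) unfolding split by (cases ys) auto
      moreover have "length ?ws = 2 * Suc n + 1" using xs(1) by (simp add: split)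
      ultimately show "\<exists>xs. length xs = 2 * Suc n + 1 \<and> hd xs = p \<and> successively r xs \<and>
          set xs \<subseteq> V \<and> card (set xs) = Suc n + 1"
        using xs ab by (intro exI[of _ ?ws]) auto
    qed
  qed
  moreover have "card V > 0" using V by (auto simp: card_gt_0_iff)
  ultimately obtain xs where xs: "length xs = 2 * (card V - 1) + 1" "hd xs = p" "successively r xs"
      "set xs \<subseteq> V" "card (set xs) = card V - 1 + 1"
    by (metis diff_less zero_less_one)
  then have "set xs = V" using V \<open>card V > 0\<close> by (intro card_subset_eq) auto
  then show ?thesis using xs \<open>card V > 0\<close> by (intro exI[of _ xs]) auto
qed

lemma card_walks_le:
  assumes "\<And>p. finite {q. r p q}" "\<And>p. card {q. r p q} \<le> D"
  shows "finite {xs. length xs = Suc n \<and> hd xs = p \<and> successively r xs} \<and>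
    card {xs. length xs = Suc n \<and> hd xs = p \<and> successively r xs} \<le> D ^ n"
proof (induction n arbitrary: p)
  case 0
  have "{xs. length xs = Suc 0 \<and> hd xs = p \<and> successively r xs} = {[p]}"
    by (auto simp: length_Suc_conv)
  then show ?case by simp
next
  case (Suc n)
  let ?W = "\<lambda>n p. {xs. length xs = Suc n \<and> hd xs = p \<and> successively r xs}"
  have sub: "?W (Suc n) p \<subseteq> (\<Union>q\<in>{q. r p q}. (#) p ` ?W n q)"
    by (auto simp: length_Suc_conv)
  have fin: "finite (\<Union>q\<in>{q. r p q}. (#) p ` ?W n q)"
    using Suc assms(1) by blast
  have "card (?W (Suc n) p) \<le> card (\<Union>q\<in>{q. r p q}. (#) p ` ?W n q)"
    by (rule card_mono[OF fin sub])
  also have "\<dots> \<le> (\<Sum>q\<in>{q. r p q}. card ((#) p ` ?W n q))"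
    by (rule card_UN_le[OF assms(1)])
  also have "\<dots> \<le> (\<Sum>q\<in>{q. r p q}. D ^ n)"
  proof (rule sum_mono)
    fix q
    have "card ((#) p ` ?W n q) \<le> card (?W n q)" using Suc by (intro card_image_le) blast
    also have "\<dots> \<le> D ^ n" using Suc by blast
    finally show "card ((#) p ` ?W n q) \<le> D ^ n" .
  qed
  also have "\<dots> \<le> D ^ Suc n" using assms(2)[of p] by simp
  finally show ?case using finite_subset[OF sub fin] by blast
qed

text \<open>A connected set is determined by a covering walk, and there are at most \<open>D\<close> choices for each step.\<close>

lemma card_connected_from_le:
  assumes sym: "\<And>a b. r a b \<Longrightarrow> r b a"
    and deg: "\<And>p. finite {q. r p q}" "\<And>p. card {q. r p q} \<le> D" and m: "m > 0"
  shows "finite {V. connected_from r p V \<and> card V = m} \<and>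
    card {V. connected_from r p V \<and> card V = m} \<le> D ^ (2 * m - 2)"
proof -
  let ?W = "{xs. length xs = Suc (2 * m - 2) \<and> hd xs = p \<and> successively r xs}"
  have sub: "{V. connected_from r p V \<and> card V = m} \<subseteq> set ` ?W"
  proof
    fix V assume "V \<in> {V. connected_from r p V \<and> card V = m}"
    then obtain xs where "length xs = 2 * m - 1" "hd xs = p" "successively r xs" "set xs = V"
      using connected_from_walk[of r p V, OF sym] by auto
    moreover have "2 * m - 1 = Suc (2 * m - 2)" using m by simp
    ultimately show "V \<in> set ` ?W" by auto
  qed
  note W = card_walks_le[of r D "2 * m - 2" p, OF deg]
  have fin: "finite (set ` ?W)" using W by blast
  have "card {V. connected_from r p V \<and> card V = m} \<le> card (set ` ?W)"
    by (rule card_mono[OF fin sub])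
  also have "\<dots> \<le> card ?W" using W by (intro card_image_le) blast
  also have "\<dots> \<le> D ^ (2 * m - 2)" using W by blast
  finally show ?thesis using finite_subset[OF sub fin] by blast
qed

definition component :: "('a \<Rightarrow> 'a \<Rightarrow> bool) \<Rightarrow> 'a set \<Rightarrow> 'a \<Rightarrow> 'a set" where
  "component r A p = {q. (p, q) \<in> {(a, b). a \<in> A \<and> b \<in> A \<and> r a b}\<^sup>*}"

lemma component_self: "p \<in> component r A p"
  by (simp add: component_def)

lemma component_subset:
  assumes "p \<in> A" shows "component r A p \<subseteq> A"
proof
  fix q assume "q \<in> component r A p"
  then have "(p, q) \<in> {(a, b). a \<in> A \<and> b \<in> A \<and> r a b}\<^sup>*" by (simp add: component_def)
  then show "q \<in> A" using assms by (induction rule: rtrancl_induct) auto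
qed

lemma component_closed:
  "\<lbrakk>a \<in> component r A p; p \<in> A; b \<in> A; r a b\<rbrakk> \<Longrightarrow> b \<in> component r A p"
  using component_subset[of p A r] unfolding component_def
  by (auto intro: rtrancl_into_rtrancl)

lemma connected_from_component:
  assumes "finite A" "p \<in> A"
  shows "connected_from r p (component r A p)"
  unfolding connected_from_def
proof (intro conjI allI impI)
  show "finite (component r A p)" using component_subset[OF assms(2)] assms(1) finite_subset by blast
  show "p \<in> component r A p" by (rule component_self)
  fix S assume S: "p \<in> S \<and> S \<subset> component r A p"
  show "\<exists>a\<in>S. \<exists>b\<in>component r A p - S. r a b"
  proof (rule ccontr)
    assume none: "\<not> ?thesis"
    have "q \<in> S" if "q \<in> component r A p" for q
    proof -
      have "(p, q) \<in> {(a, b). a \<in> A \<and> b \<in> A \<and> r a b}\<^sup>*" using that by (simp add: component_def)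
      then show ?thesis
      proof (induction rule: rtrancl_induct)
        case (step y z)
        then have "z \<in> component r A p" unfolding component_def
          by (simp add: rtrancl.rtrancl_into_rtrancl)
        then show ?case using step none by auto
      qed (use S in simp)
    qed
    then show False using S by blast
  qed
qed

text \<open>Removing one component does not affect the others.\<close>

lemma component_Diff:
  assumes sym: "\<And>a b. r a b \<Longrightarrow> r b a" and p: "p \<in> A" and q: "q \<in> A" "q \<notin> component r A p"
  shows "component r (A - component r A p) q = component r A q"
proof
  show "component r (A - component r A p) q \<subseteq> component r A q"
    unfolding component_def by (auto elim!: rtrancl_mono[THEN subsetD, rotated])
  show "component r A q \<subseteq> component r (A - component r A p) q"
  proof
    fix z assume "z \<in> component r A q"
    then have "(q, z) \<in> {(a, b). a \<in> A \<and> b \<in> A \<and> r a b}\<^sup>*" by (simp add: component_def)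
    then have "z \<in> component r (A - component r A p) q \<and> z \<notin> component r A p"
    proof (induction rule: rtrancl_induct)
      case base
      then show ?case using q by (simp add: component_self)
    next
      case (step y z)
      then have yz: "y \<in> A" "z \<in> A" "r y z" by auto
      have "z \<notin> component r A p"
        using step.IH component_closed[of z r A p y] p yz(1) sym[OF yz(3)] by blast
      then show ?case
        using step.IH yz component_closed[of y r "A - component r A p" q z] q by auto
    qed
    then show "z \<in> component r (A - component r A p) q" by simp
  qed
qed

lemma component_eq:
  assumes sym: "\<And>a b. r a b \<Longrightarrow> r b a" and q: "q \<in> component r A p"
  shows "component r A q = component r A p"
proof -
  let ?R = "{(a, b). a \<in> A \<and> b \<in> A \<and> r a b}"
  have "sym ?R" using sym by (auto simp: sym_def)
  then have "sym (?R\<^sup>*)" by (rule sym_rtrancl)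
  moreover have pq: "(p, q) \<in> ?R\<^sup>*" using q by (simp add: component_def)
  ultimately have qp: "(q, p) \<in> ?R\<^sup>*" by (auto simp: sym_def)
  show ?thesis unfolding component_def using pq qp by (auto intro: rtrancl_trans)
qed

section \<open>Edges and plaquettes of the four-dimensional lattice\<close>

definition edge_at :: "site \<Rightarrow> 4 \<Rightarrow> edge" where
  "edge_at x i = {x, x + axis i 1}"

definition plaq_at :: "site \<Rightarrow> 4 \<Rightarrow> 4 \<Rightarrow> plaquette" where
  "plaq_at x i j = {edge_at x i, edge_at (x + axis i 1) j, edge_at (x + axis j 1) i, edge_at x j}"

lemma axis_eq_iff_int [simp]: "(axis i 1 :: int ^ 'n) = axis j 1 \<longleftrightarrow> i = j"
  by (auto simp: vec_eq_iff)

lemma add_axis_neq [simp]: "x + axis i 1 \<noteq> (x :: int ^ 'n)" "x \<noteq> x + axis i (1::int)"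
  by (auto simp: vec_eq_iff)

lemma diff_axis_neq [simp]: "x - axis i 1 \<noteq> (x :: int ^ 'n)" "x \<noteq> x - axis i (1::int)"
  using add_axis_neq[of "x - axis i 1" i] by auto

lemma edge_at_inject [simp]: "edge_at x i = edge_at y j \<longleftrightarrow> x = y \<and> i = j"
proof
  assume "edge_at x i = edge_at y j"
  then have "(x = y \<and> x + axis i 1 = y + axis j 1) \<or> (x = y + axis j 1 \<and> x + axis i 1 = y)"
    by (simp add: edge_at_def doubleton_eq_iff)
  then show "x = y \<and> i = j"
  proof
    assume h: "x = y + axis j 1 \<and> x + axis i 1 = y"
    have "x $ j = (y + axis j 1) $ j" "(x + axis i 1) $ j = y $ j"
      by (rule arg_cong[OF conjunct1[OF h]], rule arg_cong[OF conjunct2[OF h]])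
    then show ?thesis by (simp split: if_splits)
  qed auto
qed simp

lemma neighbors_iff: "neighbors x y \<longleftrightarrow> (\<exists>i. y = x + axis i 1 \<or> x = y + axis i 1)"
proof
  assume n: "neighbors x y"
  then have sum1: "(\<Sum>i\<in>UNIV. \<bar>x $ i - y $ i\<bar>) = 1" by (simp add: neighbors_def)
  then obtain i where i: "x $ i \<noteq> y $ i"
    by (metis (no_types, lifting) abs_0 cancel_comm_monoid_add_class.diff_cancel sum.neutral zero_neq_one)
  have "\<bar>x $ i - y $ i\<bar> + (\<Sum>k\<in>UNIV - {i}. \<bar>x $ k - y $ k\<bar>) = 1"
    using sum1 by (simp add: sum.remove[of UNIV i])
  moreover have "(\<Sum>k\<in>UNIV - {i}. \<bar>x $ k - y $ k\<bar>) \<ge> 0" by (intro sum_nonneg) simp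
  moreover have "\<bar>x $ i - y $ i\<bar> \<ge> 1" using i by linarith
  ultimately have *: "\<bar>x $ i - y $ i\<bar> = 1" "(\<Sum>k\<in>UNIV - {i}. \<bar>x $ k - y $ k\<bar>) = 0"
    by linarith+
  then have rest: "x $ k = y $ k" if "k \<noteq> i" for k
    using that by (simp add: sum_nonneg_eq_0_iff)
  have "y $ i = x $ i + 1 \<or> x $ i = y $ i + 1" using *(1) by linarith
  then have "y = x + axis i 1 \<or> x = y + axis i 1"
    using rest by (auto simp: vec_eq_iff)
  then show "\<exists>i. y = x + axis i 1 \<or> x = y + axis i 1" by blast
next
  assume "\<exists>i. y = x + axis i 1 \<or> x = y + axis i 1"
  then obtain i where "y = x + axis i 1 \<or> x = y + axis i 1" by blast
  then have "\<bar>x $ k - y $ k\<bar> = (if k = i then 1 else 0)" for k by auto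
  then show "neighbors x y" by (simp add: neighbors_def)
qed

lemma edges_iff: "e \<in> edges \<longleftrightarrow> (\<exists>x i. e = edge_at x i)"
  unfolding edges_def edge_at_def neighbors_iff by (auto simp: insert_commute)

lemma plaquettes_iff: "p \<in> plaquettes \<longleftrightarrow> (\<exists>x i j. i \<noteq> j \<and> p = plaq_at x i j)"
proof -
  have "{{x, x + axis i 1}, {x + axis i 1, x + axis i 1 + axis j 1},
       {x + axis i 1 + axis j 1, x + axis j 1}, {x + axis j 1, x}} = plaq_at x i j" for x :: site and i j
    unfolding plaq_at_def edge_at_def by (simp add: insert_commute add_ac)
  then show ?thesis unfolding plaquettes_def by auto
qed

lemma plaq_at_sym: "plaq_at x i j = plaq_at x j i"
  by (auto simp: plaq_at_def)

lemma edge_in_plaq: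
  "edge_at x k \<in> plaq_at y i j \<longleftrightarrow> (k = i \<and> (x = y \<or> x = y + axis j 1)) \<or> (k = j \<and> (x = y \<or> x = y + axis i 1))"
  by (auto simp: plaq_at_def)

lemma plaq_at_inject:
  assumes "i \<noteq> j" "k \<noteq> l"
  shows "plaq_at x i j = plaq_at y k l \<longleftrightarrow> x = y \<and> {i, j} = {k, l}"
proof
  assume eq: "plaq_at x i j = plaq_at y k l"
  have "edge_at x i \<in> plaq_at y k l" "edge_at x j \<in> plaq_at y k l"
    unfolding eq[symmetric] by (auto simp: edge_in_plaq)
  then show "x = y \<and> {i, j} = {k, l}"
    using assms by (auto simp: edge_in_plaq)
next
  assume "x = y \<and> {i, j} = {k, l}"
  then show "plaq_at x i j = plaq_at y k l" by (auto simp: doubleton_eq_iff plaq_at_sym)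
qed

lemma prod_plaq_at:
  assumes "i \<noteq> j"
  shows "(\<Prod>e\<in>plaq_at x i j. \<tau> e) = cobound (\<lambda>x i. \<tau> (edge_at x i)) x i j"
  using assms unfolding plaq_at_def cobound_def by (simp add: mult_ac)

lemma Union_plaq_at:
  "\<Union>(plaq_at x i j) = {x, x + axis i 1, x + axis j 1, x + axis i 1 + axis j 1}"
  by (auto simp: plaq_at_def edge_at_def add_ac)

definition box_corner :: "nat \<Rightarrow> site" where
  "box_corner N = (\<chi> k. int N)"

lemma box_eq: "box N = lattice_box (- box_corner N) (box_corner N)"
  by (auto simp: box_def lattice_box_def box_corner_def)

lemma edge_in_box: "edge_at x i \<in> box_edges N \<longleftrightarrow> x \<in> box N \<and> x + axis i 1 \<in> box N"
  unfolding box_edges_def using edges_iff by (auto simp: edge_at_def)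

lemma box_interval:
  assumes "x \<in> box N" "x + axis i 1 + axis j 1 \<in> box N"
  shows "x + axis i 1 \<in> box N" "x + axis j 1 \<in> box N"
proof -
  have "- int N \<le> (x + axis m 1) $ k \<and> (x + axis m 1) $ k \<le> int N" if "m = i \<or> m = j" for k m
  proof -
    have "- int N \<le> x $ k" "(x + axis i 1 + axis j 1) $ k \<le> int N"
      using assms unfolding box_def by auto
    then show ?thesis using that by (auto split: if_splits)
  qed
  then show "x + axis i 1 \<in> box N" "x + axis j 1 \<in> box N" unfolding box_def by blast+
qed

lemma plaq_in_box:
  assumes "i \<noteq> j"
  shows "plaq_at x i j \<in> box_plaquettes N \<longleftrightarrow> x \<in> box N \<and> x + axis i 1 + axis j 1 \<in> box N"
proof -
  have "plaq_at x i j \<in> plaquettes" using assms plaquettes_iff by blast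
  then show ?thesis
    unfolding box_plaquettes_def using box_interval[of x N i j]
    by (auto simp: plaq_at_def edge_in_box add_ac)
qed

lemma box_plaquettesE:
  assumes "p \<in> box_plaquettes N"
  obtains x i j where "i \<noteq> j" "p = plaq_at x i j" "x \<in> box N" "x + axis i 1 + axis j 1 \<in> box N"
  using assms plaq_in_box plaquettes_iff unfolding box_plaquettes_def by (metis (no_types, lifting) CollectD assms)

lemma finite_box_edges: "finite (box_edges N)"
  by (rule finite_subset[of _ "Pow (box N)"]) (auto simp: box_edges_def finite_box)

lemma finite_box_plaquettes: "finite (box_plaquettes N)"
  by (rule finite_subset[of _ "Pow (box_edges N)"]) (auto simp: box_plaquettes_def finite_box_edges)

lemma finite_plaquette: "p \<in> plaquettes \<Longrightarrow> finite p"
  by (auto simp: plaquettes_def)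

definition star :: "edge \<Rightarrow> plaquette set" where
  "star e = {p \<in> plaquettes. e \<in> p}"

text \<open>The two plaquettes in each of the three planes through the edge.\<close>

lemma star_edge_at:
  "star (edge_at x i) = (\<lambda>(j, s). plaq_at (if s then x else x - axis j 1) i j) ` ((UNIV - {i}) \<times> UNIV)"
proof (intro equalityI subsetI)
  fix p assume "p \<in> star (edge_at x i)"
  then obtain y a b where p: "a \<noteq> b" "p = plaq_at y a b" "edge_at x i \<in> plaq_at y a b"
    by (auto simp: star_def plaquettes_iff)
  from p(3) have "\<exists>j s. j \<noteq> i \<and> p = plaq_at (if s then x else x - axis j 1) i j"
    unfolding edge_in_plaq
  proof (elim disjE conjE)
    assume "i = a" "x = y"
    then show ?thesis using p by (intro exI[of _ b] exI[of _ True]) auto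
  next
    assume "i = a" "x = y + axis b 1"
    then show ?thesis using p by (intro exI[of _ b] exI[of _ False]) auto
  next
    assume "i = b" "x = y"
    then show ?thesis using p plaq_at_sym by (intro exI[of _ a] exI[of _ True]) auto
  next
    assume "i = b" "x = y + axis a 1"
    then show ?thesis using p plaq_at_sym by (intro exI[of _ a] exI[of _ False]) auto
  qed
  then obtain j s where "j \<noteq> i" "p = plaq_at (if s then x else x - axis j 1) i j" by blast
  then show "p \<in> (\<lambda>(j, s). plaq_at (if s then x else x - axis j 1) i j) ` ((UNIV - {i}) \<times> UNIV)"
    by (intro image_eqI[of _ _ "(j, s)"]) auto
next
  fix p assume "p \<in> (\<lambda>(j, s). plaq_at (if s then x else x - axis j 1) i j) ` ((UNIV - {i}) \<times> UNIV)"
  then obtain j s where p: "j \<noteq> i" "p = plaq_at (if s then x else x - axis j 1) i j" by auto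
  then have "p \<in> plaquettes" using plaquettes_iff by metis
  moreover have "edge_at x i \<in> p" using p by (cases s) (simp_all add: edge_in_plaq)
  ultimately show "p \<in> star (edge_at x i)" by (simp add: star_def)
qed

lemma card_star:
  assumes "e \<in> edges"
  shows "finite (star e)" "card (star e) = 6"
proof -
  obtain x i where e: "e = edge_at x i" using assms edges_iff by blast
  let ?f = "\<lambda>(j, s). plaq_at (if s then x else x - axis j 1) i j"
  have inj: "inj_on ?f ((UNIV - {i}) \<times> UNIV)"
  proof (rule inj_onI)
    fix a b
    assume a: "a \<in> (UNIV - {i}) \<times> (UNIV :: bool set)" and b: "b \<in> (UNIV - {i}) \<times> (UNIV :: bool set)"
      and eq: "?f a = ?f b"
    obtain j s j' s' where ab: "a = (j, s)" "b = (j', s')" by (cases a, cases b) auto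
    have j: "j \<noteq> i" "j' \<noteq> i" using a b ab by auto
    then have *: "(if s then x else x - axis j 1) = (if s' then x else x - axis j' 1)" "{i, j} = {i, j'}"
      using plaq_at_inject[of i j i j'] eq ab by auto
    then have "j = j'" using j by (auto simp: doubleton_eq_iff)
    moreover have "s = s'" using *(1) by (cases s; cases s') simp_all
    ultimately show "a = b" using ab by simp
  qed
  show "finite (star e)" unfolding e star_edge_at by simp
  have "card (star e) = card ((UNIV - {i}) \<times> (UNIV :: bool set))"
    unfolding e star_edge_at by (rule card_image[OF inj])
  also have "\<dots> = 6" by (simp add: card_cartesian_product)
  finally show "card (star e) = 6" .
qed

lemma card_star_Int_le:
  assumes "e \<in> edges" "e' \<in> edges" "e \<noteq> e'"
  shows "card (star e \<inter> star e') \<le> 1"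
proof -
  obtain x k where e: "e = edge_at x k" using assms edges_iff by blast
  obtain y l where e': "e' = edge_at y l" using assms edges_iff by blast
  have "p = q" if p: "p \<in> star e \<inter> star e'" and q: "q \<in> star e \<inter> star e'" for p q
  proof -
    obtain j s where 1: "j \<noteq> k" "p = plaq_at (if s then x else x - axis j 1) k j"
      using p unfolding e star_edge_at by auto
    obtain i t where 2: "i \<noteq> k" "q = plaq_at (if t then x else x - axis i 1) k i"
      using q unfolding e star_edge_at by auto
    have mem: "edge_at y l \<in> p" "edge_at y l \<in> q" using p q by (auto simp: star_def e')
    have yx: "\<not> (y = x \<and> l = k)" using assms(3) e e' by auto
    have side: "(l = k \<longrightarrow> y $ a = x $ a + (if u then 1 else - 1) \<and> (\<forall>m. m \<noteq> a \<longrightarrow> y $ m = x $ m)) \<and>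
        (l \<noteq> k \<longrightarrow> l = a \<and> y $ a = x $ a + (if u then 0 else - 1))"
      if "a \<noteq> k" "edge_at y l \<in> plaq_at (if u then x else x - axis a 1) k a" for a u
      using that yx by (cases u) (auto simp: edge_in_plaq)
    note j = side[OF 1(1) mem(1)[unfolded 1(2)]] and i = side[OF 2(1) mem(2)[unfolded 2(2)]]
    have "i = j" 
    proof (cases "l = k")
      case True
      then have "y $ i \<noteq> x $ i" using i by (auto split: if_splits)
      then show ?thesis using j True by blast
    qed (use i j in auto)
    moreover have "s = t" using i j \<open>i = j\<close> by (cases "l = k") (auto split: if_splits)
    ultimately show ?thesis using 1 2 by simp
  qed
  then have "card (star e \<inter> star e') \<le> Suc 0"
    by (subst card_le_Suc0_iff_eq) (use card_star(1)[OF assms(1)] in auto)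
  then show ?thesis by simp
qed

section \<open>Vortices and linking\<close>

text \<open>A coarse adjacency: any two corners differ by at most 2 in every coordinate. It relates any two faces of a
common cube, so that components are closed, and any two plaquettes that share an edge, so that the negative plaquettes around an
edge belong to a single component.\<close>

definition near :: "plaquette \<Rightarrow> plaquette \<Rightarrow> bool" where
  "near p q \<longleftrightarrow> p \<in> plaquettes \<and> q \<in> plaquettes \<and>
     (\<forall>a\<in>\<Union>p. \<forall>b\<in>\<Union>q. \<forall>k. \<bar>a $ k - b $ k\<bar> \<le> 2)"

lemma near_sym: "near p q \<Longrightarrow> near q p"
  unfolding near_def by (subst abs_minus_commute) blast

lemma card_lattice_cube_le:
  "finite {y :: site. \<forall>k. \<bar>y $ k - c $ k\<bar> \<le> int n} \<and>
   card {y :: site. \<forall>k. \<bar>y $ k - c $ k\<bar> \<le> int n} \<le> (2 * n + 1) ^ 4"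
proof -
  let ?Y = "{y :: site. \<forall>k. \<bar>y $ k - c $ k\<bar> \<le> int n}"
  let ?R = "PiE UNIV (\<lambda>k::4. {c $ k - int n..c $ k + int n})"
  have inj: "inj_on vec_nth ?Y" by (auto simp: inj_on_def vec_eq_iff)
  have sub: "vec_nth ` ?Y \<subseteq> ?R"
    by (auto simp: abs_le_iff algebra_simps)
  have finR: "finite ?R" by (intro finite_PiE) auto
  have "card ?R = (2 * n + 1) ^ 4"
    by (subst card_PiE) (simp_all add: nat_add_distrib nat_mult_distrib)
  then show ?thesis
    using card_inj_on_le[OF inj sub finR] finite_imageD[OF finite_subset[OF sub finR] inj] by simp
qed

text \<open>A plaquette is given by a site and two directions. If it is near \<open>p\<close>, the site lies in a cube of side 5 around a corner of \<open>p\<close>,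
which leaves \<open>5 ^ 4 * 16 = 10000\<close> possibilities.\<close>

lemma near_degree: "finite {q. near p q} \<and> card {q. near p q} \<le> 10000"
proof (cases "\<exists>q. near p q")
  case True
  then obtain x i j where p: "i \<noteq> j" "p = plaq_at x i j" unfolding near_def plaquettes_iff by blast
  let ?Y = "{y :: site. \<forall>k. \<bar>y $ k - x $ k\<bar> \<le> int 2}"
  note Y = card_lattice_cube_le[of x 2]
  have sub: "{q. near p q} \<subseteq> (\<lambda>(y, k, l). plaq_at y k l) ` (?Y \<times> UNIV \<times> UNIV)"
  proof
    fix q assume "q \<in> {q. near p q}"
    then have q: "near p q" by simp
    then obtain y k l where qy: "q = plaq_at y k l" unfolding near_def plaquettes_iff by blast
    have "x \<in> \<Union>p" "y \<in> \<Union>q" unfolding p qy Union_plaq_at by auto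
    then have "\<bar>x $ k - y $ k\<bar> \<le> 2" for k using q unfolding near_def by blast
    then have "y \<in> ?Y" by (simp add: abs_minus_commute)
    then show "q \<in> (\<lambda>(y, k, l). plaq_at y k l) ` (?Y \<times> UNIV \<times> UNIV)"
      unfolding qy by (intro image_eqI[of _ _ "(y, k, l)"]) auto
  qed
  have fin: "finite (?Y \<times> (UNIV :: 4 set) \<times> (UNIV :: 4 set))" using Y by auto
  have "card {q. near p q} \<le> card (?Y \<times> (UNIV :: 4 set) \<times> (UNIV :: 4 set))"
    by (rule order_trans[OF card_mono[OF finite_imageI[OF fin] sub] card_image_le[OF fin]])
  also have "\<dots> \<le> 10000" using Y by (simp add: card_cartesian_product)
  finally show ?thesis using finite_subset[OF sub finite_imageI[OF fin]] by blast
qed simp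

definition plaq_sign :: "plaquette set \<Rightarrow> site \<Rightarrow> 4 \<Rightarrow> 4 \<Rightarrow> real" where
  "plaq_sign V x i j = (if i \<noteq> j \<and> plaq_at x i j \<in> V then -1 else 1)"

definition closed_on_box :: "nat \<Rightarrow> plaquette set \<Rightarrow> bool" where
  "closed_on_box N V \<longleftrightarrow> (\<forall>x i j k. distinct [i, j, k] \<longrightarrow> x \<in> box N \<longrightarrow>
     x + axis i 1 + axis j 1 + axis k 1 \<in> box N \<longrightarrow> cube_prod (plaq_sign V) x i j k = 1)"

definition excited :: "nat \<Rightarrow> spin_config \<Rightarrow> plaquette set" where
  "excited N \<tau> = {p \<in> box_plaquettes N. (\<Prod>e\<in>p. \<tau> e) = -1}"

lemma plaq_sign_sign: "plaq_sign V x i j \<in> {-1, 1}"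
  by (simp add: plaq_sign_def)

lemma plaq_sign_sym: "plaq_sign V x i j = plaq_sign V x j i"
  using plaq_at_sym[of x i j] by (auto simp: plaq_sign_def)

lemma excited_subset: "excited N \<tau> \<subseteq> box_plaquettes N"
  by (auto simp: excited_def)

lemma box_mono_interval:
  assumes "x \<in> box N" "y \<in> box N" "\<And>k. x $ k \<le> z $ k" "\<And>k. z $ k \<le> y $ k"
  shows "z \<in> box N"
proof -
  have "- int N \<le> z $ k \<and> z $ k \<le> int N" for k
    using assms(1,2) assms(3,4)[of k] order_trans unfolding box_def by blast
  then show ?thesis by (simp add: box_def)
qed

lemma plaq_sign_excited:
  assumes \<tau>: "\<And>e. e \<in> box_edges N \<Longrightarrow> \<tau> e \<in> {-1, 1}"
    and ij: "i \<noteq> j" and box: "x \<in> box N" "x + axis i 1 + axis j 1 \<in> box N"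
  shows "plaq_sign (excited N \<tau>) x i j = cobound (\<lambda>x i. \<tau> (edge_at x i)) x i j"
proof -
  have p: "plaq_at x i j \<in> box_plaquettes N" using plaq_in_box ij box by blast
  have "(\<Prod>e\<in>plaq_at x i j. \<tau> e) \<in> {-1, 1}"
    by (rule prod_sign, rule \<tau>) (use p in \<open>auto simp: box_plaquettes_def\<close>)
  then show ?thesis using p ij
    unfolding plaq_sign_def excited_def prod_plaq_at[OF ij, symmetric] by auto
qed

lemma closed_excited:
  assumes \<tau>: "\<And>e. e \<in> box_edges N \<Longrightarrow> \<tau> e \<in> {-1, 1}"
  shows "closed_on_box N (excited N \<tau>)"
  unfolding closed_on_box_def
proof (intro allI impI)
  fix x i j k
  assume ijk: "distinct [i, j, k]" and x: "x \<in> box N" and y: "x + axis i 1 + axis j 1 + axis k 1 \<in> box N"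
  define a where "a x i = (if edge_at x i \<in> box_edges N then \<tau> (edge_at x i) else 1)" for x i
  have a: "a x i \<in> {-1, 1}" for x i using \<tau>[of "edge_at x i"] by (simp add: a_def)
  have eq: "plaq_sign (excited N \<tau>) z m n = cobound a z m n"
    if "m \<noteq> n" "\<And>k. x $ k \<le> z $ k"
      "\<And>l. (z + axis m 1 + axis n 1) $ l \<le> (x + axis i 1 + axis j 1 + axis k 1) $ l" for z m n
  proof -
    have 1: "z + axis m 1 + axis n 1 \<in> box N"
    proof (rule box_mono_interval[OF x y _ that(3)])
      fix l show "x $ l \<le> (z + axis m 1 + axis n 1) $ l" using that(2)[of l] by auto
    qed
    have 2: "z \<in> box N"
    proof (rule box_mono_interval[OF x 1 that(2)])
      fix l show "z $ l \<le> (z + axis m 1 + axis n 1) $ l" by simp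
    qed
    have "edge_at z m \<in> box_edges N" "edge_at (z + axis m 1) n \<in> box_edges N"
      "edge_at (z + axis n 1) m \<in> box_edges N" "edge_at z n \<in> box_edges N"
      using plaq_in_box[OF that(1), of z N] 1 2 by (auto simp: box_plaquettes_def plaq_at_def)
    then have "cobound a z m n = cobound (\<lambda>x i. \<tau> (edge_at x i)) z m n"
      by (simp add: cobound_def a_def)
    then show ?thesis using plaq_sign_excited[OF \<tau> that(1) 2 1] by simp
  qed
  have "cube_prod (plaq_sign (excited N \<tau>)) x i j k = cube_prod (cobound a) x i j k"
    unfolding cube_prod_def using ijk by (subst (1 2 3 4 5 6) eq) auto
  then show "cube_prod (plaq_sign (excited N \<tau>)) x i j k = 1"
    using cube_prod_cobound[of a, OF a] by simp
qed

text \<open>If \<open>V\<close> is a union of components of \<open>A\<close>, then a cube with a face in \<open>V\<close> has the same faces in \<open>V\<close> as in \<open>A\<close>.\<close>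

lemma cube_faces_near:
  assumes V: "\<And>p q. p \<in> V \<Longrightarrow> q \<in> A \<Longrightarrow> near p q \<Longrightarrow> q \<in> V" and VA: "V \<subseteq> A"
    and ijk: "distinct [i, j, k]"
  shows "cube_prod (plaq_sign V) x i j k = 1 \<or> cube_prod (plaq_sign V) x i j k = cube_prod (plaq_sign A) x i j k"
proof -
  define F where "F = {(x, i, j), (x + axis k 1, i, j), (x, i, k), (x + axis j 1, i, k),
     (x, j, k), (x + axis i 1, j, k)}"
  have F: "m \<noteq> n \<and> (\<forall>a \<in> \<Union>(plaq_at y m n). \<forall>l. x $ l \<le> a $ l \<and> a $ l \<le> x $ l + 1)"
    if "(y, m, n) \<in> F" for y m n
    using that ijk unfolding F_def Union_plaq_at by auto
  have nr: "near (plaq_at y m n) (plaq_at y' m' n')" if "(y, m, n) \<in> F" "(y', m', n') \<in> F" for y m n y' m' n'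
    unfolding near_def
  proof (intro conjI ballI allI)
    show "plaq_at y m n \<in> plaquettes" "plaq_at y' m' n' \<in> plaquettes"
      using F[OF that(1)] F[OF that(2)] plaquettes_iff by blast+
    fix a b l assume "a \<in> \<Union>(plaq_at y m n)" "b \<in> \<Union>(plaq_at y' m' n')"
    then have "x $ l \<le> a $ l \<and> a $ l \<le> x $ l + 1" "x $ l \<le> b $ l \<and> b $ l \<le> x $ l + 1"
      using F[OF that(1)] F[OF that(2)] by blast+
    then show "\<bar>a $ l - b $ l\<bar> \<le> 2" by linarith
  qed
  show ?thesis
  proof (cases "\<exists>(y, m, n)\<in>F. plaq_at y m n \<in> V")
    case True
    then obtain y m n where ymn: "(y, m, n) \<in> F" "plaq_at y m n \<in> V" by auto
    have "plaq_sign V y' m' n' = plaq_sign A y' m' n'" if "(y', m', n') \<in> F" for y' m' n'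
      using V[OF ymn(2) _ nr[OF ymn(1) that]] VA by (auto simp: plaq_sign_def)
    then show ?thesis unfolding cube_prod_def F_def by simp
  next
    case False
    then have "plaq_sign V y' m' n' = 1" if "(y', m', n') \<in> F" for y' m' n'
      using that by (auto simp: plaq_sign_def)
    then show ?thesis unfolding cube_prod_def F_def by simp
  qed
qed

lemma closed_component:
  assumes A: "closed_on_box N A" and p: "p \<in> A"
  shows "closed_on_box N (component near A p)"
  unfolding closed_on_box_def
proof (intro allI impI)
  fix x i j k
  assume *: "distinct [i, j, k]" "x \<in> box N" "x + axis i 1 + axis j 1 + axis k 1 \<in> box N"
  have "cube_prod (plaq_sign A) x i j k = 1" using A * unfolding closed_on_box_def by blast
  then show "cube_prod (plaq_sign (component near A p)) x i j k = 1"
    using cube_faces_near[of "component near A p" A i j k x, OF component_closed[OF _ p] component_subset[OF p] *(1)]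
    by auto
qed

text \<open>The Poincare lemma translated to sets of plaquettes: every closed set is the set of negative plaquettes of
some spin configuration.\<close>

lemma closed_on_box_exact:
  assumes closed: "closed_on_box N V" and V: "V \<subseteq> box_plaquettes N"
  shows "\<exists>\<tau>. (\<forall>e. \<tau> e \<in> {-1, 1}) \<and> excited N \<tau> = V"
proof -
  have "\<exists>a. (\<forall>x i. a x i \<in> {-1, 1}) \<and> (\<forall>x i j. i \<noteq> j \<and> x \<in> box N \<and> x + axis i 1 + axis j 1 \<in> box N
      \<longrightarrow> plaq_sign V x i j = cobound a x i j)"
    unfolding box_eq
  proof (rule closed_2cochain_exact_on_box)
    show "plaq_sign V x i j \<in> {-1, 1}" for x i j by (rule plaq_sign_sign)
    show "plaq_sign V x i j = plaq_sign V x j i" for x i j by (rule plaq_sign_sym)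
    show "cube_prod (plaq_sign V) x i j k = 1"
      if "distinct [i, j, k]" "x \<in> lattice_box (- box_corner N) (box_corner N)"
       "x + axis i 1 + axis j 1 + axis k 1 \<in> lattice_box (- box_corner N) (box_corner N)" for x i j k
      using closed that unfolding closed_on_box_def box_eq by blast
  qed
  then obtain a where "(\<forall>x i. a x i \<in> {-1, 1}) \<and> (\<forall>x i j. i \<noteq> j \<and> x \<in> box N \<and>
      x + axis i 1 + axis j 1 \<in> box N \<longrightarrow> plaq_sign V x i j = cobound a x i j)"
    by (rule exE)
  then have a: "\<And>x i. a x i \<in> {-1, 1}" and av: "\<And>x i j. i \<noteq> j \<Longrightarrow> x \<in> box N \<Longrightarrow>
      x + axis i 1 + axis j 1 \<in> box N \<Longrightarrow> plaq_sign V x i j = cobound a x i j"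
    by simp_all
  define f where "f = (\<lambda>(x, i). edge_at x i)"
  have "inj f" by (auto simp: inj_def f_def)
  then have inv: "inv f (edge_at x i) = (x, i)" for x i using inv_f_f[of f "(x, i)"] by (simp add: f_def)
  define \<tau> where "\<tau> e = a (fst (inv f e)) (snd (inv f e))" for e
  have \<tau>: "\<tau> e \<in> {-1, 1}" for e unfolding \<tau>_def by (rule a)
  have \<tau>a: "(\<lambda>x i. \<tau> (edge_at x i)) = a" by (simp add: \<tau>_def inv)
  have "p \<in> excited N \<tau> \<longleftrightarrow> p \<in> V" if p: "p \<in> box_plaquettes N" for p
  proof -
    obtain x i j where x: "i \<noteq> j" "p = plaq_at x i j" "x \<in> box N" "x + axis i 1 + axis j 1 \<in> box N"
      by (rule box_plaquettesE[OF p])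
    have "(\<Prod>e\<in>p. \<tau> e) = cobound a x i j"
      unfolding x(2) prod_plaq_at[OF x(1)] \<tau>a by (rule refl)
    then have "p \<in> excited N \<tau> \<longleftrightarrow> cobound a x i j = -1"
      using p by (simp add: excited_def)
    also have "\<dots> \<longleftrightarrow> p \<in> V" using av[OF x(1,3,4)] x(1,2) by (simp add: plaq_sign_def split: if_splits)
    finally show ?thesis .
  qed
  then have "excited N \<tau> = V" using V excited_subset by blast
  then show ?thesis using \<tau> by (intro exI[of _ \<tau>]) simp
qed

text \<open>Cycles modulo 2, characterised by duality with gradients: every gradient has trivial holonomy.\<close>

definition mod2_cycle :: "edge set \<Rightarrow> bool" where
  "mod2_cycle \<gamma> \<longleftrightarrow> finite \<gamma> \<and> \<gamma> \<subseteq> edges \<and>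
     (\<forall>g :: site \<Rightarrow> real. (\<forall>x. g x \<in> {-1, 1}) \<longrightarrow> (\<Prod>e\<in>\<gamma>. \<Prod>x\<in>e. g x) = 1)"

text \<open>A loop none of whose edges lies in the cube of radius \<open>2 r\<close> around \<open>c\<close> is not linked with negative plaquettes
inside the cube of radius \<open>r\<close>. If the box were smaller than \<open>r\<close>, it would lie within the larger cube, which is impossible for
a nonempty loop; hence there is room for a slab in every direction, and every edge of the loop lies in a slab.\<close>

lemma wilson_loop_unlinked:
  assumes \<gamma>: "mod2_cycle \<gamma>" "\<gamma> \<noteq> {}" "\<gamma> \<subseteq> box_edges N"
    and \<tau>: "\<And>e. \<tau> e \<in> {-1, 1}"
    and c: "c \<in> box N" and r: "r > 0"
    and ex: "\<And>p a k. p \<in> excited N \<tau> \<Longrightarrow> a \<in> \<Union>p \<Longrightarrow> \<bar>a $ k - c $ k\<bar> < r"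
    and far: "\<And>e. e \<in> \<gamma> \<Longrightarrow> \<exists>a\<in>e. \<exists>k. \<bar>a $ k - c $ k\<bar> > 2 * r"
  shows "(\<Prod>e\<in>\<gamma>. \<tau> e) = 1"
proof -
  let ?lo = "- box_corner N" and ?hi = "box_corner N"
  have cN: "- int N \<le> c $ k" "c $ k \<le> int N" for k using c by (auto simp: box_def)
  have "r \<le> int N"
  proof (rule ccontr)
    assume rN: "\<not> r \<le> int N"
    obtain e where e: "e \<in> \<gamma>" using \<gamma>(2) by blast
    then obtain a k where a: "a \<in> e" "\<bar>a $ k - c $ k\<bar> > 2 * r" using far by blast
    have "e \<subseteq> box N" using \<gamma>(3) e by (auto simp: box_edges_def)
    then have "a \<in> box N" using a(1) by blast
    then have "- int N \<le> a $ k" "a $ k \<le> int N" by (auto simp: box_def)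
    with a(2) cN[of k] rN show False by linarith
  qed
  then have room: "c $ k + r \<le> ?hi $ k \<or> ?lo $ k \<le> c $ k - r" for k
    unfolding box_corner_def using cN[of k] by (simp; linarith)
  have "\<exists>g. (\<forall>x. g x \<in> {-1, 1}) \<and> (\<forall>\<alpha> x i. x \<in> outer_slab ?lo ?hi c r \<alpha> \<and>
      x + axis i 1 \<in> outer_slab ?lo ?hi c r \<alpha> \<longrightarrow> \<tau> (edge_at x i) = g x * g (x + axis i 1))"
  proof (rule exact_outside_cube)
    show "3 \<le> CARD(4)" by simp
    show "\<tau> (edge_at x i) \<in> {-1, 1}" for x i by (rule \<tau>)
    show "0 < r" by (rule r)
    show "?lo $ k \<le> ?hi $ k" for k by (simp add: box_corner_def)
    show "c $ k + r \<le> ?hi $ k \<or> ?lo $ k \<le> c $ k - r" for k by (rule room)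
    fix x i j \<alpha>
    assume ij: "i \<noteq> j" and x: "x \<in> outer_slab ?lo ?hi c r \<alpha>"
      and y: "x + axis i 1 + axis j 1 \<in> outer_slab ?lo ?hi c r \<alpha>"
    have xb: "x \<in> box N" "x + axis i 1 + axis j 1 \<in> box N"
      using x y unfolding mem_outer_slab box_eq by auto
    have "\<bar>x $ fst \<alpha> - c $ fst \<alpha>\<bar> \<ge> r" using x unfolding mem_outer_slab by (auto split: if_splits)
    then have "plaq_at x i j \<notin> excited N \<tau>" using ex[of "plaq_at x i j" x "fst \<alpha>"]
      unfolding Union_plaq_at by auto
    moreover have "plaq_sign (excited N \<tau>) x i j = cobound (\<lambda>x i. \<tau> (edge_at x i)) x i j"
      by (rule plaq_sign_excited[OF _ ij xb], rule \<tau>)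
    ultimately show "cobound (\<lambda>x i. \<tau> (edge_at x i)) x i j = 1"
      by (simp add: plaq_sign_def)
  qed
  then obtain g where gg: "(\<forall>x. g x \<in> {-1, 1}) \<and> (\<forall>\<alpha> x i. x \<in> outer_slab ?lo ?hi c r \<alpha> \<and>
      x + axis i 1 \<in> outer_slab ?lo ?hi c r \<alpha> \<longrightarrow> \<tau> (edge_at x i) = g x * g (x + axis i 1))"
    by (rule exE)
  then have g: "\<forall>x. g x \<in> {-1, 1}" by (rule conjunct1)
  have \<tau>g: "\<tau> (edge_at x i) = g x * g (x + axis i 1)"
    if "x \<in> outer_slab ?lo ?hi c r \<alpha>" "x + axis i 1 \<in> outer_slab ?lo ?hi c r \<alpha>" for \<alpha> x i
    using conjunct2[OF gg] that by blast
  have "\<tau> e = (\<Prod>x\<in>e. g x)" if e: "e \<in> \<gamma>" for e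
  proof -
    have "e \<in> edges" using \<gamma>(3) e by (auto simp: box_edges_def)
    then obtain x i where xi: "e = edge_at x i" using edges_iff by blast
    have xb: "x \<in> box N" "x + axis i 1 \<in> box N" using e \<gamma>(3) edge_in_box xi by auto
    obtain a k where a: "a \<in> e" "\<bar>a $ k - c $ k\<bar> > 2 * r" using far[OF e] by blast
    have ax: "\<bar>a $ k - x $ k\<bar> \<le> 1" "\<bar>a $ k - (x + axis i 1) $ k\<bar> \<le> 1"
      using a(1) unfolding xi edge_at_def by auto
    have "\<exists>\<alpha>. x \<in> outer_slab ?lo ?hi c r \<alpha> \<and> x + axis i 1 \<in> outer_slab ?lo ?hi c r \<alpha>"
    proof (cases "a $ k > c $ k")
      case True
      then have "c $ k + r \<le> x $ k" "c $ k + r \<le> (x + axis i 1) $ k" using ax a(2) r by linarith+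
      then show ?thesis using xb unfolding mem_outer_slab box_eq by (intro exI[of _ "(k, True)"]) auto
    next
      case False
      then have "x $ k \<le> c $ k - r" "(x + axis i 1) $ k \<le> c $ k - r" using ax a(2) r by linarith+
      then show ?thesis using xb unfolding mem_outer_slab box_eq by (intro exI[of _ "(k, False)"]) auto
    qed
    then have "\<tau> e = g x * g (x + axis i 1)" using \<tau>g xi by blast
    then show ?thesis by (simp add: xi edge_at_def)
  qed
  then have "(\<Prod>e\<in>\<gamma>. \<tau> e) = (\<Prod>e\<in>\<gamma>. \<Prod>x\<in>e. g x)" by (rule prod.cong[OF refl])
  also have "\<dots> = 1" using \<gamma>(1) g unfolding mod2_cycle_def by blast
  finally show ?thesis .
qed

section \<open>The smallest vortices\<close>

definition closed_everywhere :: "plaquette set \<Rightarrow> bool" where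
  "closed_everywhere V \<longleftrightarrow> (\<forall>x i j k. distinct [i, j, k] \<longrightarrow> cube_prod (plaq_sign V) x i j k = 1)"

lemma neg_sites_plaq_sign:
  "a \<noteq> b \<Longrightarrow> neg_sites (plaq_sign V) a b = {x. plaq_at x a b \<in> V}"
  by (auto simp: neg_sites_def plaq_sign_def)

lemma neg_sites_plaq_sign_sym: "neg_sites (plaq_sign V) a b = neg_sites (plaq_sign V) b a"
  unfolding neg_sites_def using plaq_sign_sym[of V _ a b] by simp

lemma inj_plaq_at: "a \<noteq> b \<Longrightarrow> inj (\<lambda>x. plaq_at x a b)"
  by (rule injI) (simp add: plaq_at_inject)

lemma finite_neg_sites_plaq_sign:
  assumes "finite V" "a \<noteq> b"
  shows "finite (neg_sites (plaq_sign V) a b)"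
  unfolding neg_sites_plaq_sign[OF assms(2)]
  using finite_vimageI[OF assms(1) inj_plaq_at[OF assms(2)]] by (simp add: vimage_def)

text \<open>The negative faces are counted by their six possible orientations.\<close>

lemma sum_orientations_le:
  assumes V: "finite V" and ijkl: "distinct [i, j, k, l]"
  shows "card (neg_sites (plaq_sign V) i j) + card (neg_sites (plaq_sign V) i k)
    + card (neg_sites (plaq_sign V) i l) + card (neg_sites (plaq_sign V) j k)
    + card (neg_sites (plaq_sign V) j l) + card (neg_sites (plaq_sign V) k l) \<le> card V"
proof -
  let ?T = "{(i, j), (i, k), (i, l), (j, k), (j, l), (k, l)}"
  let ?N = "\<lambda>(a, b). neg_sites (plaq_sign V) a b"
  let ?f = "\<lambda>((a, b), x). plaq_at x a b"
  have T: "a \<noteq> b" if "(a, b) \<in> ?T" for a b using that ijkl by auto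
  have T2: "{a, b} \<noteq> {c, d}" if "(a, b) \<in> ?T" "(c, d) \<in> ?T" "(a, b) \<noteq> (c, d)" for a b c d
    using that ijkl by (auto simp: doubleton_eq_iff)
  have "card (Sigma ?T ?N) \<le> card V"
  proof (rule card_inj_on_le[OF _ _ V])
    show "inj_on ?f (Sigma ?T ?N)"
    proof (rule inj_onI)
      fix u w assume u: "u \<in> Sigma ?T ?N" and w: "w \<in> Sigma ?T ?N" and eq: "?f u = ?f w"
      obtain a b x c d y where uw: "u = ((a, b), x)" "w = ((c, d), y)" by (metis surj_pair)
      have ab: "(a, b) \<in> ?T" "(c, d) \<in> ?T" using u w uw by auto
      have "x = y" "{a, b} = {c, d}"
        using eq plaq_at_inject[OF T[OF ab(1)] T[OF ab(2)]] uw by auto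
      then show "u = w" using T2[OF ab] uw by blast
    qed
    show "?f ` Sigma ?T ?N \<subseteq> V"
    proof
      fix p assume "p \<in> ?f ` Sigma ?T ?N"
      then obtain a b x where "(a, b) \<in> ?T" "x \<in> neg_sites (plaq_sign V) a b" "p = plaq_at x a b"
        by (elim imageE SigmaE) auto
      then show "p \<in> V" using neg_sites_plaq_sign[OF T] by auto
    qed
  qed
  moreover have "card (Sigma ?T ?N) = (\<Sum>t\<in>?T. card (?N t))"
  proof (rule card_SigmaI)
    show "\<forall>t\<in>?T. finite (?N t)"
    proof
      fix t assume t: "t \<in> ?T"
      obtain a b where ab: "t = (a, b)" by (cases t)
      have "a \<noteq> b" using t unfolding ab by (rule T)
      then show "finite (?N t)" using finite_neg_sites_plaq_sign[OF V] by (simp add: ab)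
    qed
  qed simp
  moreover have "(\<Sum>t\<in>?T. card (?N t)) = card (neg_sites (plaq_sign V) i j) + card (neg_sites (plaq_sign V) i k)
    + card (neg_sites (plaq_sign V) i l) + card (neg_sites (plaq_sign V) j k)
    + card (neg_sites (plaq_sign V) j l) + card (neg_sites (plaq_sign V) k l)"
    using ijkl by simp
  ultimately show ?thesis by simp
qed

context
  fixes V :: "plaquette set"
  assumes fin: "finite V" and closed: "closed_everywhere V"
begin

private abbreviation (input) N where "N a b \<equiv> neg_sites (plaq_sign V) a b"

lemma cube_closed: "distinct [a, b, c] \<Longrightarrow> cube_prod (plaq_sign V) x a b c = 1"
  using closed unfolding closed_everywhere_def by blast

text \<open>In dimension 4 there is a third direction, so parity applies.\<close>

lemma orientation_at_least_two:
  assumes ab: "a \<noteq> b" and ne: "N a b \<noteq> {}"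
  shows "2 \<le> card (N a b)"
proof -
  obtain x where x: "x \<in> N a b" using ne by blast
  have "\<exists>c. c \<notin> {a, b}" 
  proof (rule ccontr)
    assume "\<not> ?thesis"
    then have "(UNIV :: 4 set) \<subseteq> {a, b}" by auto
    then have "card (UNIV :: 4 set) \<le> card {a, b}" by (intro card_mono) auto
    also have "\<dots> \<le> 2" by (simp add: card_insert_if)
    finally show False by simp
  qed
  then obtain c where c: "c \<notin> {a, b}" by blast
  then have abc: "distinct [a, b, c]" using ab by auto
  have "\<exists>y. y \<in> N a b \<and> y \<noteq> x"
    by (rule neg_sites_not_single[OF plaq_sign_sign cube_closed[OF abc] abc finite_neg_sites_plaq_sign[OF fin] x])
  then obtain y where y: "y \<in> N a b" "y \<noteq> x" by blast
  have "card {x, y} \<le> card (N a b)"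
    by (intro card_mono finite_neg_sites_plaq_sign[OF fin ab]) (use x y in auto)
  then show ?thesis using y by simp
qed

lemma side_orientations:
  assumes abc: "distinct [a, b, c]" and ne: "N a b \<noteq> {}"
  shows "2 \<le> card (N a c) + card (N b c)"
  by (rule two_side_faces[OF plaq_sign_sign cube_closed[OF abc] abc finite_neg_sites_plaq_sign[OF fin] ne])

text \<open>The side faces above and below a face, in the situation that all of them have the orientation \<open>{a, c}\<close>.\<close>

lemma flanking_faces:
  assumes abc: "distinct [a, b, c]" and none: "N b c = {}" and x: "x \<in> N a b"
  shows "\<exists>y\<in>N a c. x $ c \<le> y $ c \<and> y $ b \<in> {x $ b, x $ b + 1} \<and>
      (\<forall>m. m \<noteq> b \<and> m \<noteq> c \<longrightarrow> y $ m = x $ m)"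
    and "\<exists>y\<in>N a c. y $ c < x $ c \<and> y $ b \<in> {x $ b, x $ b + 1} \<and>
      (\<forall>m. m \<noteq> b \<and> m \<noteq> c \<longrightarrow> y $ m = x $ m)"
proof -
  have ab: "a \<noteq> b" "b \<noteq> c" using abc by auto
  have fin_ab: "finite (N a b)" by (rule finite_neg_sites_plaq_sign[OF fin ab(1)])
  have witness: "\<exists>y\<in>N a c. y $ c = s \<and> y $ b \<in> {x $ b, x $ b + 1} \<and> (\<forall>m. m \<noteq> b \<and> m \<noteq> c \<longrightarrow> y $ m = x $ m)"
    if "set_coord x c s \<in> N a c \<or> set_coord x c s + axis b 1 \<in> N a c" for s
    using that
  proof
    assume "set_coord x c s \<in> N a c"
    then show ?thesis using ab by (intro bexI[of _ "set_coord x c s"]) auto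
  next
    assume "set_coord x c s + axis b 1 \<in> N a c"
    then show ?thesis using ab by (intro bexI[of _ "set_coord x c s + axis b 1"]) auto
  qed
  have "\<exists>s z. x $ c \<le> s \<and> z = set_coord x c s \<and>
    (z \<in> N a c \<or> z + axis b 1 \<in> N a c \<or> z \<in> N b c \<or> z + axis a 1 \<in> N b c)"
    by (rule side_face_above[OF plaq_sign_sign cube_closed[OF abc] abc fin_ab x])
  then obtain s where "x $ c \<le> s" "set_coord x c s \<in> N a c \<or> set_coord x c s + axis b 1 \<in> N a c"
    using none by blast
  with witness[of s] show "\<exists>y\<in>N a c. x $ c \<le> y $ c \<and> y $ b \<in> {x $ b, x $ b + 1} \<and>
      (\<forall>m. m \<noteq> b \<and> m \<noteq> c \<longrightarrow> y $ m = x $ m)" by blast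
  have "\<exists>s z. s < x $ c \<and> z = set_coord x c s \<and>
    (z \<in> N a c \<or> z + axis b 1 \<in> N a c \<or> z \<in> N b c \<or> z + axis a 1 \<in> N b c)"
    by (rule side_face_below[OF plaq_sign_sign cube_closed[OF abc] abc fin_ab x])
  then obtain s where "s < x $ c" "set_coord x c s \<in> N a c \<or> set_coord x c s + axis b 1 \<in> N a c"
    using none by blast
  with witness[of s] show "\<exists>y\<in>N a c. y $ c < x $ c \<and> y $ b \<in> {x $ b, x $ b + 1} \<and>
      (\<forall>m. m \<noteq> b \<and> m \<noteq> c \<longrightarrow> y $ m = x $ m)" by blast
qed

lemma two_orientations:
  assumes abc: "distinct [a, b, c]" and none: "N b c = {}"
    and two: "card (N a b) = 2" "card (N a c) = 2"
  shows "\<exists>z. N a b = {z, z - axis b 1} \<and> N a c = {z, z - axis c 1}"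
proof -
  have acb: "distinct [a, c, b]" and bc: "b \<noteq> c" using abc by auto
  have none': "N c b = {}" using none neg_sites_plaq_sign_sym[of V b c] by simp
  show ?thesis
  proof (rule interlocked_pairs[OF bc two])
    fix y assume y: "y \<in> N a c"
    show "\<exists>x\<in>N a b. y $ b \<le> x $ b \<and> x $ c \<in> {y $ c, y $ c + 1} \<and>
        (\<forall>m. m \<noteq> b \<and> m \<noteq> c \<longrightarrow> x $ m = y $ m)"
      using flanking_faces(1)[OF acb none' y] by blast
    show "\<exists>x\<in>N a b. x $ b < y $ b \<and> x $ c \<in> {y $ c, y $ c + 1} \<and>
        (\<forall>m. m \<noteq> b \<and> m \<noteq> c \<longrightarrow> x $ m = y $ m)"
      using flanking_faces(2)[OF acb none' y] by blast
  qed (use flanking_faces[OF abc none] in blast)+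
qed

text \<open>If all faces contain the direction \<open>i\<close> and there are two of each such orientation, the rigidity of pairs attaches
the faces of the three orientations to one common site.\<close>

lemma star_if_two_each:
  assumes ijkl: "distinct [i, j, k, l]" and univ: "UNIV = {i, j, k, l}" and V: "V \<subseteq> plaquettes"
    and two: "card (N i j) = 2" "card (N i k) = 2" "card (N i l) = 2"
    and none: "N j k = {}" "N j l = {}" "N k l = {}"
  shows "\<exists>z. V = star (edge_at z i)"
proof -
  obtain z where z: "N i j = {z, z - axis j 1}" "N i k = {z, z - axis k 1}"
    using two_orientations[of i j k] ijkl none(1) two by auto
  obtain w where w: "N i j = {w, w - axis j 1}" "N i l = {w, w - axis l 1}"
    using two_orientations[of i j l] ijkl none(2) two by auto
  have "w = z"
  proof (rule ccontr)
    assume "w \<noteq> z"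
    then have e: "w = z - axis j 1" "z = w - axis j 1" using z(1) w(1) by (auto simp: doubleton_eq_iff)
    have "w $ j = (z - axis j 1) $ j" by (rule arg_cong[OF e(1)])
    moreover have "z $ j = (w - axis j 1) $ j" by (rule arg_cong[OF e(2)])
    ultimately show False by simp
  qed
  have dir: "N i m = {z, z - axis m 1}" if "m \<noteq> i" for m
    using z w \<open>w = z\<close> that univ by auto
  have nodir: "N a b = {}" if "a \<noteq> i" "b \<noteq> i" "a \<noteq> b" for a b
  proof -
    have "a \<in> {j, k, l}" "b \<in> {j, k, l}" using that univ by auto
    then show ?thesis using none neg_sites_plaq_sign_sym[of V] that(3) by auto
  qed
  have mem: "plaq_at x i m \<in> V \<longleftrightarrow> x = z \<or> x = z - axis m 1" if "m \<noteq> i" for x m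
    using dir[OF that] neg_sites_plaq_sign[of i m V] that by auto
  have "V = star (edge_at z i)"
  proof (intro equalityI subsetI)
    fix p assume p: "p \<in> V"
    then obtain x a b where ab: "a \<noteq> b" "p = plaq_at x a b" using V plaquettes_iff by blast
    then have "x \<in> N a b" using p neg_sites_plaq_sign by auto
    then have "a = i \<or> b = i" using nodir ab(1) by blast
    then obtain m where m: "m \<noteq> i" "p = plaq_at x i m" using ab plaq_at_sym by metis
    then have "x = z \<or> x = z - axis m 1" using mem p by blast
    then show "p \<in> star (edge_at z i)"
    proof
      assume "x = z"
      then show ?thesis unfolding star_edge_at m(2)
        by (intro image_eqI[of _ _ "(m, True)"]) (use m in auto)
    next
      assume "x = z - axis m 1"
      then show ?thesis unfolding star_edge_at m(2)
        by (intro image_eqI[of _ _ "(m, False)"]) (use m in auto)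
    qed
  next
    fix p assume "p \<in> star (edge_at z i)"
    then obtain m s where "m \<noteq> i" "p = plaq_at (if s then z else z - axis m 1) i m"
      unfolding star_edge_at by auto
    then show "p \<in> V" using mem by (cases s) auto
  qed
  then show ?thesis by blast
qed

text \<open>Let \<open>n a b\<close> be the number of faces with orientation \<open>{a, b}\<close>. Each \<open>n a b\<close> is 0 or at least 2; and if it is not 0, then
\<open>n a c + n b c \<ge> 2\<close> for every third direction \<open>c\<close>. With at most six faces this forces exactly three orientations with two faces each,
and the three orientations have a direction in common.\<close>

lemma small_closed_is_star:
  assumes ne: "V \<noteq> {}" and V: "V \<subseteq> plaquettes" and card: "card V \<le> 6"
  shows "\<exists>e\<in>edges. V = star e"
proof -
  let ?n = "\<lambda>a b. card (N a b)"
  have sym: "N a b = N b a" for a b by (rule neg_sites_plaq_sign_sym)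
  have none_iff: "N a b = {} \<longleftrightarrow> ?n a b = 0" if "a \<noteq> b" for a b
    using finite_neg_sites_plaq_sign[OF fin that] by simp
  have two: "?n a b = 0 \<or> 2 \<le> ?n a b" if "a \<noteq> b" for a b
    using orientation_at_least_two[OF that] by force
  have side: "2 \<le> ?n a c + ?n b c" if "distinct [a, b, c]" "?n a b \<noteq> 0" for a b c
    by (rule side_orientations[OF that(1)]) (use that(2) in force)
  obtain p where p: "p \<in> V" "p \<in> plaquettes" using ne V by blast
  then obtain x i j where ij: "i \<noteq> j" "p = plaq_at x i j" using plaquettes_iff by blast
  then have "x \<in> N i j" using p(1) by (simp add: neg_sites_plaq_sign)
  then have nij: "?n i j \<noteq> 0" using none_iff[OF ij(1)] by blast
  have "card (UNIV - {i, j} :: 4 set) = 2" using ij(1) by (simp add: card_Diff_subset)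
  then obtain k l where kl: "UNIV - {i, j} = {k, l}" "k \<noteq> l" by (meson card_2_iff)
  have univ: "UNIV = {i, j, k, l}" using kl(1) by blast
  have ijkl: "distinct [i, j, k, l]" using ij kl by auto
  note le = sum_orientations_le[OF fin ijkl]
  have s1: "2 \<le> ?n i l + ?n j l" and s2: "2 \<le> ?n i k + ?n j k"
    using side[of i j l] side[of i j k] nij ijkl by auto
  have t: "?n i j = 0 \<or> 2 \<le> ?n i j" "?n i k = 0 \<or> 2 \<le> ?n i k" "?n i l = 0 \<or> 2 \<le> ?n i l"
    "?n j k = 0 \<or> 2 \<le> ?n j k" "?n j l = 0 \<or> 2 \<le> ?n j l"
    using two ijkl by auto
  have nkl: "?n k l = 0" "?n i j = 2" using le card nij s1 s2 t(1) by linarith+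
  have x1: "2 \<le> ?n i k + ?n l k" if "?n i l \<noteq> 0" using side[of i l k] that ijkl by auto
  have x2: "2 \<le> ?n j k + ?n l k" if "?n j l \<noteq> 0" using side[of j l k] that ijkl by auto
  have lk: "?n l k = 0" using nkl sym[of l k] by simp
  consider "?n i k = 2" "?n i l = 2" "?n j k = 0" "?n j l = 0"
    | "?n j k = 2" "?n j l = 2" "?n i k = 0" "?n i l = 0"
    using le card nij s1 s2 t nkl x1 x2 lk by linarith
  then show ?thesis
  proof cases
    case 1
    have "\<exists>z. V = star (edge_at z i)"
      by (rule star_if_two_each[OF ijkl univ V nkl(2) 1(1,2)]) (use 1 nkl none_iff ijkl in auto)
    then show ?thesis using edges_iff by blast
  next
    case 2
    have "\<exists>z. V = star (edge_at z j)"
    proof (rule star_if_two_each[of j i k l])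
      show "distinct [j, i, k, l]" "UNIV = {j, i, k, l}" using ijkl univ by auto
      show "V \<subseteq> plaquettes" by (rule V)
      show "?n j i = 2" "?n j k = 2" "?n j l = 2" using nkl 2 sym[of j i] by auto
      show "N i k = {}" "N i l = {}" "N k l = {}" using 2 nkl none_iff ijkl by auto
    qed
    then show ?thesis using edges_iff by blast
  qed
qed

end

section \<open>Decomposition of a configuration into vortices\<close>

lemma plaq_at_near_base: "b \<in> \<Union>(plaq_at x i j) \<Longrightarrow> x $ k \<le> b $ k \<and> b $ k \<le> x $ k + (if i = j then 2 else 1)"
  unfolding Union_plaq_at by auto

text \<open>A covering walk has at most \<open>2 |V| - 2\<close> steps, each of which moves by at most 2 in every coordinate.\<close>

lemma connected_from_spread:
  assumes conn: "connected_from near p V" and p: "i \<noteq> j" "p = plaq_at x i j"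
    and q: "q \<in> V" "b \<in> \<Union>q"
  shows "\<bar>b $ k - x $ k\<bar> < 4 * int (card V)"
proof -
  obtain xs where xs: "length xs = 2 * card V - 1" "hd xs = p" "successively near xs" "set xs = V"
    using connected_from_walk[of near p V, OF near_sym conn] by blast
  have "V \<noteq> {}" "finite V" using conn by (auto simp: connected_from_def)
  then have cV: "card V \<ge> 1" by (simp add: Suc_leI card_gt_0_iff)
  have step: "\<forall>b\<in>\<Union>(xs ! t). \<bar>b $ k - x $ k\<bar> \<le> 2 * int t + 1" if "t < length xs" for t
    using that
  proof (induction t)
    case 0
    then have "xs ! 0 = p" using xs(2) by (simp add: hd_conv_nth)
    then show ?case using plaq_at_near_base[of _ x i j k] p by fastforce
  next
    case (Suc t)
    have nr: "near (xs ! t) (xs ! Suc t)" using xs(3) Suc.prems by (simp add: successively_conv_nth)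
    then obtain y m n where "xs ! t = plaq_at y m n" unfolding near_def plaquettes_iff by blast
    then have y: "y \<in> \<Union>(xs ! t)" by (simp add: Union_plaq_at)
    have "t < length xs" using Suc.prems by simp
    then have yx: "\<bar>y $ k - x $ k\<bar> \<le> 2 * int t + 1" using Suc.IH y by blast
    show ?case
    proof
      fix b assume "b \<in> \<Union>(xs ! Suc t)"
      then have "\<bar>y $ k - b $ k\<bar> \<le> 2" using nr y unfolding near_def by blast
      then show "\<bar>b $ k - x $ k\<bar> \<le> 2 * int (Suc t) + 1"
        using yx by (simp add: abs_le_iff)
    qed
  qed
  obtain t where t: "t < length xs" "xs ! t = q" using q(1) xs(4) by (metis in_set_conv_nth)
  then have "\<bar>b $ k - x $ k\<bar> \<le> 2 * int t + 1" using step q(2) by blast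
  moreover have "int t \<le> 2 * int (card V) - 2" using t(1) xs(1) cV by linarith
  ultimately show ?thesis by linarith
qed

definition flip :: "edge \<Rightarrow> spin_config" where
  "flip e = (\<lambda>e'. if e' = e then -1 else 1)"

lemma flip_sign: "flip e e' \<in> {-1, 1}"
  by (simp add: flip_def)

lemma excited_flip: "excited N (flip e) = star e \<inter> box_plaquettes N"
proof -
  have "(\<Prod>e'\<in>p. flip e e') = (if e \<in> p then -1 else 1)" if "p \<in> box_plaquettes N" for p
    using that finite_plaquette[of p] by (simp add: flip_def box_plaquettes_def prod.delta)
  then show ?thesis by (auto simp: excited_def star_def box_plaquettes_def split: if_splits)
qed

lemma prod_flip: "finite \<gamma> \<Longrightarrow> (\<Prod>e'\<in>\<gamma>. flip e e') = (if e \<in> \<gamma> then -1 else 1)"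
  by (simp add: flip_def)

text \<open>Two different edges have at most one plaquette in common, but every edge lies in six.\<close>

lemma star_inject:
  assumes "e \<in> edges" "e' \<in> edges" "star e = star e'"
  shows "e = e'"
proof (rule ccontr)
  assume "e \<noteq> e'"
  then show False using card_star_Int_le[OF assms(1,2)] card_star(2)[OF assms(1)] assms(3) by simp
qed

lemma excited_mult:
  assumes \<tau>: "\<And>e. \<tau> e \<in> {-1, 1}" and \<tau>': "\<And>e. \<tau>' e \<in> {-1, 1}"
    and sub: "excited N \<tau>' \<subseteq> excited N \<tau>"
  shows "excited N (\<lambda>e. \<tau> e * \<tau>' e) = excited N \<tau> - excited N \<tau>'"
proof -
  have "(\<Prod>e\<in>p. \<tau> e) \<in> {-1, 1}" "(\<Prod>e\<in>p. \<tau>' e) \<in> {-1, 1}" for p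
    by (rule prod_sign, rule \<tau>) (rule prod_sign, rule \<tau>')
  then have *: "(\<Prod>e\<in>p. \<tau> e) = 1 \<or> (\<Prod>e\<in>p. \<tau> e) = -1" "(\<Prod>e\<in>p. \<tau>' e) = 1 \<or> (\<Prod>e\<in>p. \<tau>' e) = -1" for p
    by auto
  show ?thesis
  proof (intro equalityI subsetI)
    fix p assume "p \<in> excited N (\<lambda>e. \<tau> e * \<tau>' e)"
    then have "p \<in> box_plaquettes N" "(\<Prod>e\<in>p. \<tau> e) * (\<Prod>e\<in>p. \<tau>' e) = -1"
      by (auto simp: excited_def prod.distrib)
    then show "p \<in> excited N \<tau> - excited N \<tau>'"
      using *(1)[of p] *(2)[of p] sub by (auto simp: excited_def)
  next
    fix p assume "p \<in> excited N \<tau> - excited N \<tau>'"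
    then show "p \<in> excited N (\<lambda>e. \<tau> e * \<tau>' e)"
      using *(2)[of p] by (auto simp: excited_def prod.distrib)
  qed
qed

lemma wilson_loop_flat:
  assumes \<gamma>: "mod2_cycle \<gamma>" "\<gamma> \<subseteq> box_edges N"
    and \<tau>: "\<And>e. \<tau> e \<in> {-1, 1}" and flat: "excited N \<tau> = {}"
  shows "(\<Prod>e\<in>\<gamma>. \<tau> e) = 1"
proof -
  have "\<exists>g. (\<forall>x. g x \<in> {-1, 1}) \<and> (\<forall>x i. x \<in> box N \<and> x + axis i 1 \<in> box N \<longrightarrow>
      \<tau> (edge_at x i) = g x * g (x + axis i 1))"
    unfolding box_eq
  proof (rule closed_1cochain_exact_on_box)
    show "\<tau> (edge_at x i) \<in> {-1, 1}" for x i by (rule \<tau>)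
    fix x i j assume ij: "i \<noteq> j" and "x \<in> lattice_box (- box_corner N) (box_corner N)"
      "x + axis i 1 + axis j 1 \<in> lattice_box (- box_corner N) (box_corner N)"
    then have xb: "x \<in> box N" "x + axis i 1 + axis j 1 \<in> box N" unfolding box_eq by auto
    have "plaq_sign (excited N \<tau>) x i j = cobound (\<lambda>x i. \<tau> (edge_at x i)) x i j"
      by (rule plaq_sign_excited[OF _ ij xb], rule \<tau>)
    then show "cobound (\<lambda>x i. \<tau> (edge_at x i)) x i j = 1" by (simp add: plaq_sign_def flat)
  qed
  then obtain g where gg: "(\<forall>x. g x \<in> {-1, 1}) \<and> (\<forall>x i. x \<in> box N \<and> x + axis i 1 \<in> box N \<longrightarrow>
      \<tau> (edge_at x i) = g x * g (x + axis i 1))" by (rule exE)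
  have "\<tau> e = (\<Prod>x\<in>e. g x)" if e: "e \<in> \<gamma>" for e
  proof -
    have "e \<in> edges" using \<gamma>(2) e by (auto simp: box_edges_def)
    then obtain x i where xi: "e = edge_at x i" using edges_iff by blast
    have xb: "x \<in> box N" "x + axis i 1 \<in> box N" using e \<gamma>(2) edge_in_box xi by auto
    have "\<tau> e = g x * g (x + axis i 1)" using conjunct2[OF gg] xb xi by blast
    then show ?thesis by (simp add: xi edge_at_def)
  qed
  then have "(\<Prod>e\<in>\<gamma>. \<tau> e) = (\<Prod>e\<in>\<gamma>. \<Prod>x\<in>e. g x)" by (rule prod.cong[OF refl])
  also have "\<dots> = 1" using \<gamma>(1) conjunct1[OF gg] unfolding mod2_cycle_def by blast
  finally show ?thesis .
qed

text \<open>Induction over the number of negative plaquettes: multiply by a configuration whose set of negative plaquettes is one component. The loop variable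
changes by the sign that is attributed to this component, and the other components remain as they are.\<close>

lemma wilson_loop_components:
  assumes \<gamma>: "mod2_cycle \<gamma>" "\<gamma> \<subseteq> box_edges N"
    and \<tau>: "\<And>e. \<tau> e \<in> {-1, 1}"
    and comp: "\<And>p. p \<in> excited N \<tau> \<Longrightarrow>
      (\<exists>e\<in>\<gamma>. component near (excited N \<tau>) p = star e) \<or>
      (\<forall>e\<in>\<gamma>. component near (excited N \<tau>) p \<noteq> star e) \<and>
      (\<exists>\<tau>'. (\<forall>e. \<tau>' e \<in> {-1, 1}) \<and> excited N \<tau>' = component near (excited N \<tau>) p \<and>
        (\<Prod>e\<in>\<gamma>. \<tau>' e) = 1)"
  shows "(\<Prod>e\<in>\<gamma>. \<tau> e) = (\<Prod>e\<in>\<gamma>. if star e \<in> component near (excited N \<tau>) ` excited N \<tau> then -1 else 1)"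
  using \<tau> comp
proof (induction "card (excited N \<tau>)" arbitrary: \<tau> rule: less_induct)
  case less
  let ?A = "excited N \<tau>"
  let ?C = "component near ?A"
  have fin\<gamma>: "finite \<gamma>" and \<gamma>E: "\<gamma> \<subseteq> edges" using \<gamma>(1) by (auto simp: mod2_cycle_def)
  have finA: "finite ?A" using excited_subset finite_box_plaquettes finite_subset by blast
  show ?case
  proof (cases "?A = {}")
    case True
    then show ?thesis using wilson_loop_flat[OF \<gamma> less.prems(1)] by simp
  next
    case False
    then obtain p where p: "p \<in> ?A" by blast
    define V where "V = ?C p"
    have VA: "V \<subseteq> ?A" unfolding V_def by (rule component_subset[OF p])
    have pV: "p \<in> V" unfolding V_def by (rule component_self)
    have "\<exists>\<tau>'. (\<forall>e. \<tau>' e \<in> {-1, 1}) \<and> excited N \<tau>' = V \<and>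
        (\<Prod>e\<in>\<gamma>. \<tau>' e) = (\<Prod>e\<in>\<gamma>. if star e = V then -1 else 1)"
    proof (cases "\<exists>e\<in>\<gamma>. V = star e")
      case True
      then obtain e where e: "e \<in> \<gamma>" "V = star e" by blast
      have "excited N (flip e) = V" using excited_flip VA excited_subset e(2) by blast
      moreover have "(star e' = V) = (e' = e)" if "e' \<in> \<gamma>" for e'
        using e that star_inject \<gamma>E by blast
      then have "(\<Prod>e'\<in>\<gamma>. if star e' = V then -1 else 1) = (\<Prod>e'\<in>\<gamma>. flip e e')"
        by (intro prod.cong refl) (simp add: flip_def)
      ultimately show ?thesis using flip_sign by (intro exI[of _ "flip e"]) simp
    next
      case False
      then obtain \<tau>' where "(\<forall>e. \<tau>' e \<in> {-1, 1}) \<and> excited N \<tau>' = V \<and> (\<Prod>e\<in>\<gamma>. \<tau>' e) = 1"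
        using less.prems(2)[OF p] unfolding V_def by blast
      moreover have "(\<Prod>e\<in>\<gamma>. if star e = V then -1 else 1) = (1::real)"
        using False by (intro prod.neutral) auto
      ultimately show ?thesis by metis
    qed
    then obtain \<tau>' where t': "(\<forall>e. \<tau>' e \<in> {-1, 1}) \<and> excited N \<tau>' = V \<and>
        (\<Prod>e\<in>\<gamma>. \<tau>' e) = (\<Prod>e\<in>\<gamma>. if star e = V then -1 else 1)" by (rule exE)
    have \<tau>': "\<tau>' e \<in> {-1, 1}" for e using t' by (rule conjunct1[THEN spec])
    define \<tau>'' where "\<tau>'' e = \<tau> e * \<tau>' e" for e
    have s'': "\<tau>'' e \<in> {-1, 1}" for e unfolding \<tau>''_def by (intro sign_mult less.prems(1) \<tau>')
    have A'': "excited N \<tau>'' = ?A - V"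
      unfolding \<tau>''_def using excited_mult[of \<tau> \<tau>' N, OF less.prems(1) \<tau>'] t' VA by metis
    have comp_eq: "component near (?A - V) q = ?C q" if "q \<in> ?A - V" for q
      unfolding V_def using that component_Diff[of near p ?A q, OF near_sym p] unfolding V_def by blast
    have IH: "(\<Prod>e\<in>\<gamma>. \<tau>'' e) = (\<Prod>e\<in>\<gamma>. if star e \<in> component near (?A - V) ` (?A - V) then -1 else 1)"
      unfolding A''[symmetric]
    proof (rule less.hyps)
      show "card (excited N \<tau>'') < card ?A" unfolding A''
        by (rule psubset_card_mono[OF finA]) (use pV p in blast)
      show "\<tau>'' e \<in> {-1, 1}" for e by (rule s'')
      fix q assume "q \<in> excited N \<tau>''"
      then have q: "q \<in> ?A - V" unfolding A'' .
      then show "(\<exists>e\<in>\<gamma>. component near (excited N \<tau>'') q = star e) \<or>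
        (\<forall>e\<in>\<gamma>. component near (excited N \<tau>'') q \<noteq> star e) \<and>
        (\<exists>\<tau>'. (\<forall>e. \<tau>' e \<in> {-1, 1}) \<and> excited N \<tau>' = component near (excited N \<tau>'') q \<and>
        (\<Prod>e\<in>\<gamma>. \<tau>' e) = 1)"
        unfolding A'' comp_eq[OF q] using less.prems(2)[of q] by blast
    qed
    have img: "component near (?A - V) ` (?A - V) = ?C ` ?A - {V}"
    proof -
      have 1: "component near (?A - V) ` (?A - V) = ?C ` (?A - V)" using comp_eq by (intro image_cong) auto
      have 2: "?C q \<noteq> V" if "q \<in> ?A - V" for q using that component_self[of q near ?A] by auto
      have 3: "?C q = V" if "q \<in> V" for q
        unfolding V_def by (rule component_eq[OF near_sym that[unfolded V_def]])
      show ?thesis unfolding 1 using 2 3 by blast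
    qed
    have VC: "V \<in> ?C ` ?A" using p V_def by blast
    have "(\<Prod>e\<in>\<gamma>. \<tau> e) = (\<Prod>e\<in>\<gamma>. \<tau>'' e) * (\<Prod>e\<in>\<gamma>. \<tau>' e)"
      unfolding \<tau>''_def prod.distrib[symmetric]
      by (intro prod.cong refl) (simp only: mult.assoc sign_square[OF \<tau>'] mult_1_right)
    also have "\<dots> = (\<Prod>e\<in>\<gamma>. (if star e \<in> ?C ` ?A - {V} then -1 else 1) * (if star e = V then -1 else 1))"
      using t' unfolding IH img prod.distrib by simp
    also have "\<dots> = (\<Prod>e\<in>\<gamma>. if star e \<in> ?C ` ?A then -1 else 1)"
      using VC by (intro prod.cong refl) auto
    finally show ?thesis .
  qed
qed

section \<open>Typical configurations\<close>

lemma box_mono: "M \<le> N \<Longrightarrow> box M \<subseteq> box N"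
proof
  fix x assume MN: "M \<le> N" and x: "x \<in> box M"
  have "- int N \<le> x $ k \<and> x $ k \<le> int N" for k
  proof -
    have "- int M \<le> x $ k" "x $ k \<le> int M" using x by (auto simp: box_def)
    then show ?thesis using MN by linarith
  qed
  then show "x \<in> box N" by (simp add: box_def)
qed

lemma box_edges_mono: "M \<le> N \<Longrightarrow> box_edges M \<subseteq> box_edges N"
  using box_mono unfolding box_edges_def by blast

lemma box_plaquettes_mono: "M \<le> N \<Longrightarrow> box_plaquettes M \<subseteq> box_plaquettes N"
  using box_edges_mono unfolding box_plaquettes_def by blast

lemma star_in_box:
  assumes "e \<in> box_edges K"
  shows "star e \<subseteq> box_plaquettes (Suc K)"
proof
  fix p assume p: "p \<in> star e"
  have "e \<in> edges" using assms by (simp add: box_edges_def)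
  then obtain x i where e: "e = edge_at x i" using edges_iff by blast
  have xb: "x \<in> box K" "x + axis i 1 \<in> box K" using assms edge_in_box e by auto
  have xk: "- int K \<le> x $ k" "x $ k + (if k = i then 1 else 0) \<le> int K" for k
    using xb(1) xb(2)[unfolded box_def] by (auto simp: box_def dest: spec[of _ k])
  obtain j s where j: "j \<noteq> i" "p = plaq_at (if s then x else x - axis j 1) i j"
    using p unfolding e star_edge_at by auto
  let ?z = "if s then x else x - axis j 1"
  have "- int (Suc K) \<le> ?z $ k \<and> ?z $ k \<le> int (Suc K) \<and>
      - int (Suc K) \<le> (?z + axis i 1 + axis j 1) $ k \<and> (?z + axis i 1 + axis j 1) $ k \<le> int (Suc K)" for k
    using xk[of k] by (auto split: if_splits)
  then have "?z \<in> box (Suc K)" "?z + axis i 1 + axis j 1 \<in> box (Suc K)" by (auto simp: box_def)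
  then show "p \<in> box_plaquettes (Suc K)" using j plaq_in_box[of i j ?z "Suc K"] by auto
qed

text \<open>Faces near a cube that is not contained in the box do not belong to \<open>V\<close>.\<close>

lemma closed_everywhere_if_interior:
  assumes closed: "closed_on_box N V" and int: "\<And>p b k. p \<in> V \<Longrightarrow> b \<in> \<Union>p \<Longrightarrow> \<bar>b $ k\<bar> \<le> int N - 2"
  shows "closed_everywhere V"
  unfolding closed_everywhere_def
proof (intro allI impI)
  fix x i j k assume ijk: "distinct [i, j, k :: 4]"
  show "cube_prod (plaq_sign V) x i j k = 1"
  proof (cases "x \<in> box N \<and> x + axis i 1 + axis j 1 + axis k 1 \<in> box N")
    case True
    then show ?thesis using closed ijk unfolding closed_on_box_def by blast
  next
    case False
    have none: "plaq_at y m n \<notin> V" if "\<And>l. x $ l \<le> y $ l \<and> y $ l \<le> x $ l + 1" for y m n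
    proof
      assume "plaq_at y m n \<in> V"
      then have y: "\<bar>y $ l\<bar> \<le> int N - 2" for l
        by (rule int) (simp add: Union_plaq_at)
      have "- int N \<le> x $ l \<and> x $ l \<le> int N \<and> - int N \<le> (x + axis i 1 + axis j 1 + axis k 1) $ l \<and>
          (x + axis i 1 + axis j 1 + axis k 1) $ l \<le> int N" for l
        using y[of l] that[of l] ijk by (auto simp: abs_le_iff)
      then have "x \<in> box N \<and> x + axis i 1 + axis j 1 + axis k 1 \<in> box N" by (simp add: box_def)
      then show False using False by blast
    qed
    have "plaq_sign V y m n = 1" if "y \<in> {x, x + axis i 1, x + axis j 1, x + axis k 1}" for y m n
    proof -
      have "plaq_at y m n \<notin> V" by (rule none) (use that in auto)
      then show ?thesis by (simp add: plaq_sign_def)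
    qed
    then show ?thesis unfolding cube_prod_def by simp
  qed
qed

definition close_to :: "edge set \<Rightarrow> site \<Rightarrow> nat \<Rightarrow> bool" where
  "close_to \<gamma> x d \<longleftrightarrow> (\<exists>e\<in>\<gamma>. \<forall>a\<in>e. \<forall>k. \<bar>a $ k - x $ k\<bar> \<le> int d)"

text \<open>The vortices that are too large to be minimal and are not excluded from being linked with \<open>\<gamma>\<close>. A connected set with base site \<open>x\<close>
lies in the cube of radius \<open>4 |V|\<close> around \<open>x\<close>, and twice this radius is what linking needs.\<close>

definition large_vortices :: "nat \<Rightarrow> edge set \<Rightarrow> plaquette set set" where
  "large_vortices N \<gamma> = {V. V \<subseteq> box_plaquettes N \<and> closed_on_box N V \<and> 7 \<le> card V \<and>
     (\<exists>x i j. i \<noteq> j \<and> connected_from near (plaq_at x i j) V \<and> close_to \<gamma> x (8 * card V))}"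

text \<open>Configurations without the two kinds of vortices that make the argument fail.\<close>

definition typical :: "nat \<Rightarrow> edge set \<Rightarrow> spin_config \<Rightarrow> bool" where
  "typical N \<gamma> \<tau> \<longleftrightarrow> (\<forall>V\<in>large_vortices N \<gamma>. \<not> V \<subseteq> excited N \<tau>) \<and>
     (\<forall>e\<in>corner_edges \<gamma>. \<not> star e \<subseteq> excited N \<tau>)"

definition adjacent_edges :: "edge \<Rightarrow> edge set" where
  "adjacent_edges e = \<Union>(star e) - {e}"

lemma adjacent_edges:
  assumes "e \<in> edges"
  shows "finite (adjacent_edges e)" "card (adjacent_edges e) \<le> 24"
proof -
  note S = card_star[OF assms]
  have p4: "finite p \<and> card p \<le> 4" if "p \<in> star e" for p
  proof -
    obtain x i j where "p = plaq_at x i j" using \<open>p \<in> star e\<close> by (auto simp: star_def plaquettes_iff)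
    then show ?thesis by (auto simp: plaq_at_def card_insert_if)
  qed
  then have fin: "finite (\<Union>(star e))" using S by blast
  then show "finite (adjacent_edges e)" by (simp add: adjacent_edges_def)
  have "card (adjacent_edges e) \<le> card (\<Union>(star e))"
    unfolding adjacent_edges_def by (intro card_mono fin) auto
  also have "\<dots> \<le> (\<Sum>p\<in>star e. card p)" using card_UN_le[OF S(1), of "\<lambda>p. p"] by simp
  also have "\<dots> \<le> (\<Sum>p\<in>star e. 4)" by (rule sum_mono) (use p4 in blast)
  also have "\<dots> = 24" using S by simp
  finally show "card (adjacent_edges e) \<le> 24" .
qed

lemma adjacent_edges_in_box:
  assumes "e \<in> box_edges M"
  shows "adjacent_edges e \<subseteq> box_edges (Suc M)"
proof
  fix e' assume "e' \<in> adjacent_edges e"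
  then obtain p where p: "p \<in> star e" "e' \<in> p" by (auto simp: adjacent_edges_def)
  have "p \<in> box_plaquettes (Suc M)" using star_in_box[OF assms] p(1) by blast
  then show "e' \<in> box_edges (Suc M)" using p(2) by (auto simp: box_plaquettes_def)
qed

lemma star_near:
  assumes e: "e \<in> edges" and p: "p \<in> star e" and q: "q \<in> star e"
  shows "near p q"
  unfolding near_def
proof (intro conjI ballI allI)
  obtain x i where xi: "e = edge_at x i" using e edges_iff by blast
  show "p \<in> plaquettes" "q \<in> plaquettes" using p q by (auto simp: star_def)
  have *: "\<bar>a $ k - x $ k\<bar> \<le> 1" if pa: "p \<in> star e" "a \<in> \<Union>p" for p a k
  proof -
    obtain j s where j: "j \<noteq> i" "p = plaq_at (if s then x else x - axis j 1) i j"
      using pa(1) unfolding xi star_edge_at by auto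
    show ?thesis using pa(2) j(1) unfolding j(2) Union_plaq_at by (cases s) auto
  qed
  fix a b k assume "a \<in> \<Union>p" "b \<in> \<Union>q"
  then have "\<bar>a $ k - x $ k\<bar> \<le> 1" "\<bar>b $ k - x $ k\<bar> \<le> 1" using * p q by blast+
  then show "\<bar>a $ k - b $ k\<bar> \<le> 2" by linarith
qed

lemma star_close_to:
  assumes e: "e \<in> \<gamma>" "e \<in> edges" and p: "plaq_at x m n \<in> star e" and d: "d \<ge> 2"
  shows "close_to \<gamma> x d"
  unfolding close_to_def
proof (intro bexI[OF _ e(1)] ballI allI)
  fix a k assume a: "a \<in> e"
  have "near (plaq_at x m n) (plaq_at x m n)" by (rule star_near[OF e(2) p p])
  moreover have "a \<in> \<Union>(plaq_at x m n)" "x \<in> \<Union>(plaq_at x m n)"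
    using a p by (auto simp: star_def Union_plaq_at) (auto simp: plaq_at_def edge_at_def)
  ultimately have "\<bar>a $ k - x $ k\<bar> \<le> 2" unfolding near_def by blast
  then show "\<bar>a $ k - x $ k\<bar> \<le> int d" using d by linarith
qed

context
  fixes \<gamma> :: "edge set" and M N :: nat and \<tau> :: spin_config
  assumes cyc: "mod2_cycle \<gamma>" and ne: "\<gamma> \<noteq> {}" and inM: "\<gamma> \<subseteq> box_edges M" and MN: "M + 100 \<le> N"
    and \<tau>: "\<And>e. \<tau> e \<in> {-1, 1}" and reg: "typical N \<gamma> \<tau>"
begin

lemma component_is_vortex:
  assumes "p \<in> excited N \<tau>"
  shows "component near (excited N \<tau>) p \<subseteq> excited N \<tau>"
    "component near (excited N \<tau>) p \<subseteq> box_plaquettes N"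
    "closed_on_box N (component near (excited N \<tau>) p)"
    "connected_from near p (component near (excited N \<tau>) p)"
proof -
  have fin: "finite (excited N \<tau>)"
    using excited_subset finite_box_plaquettes finite_subset by blast
  show sub: "component near (excited N \<tau>) p \<subseteq> excited N \<tau>" by (rule component_subset[OF assms])
  then show "component near (excited N \<tau>) p \<subseteq> box_plaquettes N" using excited_subset by blast
  show "closed_on_box N (component near (excited N \<tau>) p)"
    by (rule closed_component[OF closed_excited assms], rule \<tau>)
  show "connected_from near p (component near (excited N \<tau>) p)"
    by (rule connected_from_component[OF fin assms])
qed

text \<open>In a typical configuration a component close to the loop has at most six plaquettes. Being small and close to the loop, it is
far from the boundary of the box, so it is closed in the whole lattice and the classification applies.\<close>

lemma close_component_is_star:
  assumes p: "p \<in> excited N \<tau>" "p = plaq_at x i j" "i \<noteq> j"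
    and close: "close_to \<gamma> x (8 * card (component near (excited N \<tau>) p))"
  shows "\<exists>e\<in>edges. component near (excited N \<tau>) p = star e"
proof -
  define V where "V = component near (excited N \<tau>) p"
  note V = component_is_vortex[OF p(1), folded V_def]
  have finV: "finite V" and pV: "p \<in> V" using V(4) by (auto simp: connected_from_def)
  have small: "card V \<le> 6"
  proof (rule ccontr)
    assume "\<not> card V \<le> 6"
    then have "V \<in> large_vortices N \<gamma>"
      unfolding large_vortices_def using V close p(2,3) unfolding V_def by auto
    then show False using reg V(1) unfolding typical_def by blast
  qed
  obtain e where e: "e \<in> \<gamma>" "\<forall>a\<in>e. \<forall>k. \<bar>a $ k - x $ k\<bar> \<le> int (8 * card V)"
    using close unfolding close_to_def V_def by blast
  have "e \<in> edges" "e \<subseteq> box M" using inM e(1) by (auto simp: box_edges_def)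
  then obtain a where a: "a \<in> e" "a \<in> box M" unfolding edges_def by blast
  \<comment> \<open>At most six plaquettes, hence distance at most 48 from the loop; the vortex itself extends over less than 24 further units.\<close>
  have xk: "\<bar>x $ k\<bar> \<le> int M + 48" for k
  proof -
    have "\<bar>a $ k - x $ k\<bar> \<le> int (8 * card V)" using e(2) a(1) by blast
    also have "\<dots> \<le> 48" using small by simp
    finally have "\<bar>a $ k - x $ k\<bar> \<le> 48" .
    moreover have "- int M \<le> a $ k" "a $ k \<le> int M" using a(2) by (auto simp: box_def)
    ultimately show ?thesis by (simp add: abs_le_iff)
  qed
  have "closed_everywhere V"
  proof (rule closed_everywhere_if_interior[OF V(3)])
    fix q b k assume "q \<in> V" "b \<in> \<Union>q"
    then have "\<bar>b $ k - x $ k\<bar> < 4 * int (card V)"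
      by (rule connected_from_spread[OF V(4) p(3,2)])
    then have "\<bar>b $ k - x $ k\<bar> < 24" using small by linarith
    then show "\<bar>b $ k\<bar> \<le> int N - 2" using xk[of k] MN by linarith
  qed
  moreover have "V \<subseteq> plaquettes" using V(2) by (auto simp: box_plaquettes_def)
  ultimately show ?thesis
    using small_closed_is_star[OF finV _ _ _ small] pV unfolding V_def by blast
qed

lemma component_cases:
  assumes p: "p \<in> excited N \<tau>"
  shows "(\<exists>e\<in>\<gamma>. component near (excited N \<tau>) p = star e) \<or>
      (\<forall>e\<in>\<gamma>. component near (excited N \<tau>) p \<noteq> star e) \<and>
      (\<exists>\<tau>'. (\<forall>e. \<tau>' e \<in> {-1, 1}) \<and> excited N \<tau>' = component near (excited N \<tau>) p \<and>
        (\<Prod>e\<in>\<gamma>. \<tau>' e) = 1)"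
proof (cases "\<exists>e\<in>\<gamma>. component near (excited N \<tau>) p = star e")
  case False
  define V where "V = component near (excited N \<tau>) p"
  note V = component_is_vortex[OF p, folded V_def]
  have pV: "p \<in> V" "finite V" using V(4) by (auto simp: connected_from_def)
  have pb: "p \<in> box_plaquettes N" using p excited_subset by blast
  obtain x i j where x: "i \<noteq> j" "p = plaq_at x i j" "x \<in> box N" by (rule box_plaquettesE[OF pb])
  have "\<exists>\<tau>'. (\<forall>e. \<tau>' e \<in> {-1, 1}) \<and> excited N \<tau>' = V \<and> (\<Prod>e\<in>\<gamma>. \<tau>' e) = 1"
  proof (cases "close_to \<gamma> x (8 * card V)")
    case True
    then obtain e where e: "e \<in> edges" "V = star e"
      using close_component_is_star[OF p x(2,1)] unfolding V_def by blast
    have "e \<notin> \<gamma>" using False e(2) unfolding V_def by blast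
    then have "(\<Prod>e'\<in>\<gamma>. flip e e') = 1" using prod_flip cyc by (simp add: mod2_cycle_def)
    moreover have "excited N (flip e) = V" using excited_flip e(2) V(2) by blast
    ultimately show ?thesis using flip_sign by (intro exI[of _ "flip e"]) simp
  next
    case far: False
    have "\<exists>\<tau>'. (\<forall>e. \<tau>' e \<in> {-1, 1}) \<and> excited N \<tau>' = V" by (rule closed_on_box_exact[OF V(3,2)])
    then obtain \<tau>' where t': "(\<forall>e. \<tau>' e \<in> {-1, 1}) \<and> excited N \<tau>' = V" by (rule exE)
    have \<tau>': "\<tau>' e \<in> {-1, 1}" for e using t' by (rule conjunct1[THEN spec])
    have exV: "excited N \<tau>' = V" using t' by (rule conjunct2)
    have "(\<Prod>e\<in>\<gamma>. \<tau>' e) = 1"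
    proof (rule wilson_loop_unlinked[OF cyc ne _ _ x(3)])
      show "\<gamma> \<subseteq> box_edges N" using inM box_edges_mono[of M N] MN by auto
      show "\<tau>' e \<in> {-1, 1}" for e by (rule \<tau>')
      show "0 < 4 * int (card V)" using pV by (auto simp: card_gt_0_iff)
      show "\<bar>a $ k - x $ k\<bar> < 4 * int (card V)" if "q \<in> excited N \<tau>'" "a \<in> \<Union>q" for q a k
        using that connected_from_spread[OF V(4) x(1,2)] unfolding exV by blast
      show "\<exists>a\<in>e. \<exists>k. \<bar>a $ k - x $ k\<bar> > 2 * (4 * int (card V))" if "e \<in> \<gamma>" for e
        using far that unfolding close_to_def by (fastforce simp: not_le)
    qed
    then show ?thesis using t' by blast
  qed
  then show ?thesis using False unfolding V_def by blast
qed blast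

text \<open>In a typical configuration the loop variable counts, modulo 2, the edges of the loop that carry a minimal vortex.\<close>

lemma typical_wilson_loop:
  "(\<Prod>e\<in>\<gamma>. \<tau> e) = (\<Prod>e\<in>\<gamma>. if star e \<in> component near (excited N \<tau>) ` excited N \<tau> then -1 else 1)"
proof (rule wilson_loop_components[OF cyc])
  show "\<gamma> \<subseteq> box_edges N" using inM box_edges_mono[of M N] MN by auto
  show "\<tau> e \<in> {-1, 1}" for e by (rule \<tau>)
qed (rule component_cases)

lemma star_sum:
  assumes e: "e \<in> \<gamma>"
  shows "(\<Sum>p | p \<in> box_plaquettes N \<and> e \<in> p. \<Prod>e'\<in>p. \<tau> e') = 6 - 2 * real (card (star e \<inter> excited N \<tau>))"
proof -
  have eE: "e \<in> edges" and eM: "e \<in> box_edges M" using e inM by (auto simp: box_edges_def)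
  have sub: "star e \<subseteq> box_plaquettes N"
    using star_in_box[OF eM] box_plaquettes_mono[of "Suc M" N] MN by auto
  have "{p. p \<in> box_plaquettes N \<and> e \<in> p} = star e"
    using sub by (auto simp: star_def box_plaquettes_def)
  then have "(\<Sum>p | p \<in> box_plaquettes N \<and> e \<in> p. \<Prod>e'\<in>p. \<tau> e') = (\<Sum>p\<in>star e. \<Prod>e'\<in>p. \<tau> e')"
    by simp
  also have "\<dots> = (\<Sum>p\<in>star e. 1 - (if p \<in> excited N \<tau> then 2 else 0))"
  proof (rule sum.cong[OF refl])
    fix p assume p: "p \<in> star e"
    have "(\<Prod>e'\<in>p. \<tau> e') \<in> {-1, 1}" by (rule prod_sign, rule \<tau>)
    then show "(\<Prod>e'\<in>p. \<tau> e') = 1 - (if p \<in> excited N \<tau> then 2 else 0)"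
      using p sub by (auto simp: excited_def)
  qed
  also have "\<dots> = 6 - 2 * real (card (star e \<inter> excited N \<tau>))"
    using card_star[OF eE] by (simp add: sum_subtractf sum.If_cases)
  finally show ?thesis .
qed

text \<open>If there are negative plaquettes around a straight edge \<open>e\<close>, they belong to one component, which is close to the loop and hence consists of
the plaquettes around an edge \<open>e'\<close>. Either \<open>e' = e\<close> and all six signs are negative, or exactly one of them is.\<close>

lemma typical_edge:
  assumes e: "e \<in> \<gamma>" "e \<notin> corner_edges \<gamma>"
  defines "s \<equiv> (\<Sum>p | p \<in> box_plaquettes N \<and> e \<in> p. \<Prod>e'\<in>p. \<tau> e')"
  shows "if star e \<in> component near (excited N \<tau>) ` excited N \<tau> then s = -6
    else s = 6 \<or> s = 4 \<and> (\<exists>e'\<in>adjacent_edges e. star e' \<subseteq> excited N \<tau>)"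
proof -
  have eE: "e \<in> edges" using e inM by (auto simp: box_edges_def)
  let ?A = "excited N \<tau>"
  note st = card_star[OF eE]
  have s: "s = 6 - 2 * real (card (star e \<inter> ?A))" unfolding s_def by (rule star_sum[OF e(1)])
  show ?thesis
  proof (cases "star e \<in> component near ?A ` ?A")
    case True
    then obtain p where p: "p \<in> ?A" "star e = component near ?A p" by blast
    have "star e \<subseteq> ?A" unfolding p(2) by (rule component_subset[OF p(1)])
    then show ?thesis using True s st by (simp add: Int_absorb2)
  next
    case not_comp: False
    show ?thesis
    proof (cases "star e \<inter> ?A = {}")
      case True
      then show ?thesis using not_comp s by simp
    next
      case False
      then obtain p where p: "p \<in> star e" "p \<in> ?A" by blast
      then obtain x i j where x: "i \<noteq> j" "p = plaq_at x i j"
        unfolding star_def plaquettes_iff by blast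
      define V where "V = component near ?A p"
      have "connected_from near p V" unfolding V_def by (rule component_is_vortex(4)[OF p(2)])
      then have "card V > 0" by (auto simp: connected_from_def card_gt_0_iff)
      then have "close_to \<gamma> x (8 * card V)"
        using star_close_to[OF e(1) eE, of x i j] p(1) x(2) by simp
      then obtain e' where e': "e' \<in> edges" "V = star e'"
        using close_component_is_star[OF p(2) x(2,1)] unfolding V_def by blast
      have "V \<in> component near ?A ` ?A" using p(2) V_def by blast
      then have "e' \<noteq> e" using not_comp e'(2) by blast
      have VA: "star e' \<subseteq> ?A" using component_is_vortex(1)[OF p(2)] e'(2) V_def by simp
      have "p \<in> star e'" unfolding e'(2)[symmetric] V_def by (rule component_self)
      then have adj: "e' \<in> adjacent_edges e"
        using p(1) \<open>e' \<noteq> e\<close> by (auto simp: adjacent_edges_def star_def)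
      have "star e \<inter> ?A \<subseteq> star e \<inter> star e'"
      proof
        fix q assume q: "q \<in> star e \<inter> ?A"
        then have "near p q" using star_near[OF eE p(1)] by blast
        moreover have "q \<in> ?A" using q by blast
        ultimately have "q \<in> V" unfolding V_def using component_closed[OF component_self p(2)] by blast
        then show "q \<in> star e \<inter> star e'" using q e'(2) by blast
      qed
      then have "card (star e \<inter> ?A) \<le> card (star e \<inter> star e')" using st(1) by (intro card_mono) auto
      then have "card (star e \<inter> ?A) \<le> 1" using card_star_Int_le[OF eE e'(1)] \<open>e' \<noteq> e\<close> by simp
      moreover have "card (star e \<inter> ?A) > 0" using st(1) False by (simp add: card_gt_0_iff)
      ultimately have "card (star e \<inter> ?A) = 1" by simp
      then show ?thesis using s not_comp adj VA by auto
    qed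
  qed
qed

end

lemma tanh_ge: "tanh x \<ge> 1 - 2 * exp (- 2 * x)" for x :: real
proof -
  define u where "u = exp (- 2 * x)"
  have u: "u > 0" by (simp add: u_def)
  have "(1 - 2 * u) * (1 + u) \<le> 1 - u" by (simp add: algebra_simps)
  then have "1 - 2 * u \<le> (1 - u) / (1 + u)" using u by (simp add: pos_le_divide_eq)
  then show ?thesis by (simp add: tanh_real_altdef u_def)
qed

lemma tanh_le_1: "tanh x \<le> 1" for x :: real
  using tanh_real_bounds[of x] by simp

definition straight_edges :: "edge set \<Rightarrow> edge set" where
  "straight_edges \<gamma> = \<gamma> - corner_edges \<gamma>"

text \<open>The local sum whose hyperbolic tangent replaces the spin at \<open>e\<close>; six equal signs in the interior give \<open>6\<close> or \<open>-6\<close>.\<close>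

definition edge_sum :: "nat \<Rightarrow> spin_config \<Rightarrow> edge \<Rightarrow> real" where
  "edge_sum N \<sigma> e = (\<Sum>p | p \<in> box_plaquettes N \<and> e \<in> p. \<Prod>e'\<in>p. \<sigma> e')"

text \<open>After the sign of the loop variable has been distributed over the straight edges, every factor is positive: it equals \<open>tanh (6 \<beta>)\<close>,
or, if an adjacent edge carries a minimal vortex, \<open>tanh (4 \<beta>) \<ge> 1 - 2 exp (-8 \<beta>)\<close>.
Along a long loop such defects are too frequent to be treated as exceptional, but Weierstrass' product inequality shows that each of them costs
only \<open>2 exp (-8 \<beta>)\<close>.\<close>

lemma typical_lower_bound:
  assumes cyc: "mod2_cycle \<gamma>" and ne: "\<gamma> \<noteq> {}" and inM: "\<gamma> \<subseteq> box_edges M" and MN: "M + 100 \<le> N"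
    and \<tau>: "\<And>e. \<tau> e \<in> {-1, 1}" and reg: "typical N \<gamma> \<tau>" and \<beta>: "\<beta> \<ge> 1"
  shows "(\<Prod>e\<in>\<gamma>. \<tau> e) * (\<Prod>e\<in>straight_edges \<gamma>. tanh (\<beta> * edge_sum N \<tau> e))
    \<ge> tanh (6 * \<beta>) ^ card (straight_edges \<gamma>)
      - 2 * exp (- 8 * \<beta>) * (\<Sum>e\<in>straight_edges \<gamma>. of_bool (\<exists>e'\<in>adjacent_edges e. star e' \<subseteq> excited N \<tau>))"
proof -
  define S where "S = straight_edges \<gamma>"
  define T where "T = tanh (6 * \<beta>)"
  define b :: "edge \<Rightarrow> real" where "b e = of_bool (\<exists>e'\<in>adjacent_edges e. star e' \<subseteq> excited N \<tau>)" for e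
  let ?comps = "component near (excited N \<tau>) ` excited N \<tau>"
  define \<epsilon> :: "edge \<Rightarrow> real" where "\<epsilon> e = (if star e \<in> ?comps then -1 else 1)" for e
  have fin: "finite \<gamma>" using cyc by (simp add: mod2_cycle_def)
  have S\<gamma>: "S \<subseteq> \<gamma>" and finS: "finite S" using fin by (auto simp: S_def straight_edges_def)
  have T: "0 \<le> T" "T \<le> 1" using \<beta> tanh_le_1 by (simp_all add: T_def)
  have small: "2 * exp (- 8 * \<beta>) \<le> 1"
  proof -
    have "exp (- 8 * \<beta>) \<le> exp (- 1)" using \<beta> by simp
    also have "exp (- 1) \<le> (1 / 2 :: real)" using exp_ge_add_one_self[of "1::real"] by (simp add: exp_minus field_simps)
    finally show ?thesis by simp
  qed
  have b: "b e = 0 \<or> b e = 1" for e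
    by (cases "\<exists>e'\<in>adjacent_edges e. star e' \<subseteq> excited N \<tau>") (simp_all add: b_def)
  have factor: "T * (1 - 2 * exp (- 8 * \<beta>) * b e) \<le> \<epsilon> e * tanh (\<beta> * edge_sum N \<tau> e)" if "e \<in> S" for e
  proof -
    have e: "e \<in> \<gamma>" "e \<notin> corner_edges \<gamma>" using that by (auto simp: S_def straight_edges_def)
    note te = typical_edge[OF cyc ne inM MN \<tau> reg e, folded edge_sum_def]
    have le: "T * (1 - 2 * exp (- 8 * \<beta>) * b e) \<le> T"
      using T b[of e] by (auto simp: algebra_simps)
    show ?thesis
    proof (cases "star e \<in> ?comps")
      case True
      then have "edge_sum N \<tau> e = -6" using te by simp
      then show ?thesis using True le by (simp add: \<epsilon>_def T_def mult.commute)
    next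
      case False
      then have "\<epsilon> e = 1" by (simp add: \<epsilon>_def)
      consider "edge_sum N \<tau> e = 6" | "edge_sum N \<tau> e = 4" "b e = 1"
        using te False by (auto simp: b_def)
      then show ?thesis
      proof cases
        case 1
        then show ?thesis using le \<open>\<epsilon> e = 1\<close> by (simp add: T_def mult.commute)
      next
        case 2
        have "T * (1 - 2 * exp (- 8 * \<beta>)) \<le> 1 * (1 - 2 * exp (- 8 * \<beta>))"
          using T small by (intro mult_right_mono) auto
        also have "\<dots> \<le> tanh (\<beta> * 4)" using tanh_ge[of "\<beta> * 4"] by simp
        finally show ?thesis using 2 \<open>\<epsilon> e = 1\<close> by simp
      qed
    qed
  qed
  have "(\<Prod>e\<in>\<gamma>. \<tau> e) = (\<Prod>e\<in>\<gamma>. \<epsilon> e)"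
    unfolding \<epsilon>_def by (rule typical_wilson_loop[OF cyc ne inM MN \<tau> reg])
  also have "\<dots> = (\<Prod>e\<in>S. \<epsilon> e)"
  proof (rule prod.mono_neutral_right[OF fin S\<gamma>])
    show "\<forall>e\<in>\<gamma> - S. \<epsilon> e = 1"
    proof
      fix e assume "e \<in> \<gamma> - S"
      then have "e \<in> corner_edges \<gamma>" by (auto simp: S_def straight_edges_def)
      then have nsub: "\<not> star e \<subseteq> excited N \<tau>" using reg by (auto simp: typical_def)
      have "star e \<notin> ?comps"
      proof
        assume "star e \<in> ?comps"
        then obtain p where p: "p \<in> excited N \<tau>" "star e = component near (excited N \<tau>) p" by blast
        then show False using nsub component_subset[OF p(1), of near] by simp
      qed
      then show "\<epsilon> e = 1" by (simp add: \<epsilon>_def)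
    qed
  qed
  finally have "(\<Prod>e\<in>\<gamma>. \<tau> e) * (\<Prod>e\<in>S. tanh (\<beta> * edge_sum N \<tau> e))
      = (\<Prod>e\<in>S. \<epsilon> e * tanh (\<beta> * edge_sum N \<tau> e))"
    by (simp add: prod.distrib)
  moreover have "(\<Prod>e\<in>S. T * (1 - 2 * exp (- 8 * \<beta>) * b e)) \<le> (\<Prod>e\<in>S. \<epsilon> e * tanh (\<beta> * edge_sum N \<tau> e))"
  proof (rule prod_mono)
    fix e assume "e \<in> S"
    have "0 \<le> T * (1 - 2 * exp (- 8 * \<beta>) * b e)" using T small b[of e] by auto
    then show "0 \<le> T * (1 - 2 * exp (- 8 * \<beta>) * b e) \<and>
       T * (1 - 2 * exp (- 8 * \<beta>) * b e) \<le> \<epsilon> e * tanh (\<beta> * edge_sum N \<tau> e)"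
      using factor[OF \<open>e \<in> S\<close>] by simp
  qed
  moreover have "(\<Prod>e\<in>S. T * (1 - 2 * exp (- 8 * \<beta>) * b e)) = T ^ card S * (\<Prod>e\<in>S. 1 - 2 * exp (- 8 * \<beta>) * b e)"
    by (simp add: prod.distrib)
  moreover have "T ^ card S * (1 - (\<Sum>e\<in>S. 2 * exp (- 8 * \<beta>) * b e)) \<le> T ^ card S * (\<Prod>e\<in>S. 1 - 2 * exp (- 8 * \<beta>) * b e)"
  proof (rule mult_left_mono[OF Weierstrass_prod_ineq])
    show "0 \<le> T ^ card S" using T by simp
    show "2 * exp (- 8 * \<beta>) * b e \<in> {0..1}" for e using b[of e] small by auto
  qed
  moreover have "T ^ card S - (\<Sum>e\<in>S. 2 * exp (- 8 * \<beta>) * b e) \<le> T ^ card S * (1 - (\<Sum>e\<in>S. 2 * exp (- 8 * \<beta>) * b e))"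
  proof -
    have "(\<Sum>e\<in>S. 2 * exp (- 8 * \<beta>) * b e) \<ge> 0" by (intro sum_nonneg) (auto simp: b_def)
    from mult_right_mono[OF power_le_one[OF T] this]
    show ?thesis by (simp add: right_diff_distrib)
  qed
  ultimately have "T ^ card S - (\<Sum>e\<in>S. 2 * exp (- 8 * \<beta>) * b e) \<le> (\<Prod>e\<in>\<gamma>. \<tau> e) * (\<Prod>e\<in>S. tanh (\<beta> * edge_sum N \<tau> e))"
    by linarith
  then show ?thesis unfolding sum_distrib_left[symmetric] S_def T_def b_def .
qed

definition all_excited :: "plaquette set \<Rightarrow> spin_config \<Rightarrow> real" where
  "all_excited V \<sigma> = of_bool (\<forall>p\<in>V. (\<Prod>e\<in>p. \<sigma> e) = -1)"

lemma finite_large_vortices: "finite (large_vortices N \<gamma>)"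
  by (rule finite_subset[of _ "Pow (box_plaquettes N)"]) (auto simp: large_vortices_def finite_box_plaquettes)

lemma configs_eq: "configs N = spins (box_edges N)"
  by (simp add: configs_def spins_def)

lemma boltzmann_weight_eq: "boltzmann_weight N \<beta> \<sigma> = gibbs_weight \<beta> (box_plaquettes N) \<sigma>"
  by (simp add: boltzmann_weight_def gibbs_weight_def plaquette_spin_def)

lemma edge_sum_bound:
  assumes \<sigma>: "\<sigma> \<in> spins (box_edges N)" and e: "e \<in> edges"
  shows "\<bar>edge_sum N \<sigma> e\<bar> \<le> 6"
proof -
  have "\<bar>edge_sum N \<sigma> e\<bar> \<le> (\<Sum>p | p \<in> box_plaquettes N \<and> e \<in> p. \<bar>\<Prod>e'\<in>p. \<sigma> e'\<bar>)"
    unfolding edge_sum_def by (rule sum_abs)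
  also have "\<dots> = (\<Sum>p | p \<in> box_plaquettes N \<and> e \<in> p. 1)"
  proof (rule sum.cong[OF refl])
    fix p assume "p \<in> {p. p \<in> box_plaquettes N \<and> e \<in> p}"
    then have "(\<Prod>e'\<in>p. \<sigma> e') \<in> {-1, 1}" by (intro prod_spins_sign[OF \<sigma>]) (auto simp: box_plaquettes_def)
    then show "\<bar>\<Prod>e'\<in>p. \<sigma> e'\<bar> = 1" by auto
  qed
  also have "\<dots> \<le> real (card (star e))"
    by (simp, intro card_mono card_star(1)[OF e]) (auto simp: star_def box_plaquettes_def)
  finally show ?thesis using card_star(2)[OF e] by simp
qed

text \<open>In a configuration that is not typical one of the indicators in the first bracket is 1, and then the right-hand side is
at most \<open>-1\<close>.\<close>

lemma pointwise_lower_bound: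
  assumes cyc: "mod2_cycle \<gamma>" and ne: "\<gamma> \<noteq> {}" and inM: "\<gamma> \<subseteq> box_edges M" and MN: "M + 100 \<le> N"
    and \<beta>: "\<beta> \<ge> 1" and \<sigma>: "\<sigma> \<in> spins (box_edges N)"
  shows "(\<Prod>e\<in>\<gamma>. \<sigma> e) * (\<Prod>e\<in>straight_edges \<gamma>. tanh (\<beta> * edge_sum N \<sigma> e))
    \<ge> tanh (6 * \<beta>) ^ card (straight_edges \<gamma>)
      - 2 * ((\<Sum>V\<in>large_vortices N \<gamma>. all_excited V \<sigma>) + (\<Sum>e\<in>corner_edges \<gamma>. all_excited (star e) \<sigma>))
      - 2 * exp (- 8 * \<beta>) * (\<Sum>e\<in>straight_edges \<gamma>. \<Sum>e'\<in>adjacent_edges e. all_excited (star e') \<sigma>)"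
    (is "?X \<ge> ?T - 2 * (?L + ?C) - 2 * exp (- 8 * \<beta>) * ?D")
proof -
  define \<tau> where "\<tau> e = (if e \<in> box_edges N then \<sigma> e else 1)" for e
  have \<tau>: "\<tau> e \<in> {-1, 1}" for e using spins_sign[OF \<sigma>, of e] by (auto simp: \<tau>_def)
  have inN: "\<gamma> \<subseteq> box_edges N" using inM box_edges_mono[of M N] MN by auto
  have fin: "finite \<gamma>" and \<gamma>E: "\<gamma> \<subseteq> edges" using cyc by (auto simp: mod2_cycle_def)
  have cor: "corner_edges \<gamma> \<subseteq> \<gamma>" "straight_edges \<gamma> \<subseteq> \<gamma>" by (auto simp: corner_edges_def straight_edges_def)
  have prod_eq: "(\<Prod>e\<in>A. \<tau> e) = (\<Prod>e\<in>A. \<sigma> e)" if "A \<subseteq> box_edges N" for A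
    using that by (intro prod.cong) (auto simp: \<tau>_def)
  have pl: "(\<Prod>e\<in>p. \<tau> e) = (\<Prod>e\<in>p. \<sigma> e)" if "p \<in> box_plaquettes N" for p
    using that prod_eq by (auto simp: box_plaquettes_def)
  have es: "edge_sum N \<tau> e = edge_sum N \<sigma> e" for e
    unfolding edge_sum_def by (intro sum.cong refl pl) simp
  have ind: "all_excited V \<sigma> = of_bool (V \<subseteq> excited N \<tau>)" if "V \<subseteq> box_plaquettes N" for V
    using that pl unfolding all_excited_def excited_def by (intro arg_cong[of _ _ of_bool]) auto
  have nonneg: "0 \<le> all_excited V \<sigma>" for V by (simp add: all_excited_def)
  have L0: "0 \<le> ?L" and C0: "0 \<le> ?C" and D0: "0 \<le> ?D"
    by (intro sum_nonneg nonneg)+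
  have starN: "star e \<subseteq> box_plaquettes N" if "e \<in> box_edges (M + 1)" for e
    using star_in_box[OF that] box_plaquettes_mono[of "Suc (M + 1)" N] MN by auto
  have adjM: "adjacent_edges e \<subseteq> box_edges (M + 1)" if "e \<in> \<gamma>" for e
    using adjacent_edges_in_box[of e M] inM that by auto
  have starC: "star e \<subseteq> box_plaquettes N" if "e \<in> \<gamma>" for e
    using starN[of e] inM box_edges_mono[of M "M + 1"] that by auto
  show ?thesis
  proof (cases "typical N \<gamma> \<tau>")
    case True
    have "?T - 2 * exp (- 8 * \<beta>) * (\<Sum>e\<in>straight_edges \<gamma>. of_bool (\<exists>e'\<in>adjacent_edges e. star e' \<subseteq> excited N \<tau>)) \<le> ?X"
      using typical_lower_bound[OF cyc ne inM MN \<tau> True \<beta>] unfolding es prod_eq[OF inN] .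
    moreover have "(\<Sum>e\<in>straight_edges \<gamma>. of_bool (\<exists>e'\<in>adjacent_edges e. star e' \<subseteq> excited N \<tau>)) \<le> ?D"
    proof (rule sum_mono)
      fix e assume e: "e \<in> straight_edges \<gamma>"
      then have eE: "e \<in> edges" and e\<gamma>: "e \<in> \<gamma>" using cor \<gamma>E by auto
      show "of_bool (\<exists>e'\<in>adjacent_edges e. star e' \<subseteq> excited N \<tau>) \<le> (\<Sum>e'\<in>adjacent_edges e. all_excited (star e') \<sigma>)"
      proof (cases "\<exists>e'\<in>adjacent_edges e. star e' \<subseteq> excited N \<tau>")
        case True
        then obtain e' where e': "e' \<in> adjacent_edges e" "star e' \<subseteq> excited N \<tau>" by blast
        have "star e' \<subseteq> box_plaquettes N" using starN adjM[OF e\<gamma>] e'(1) by blast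
        then have "all_excited (star e') \<sigma> = 1" using ind e'(2) by simp
        moreover have "all_excited (star e') \<sigma> \<le> (\<Sum>e'\<in>adjacent_edges e. all_excited (star e') \<sigma>)"
          by (rule member_le_sum[OF e'(1)]) (auto intro: nonneg adjacent_edges[OF eE])
        ultimately show ?thesis by simp
      next
        case False
        then show ?thesis using sum_nonneg[OF nonneg] by simp
      qed
    qed
    then have "2 * exp (- 8 * \<beta>) * (\<Sum>e\<in>straight_edges \<gamma>. of_bool (\<exists>e'\<in>adjacent_edges e. star e' \<subseteq> excited N \<tau>))
        \<le> 2 * exp (- 8 * \<beta>) * ?D" by (intro mult_left_mono) auto
    moreover have "t - 2 * (l + c) - d \<le> x" if "t - f \<le> x" "f \<le> d" "0 \<le> l" "0 \<le> c" for t f x d l c :: real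
      using that by (simp add: algebra_simps)
    ultimately show ?thesis using L0 C0 by blast
  next
    case False
    have one: "1 \<le> ?L + ?C"
    proof -
      consider V where "V \<in> large_vortices N \<gamma>" "V \<subseteq> excited N \<tau>"
        | e where "e \<in> corner_edges \<gamma>" "star e \<subseteq> excited N \<tau>"
        using False unfolding typical_def by blast
      then show ?thesis
      proof cases
        case 1
        then have "all_excited V \<sigma> = 1" using ind by (simp add: large_vortices_def)
        moreover have "all_excited V \<sigma> \<le> ?L"
          by (rule member_le_sum[OF 1(1)]) (auto intro: nonneg finite_large_vortices)
        ultimately show ?thesis using C0 by linarith
      next
        case 2
        then have "all_excited (star e) \<sigma> = 1" using ind starC cor by auto
        moreover have "all_excited (star e) \<sigma> \<le> ?C"
          by (rule member_le_sum[OF 2(1)]) (auto intro: nonneg finite_subset[OF cor(1) fin])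
        ultimately show ?thesis using L0 by linarith
      qed
    qed
    have "\<bar>?X\<bar> \<le> 1"
    proof -
      have "\<bar>\<Prod>e\<in>straight_edges \<gamma>. tanh (\<beta> * edge_sum N \<sigma> e)\<bar> \<le> 1"
        unfolding abs_prod using tanh_real_bounds by (intro prod_le_1) (auto simp: abs_le_iff less_imp_le minus_le_iff)
      moreover have "\<bar>\<Prod>e\<in>\<gamma>. \<sigma> e\<bar> = 1" using prod_spins_sign[OF \<sigma> inN] by auto
      ultimately show ?thesis by (simp add: abs_mult)
    qed
    moreover have "?T \<le> 1" using \<beta> tanh_le_1[of "6 * \<beta>"] by (intro power_le_one) auto
    moreover have "0 \<le> 2 * exp (- 8 * \<beta>) * ?D" using D0 by simp
    moreover have "t - 2 * a - d \<le> x" if "\<bar>x\<bar> \<le> 1" "t \<le> 1" "0 \<le> d" "1 \<le> a" for t x d a :: real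
      using that by linarith
    ultimately show ?thesis using one by blast
  qed
qed

section \<open>Bounds in finite volume\<close>

lemma sum_all_excited_le:
  fixes \<beta> :: real
  assumes \<tau>: "\<And>e. \<tau> e \<in> {-1, 1}" and V: "V = excited N \<tau>"
  shows "(\<Sum>\<sigma>\<in>configs N. all_excited V \<sigma> * boltzmann_weight N \<beta> \<sigma>)
    \<le> exp (- 2 * \<beta> * card V) * partition_fn N \<beta>"
proof -
  have "(\<Sum>\<sigma>\<in>configs N. all_excited V \<sigma> * boltzmann_weight N \<beta> \<sigma>)
    = (\<Sum>\<sigma> | \<sigma> \<in> spins (box_edges N) \<and> (\<forall>p\<in>V. (\<Prod>e\<in>p. \<sigma> e) = -1). gibbs_weight \<beta> (box_plaquettes N) \<sigma>)"
    unfolding configs_eq boltzmann_weight_eq all_excited_def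
    by (subst sum.inter_filter[OF finite_spins[OF finite_box_edges[of N]]], rule sum.cong[OF refl]) simp
  also have "\<dots> \<le> exp (- 2 * \<beta> * card V) * (\<Sum>\<sigma>\<in>spins (box_edges N). gibbs_weight \<beta> (box_plaquettes N) \<sigma>)"
  proof (rule peierls[OF finite_box_edges finite_box_plaquettes])
    show "p \<subseteq> box_edges N" if "p \<in> box_plaquettes N" for p using that by (simp add: box_plaquettes_def)
    show "\<tau> e \<in> {-1, 1}" for e by (rule \<tau>)
    show "V = {p \<in> box_plaquettes N. prod \<tau> p = - 1}" using V by (simp add: excited_def)
  qed
  finally show ?thesis unfolding partition_fn_def configs_eq boltzmann_weight_eq .
qed

lemma wilson_loop_heat_bath:
  assumes cyc: "mod2_cycle \<gamma>" and inN: "\<gamma> \<subseteq> box_edges N"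
  shows "(\<Sum>\<sigma>\<in>configs N. wilson_loop \<gamma> \<sigma> * boltzmann_weight N \<beta> \<sigma>)
    = (\<Sum>\<sigma>\<in>configs N. (\<Prod>e\<in>\<gamma>. \<sigma> e) * (\<Prod>e\<in>straight_edges \<gamma>. tanh (\<beta> * edge_sum N \<sigma> e)) * boltzmann_weight N \<beta> \<sigma>)"
  unfolding wilson_loop_def configs_eq boltzmann_weight_eq edge_sum_def
proof (rule heat_bath)
  show "finite \<gamma>" "\<gamma> \<subseteq> box_edges N" using cyc inN by (auto simp: mod2_cycle_def)
  then show "finite (straight_edges \<gamma>)" "straight_edges \<gamma> \<subseteq> \<gamma>" by (auto simp: straight_edges_def)
  show "finite (box_plaquettes N)" by (rule finite_box_plaquettes)
  show "p \<subseteq> box_edges N \<and> finite p" if "p \<in> box_plaquettes N" for p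
    using that finite_plaquette by (auto simp: box_plaquettes_def)
  show "e = e'" if "e \<in> straight_edges \<gamma>" "e' \<in> straight_edges \<gamma>" "p \<in> box_plaquettes N" "e \<in> p" "e' \<in> p" for e e' p
    using that by (auto simp: straight_edges_def corner_edges_def box_plaquettes_def)
qed

lemma box_expectation_upper:
  fixes \<beta> :: real
  assumes cyc: "mod2_cycle \<gamma>" and inN: "\<gamma> \<subseteq> box_edges N" and \<beta>: "\<beta> \<ge> 0"
  shows "box_expectation N \<beta> (wilson_loop \<gamma>) \<le> tanh (6 * \<beta>) ^ card (straight_edges \<gamma>)"
proof -
  have \<gamma>E: "\<gamma> \<subseteq> edges" using cyc by (simp add: mod2_cycle_def)
  have "(\<Prod>e\<in>\<gamma>. \<sigma> e) * (\<Prod>e\<in>straight_edges \<gamma>. tanh (\<beta> * edge_sum N \<sigma> e)) \<le> tanh (6 * \<beta>) ^ card (straight_edges \<gamma>)"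
    if \<sigma>: "\<sigma> \<in> spins (box_edges N)" for \<sigma>
  proof -
    have W: "\<bar>\<Prod>e\<in>\<gamma>. \<sigma> e\<bar> = 1" using prod_spins_sign[OF \<sigma> inN] by auto
    have "\<bar>tanh (\<beta> * edge_sum N \<sigma> e)\<bar> \<le> tanh (6 * \<beta>)" if "e \<in> straight_edges \<gamma>" for e
    proof -
      have e: "e \<in> edges" using that \<gamma>E by (auto simp: straight_edges_def)
      have "\<bar>\<beta> * edge_sum N \<sigma> e\<bar> \<le> \<beta> * 6"
        unfolding abs_mult using edge_sum_bound[OF \<sigma> e] \<beta> by (intro mult_mono) auto
      then have "- (6 * \<beta>) \<le> \<beta> * edge_sum N \<sigma> e" "\<beta> * edge_sum N \<sigma> e \<le> 6 * \<beta>" by linarith+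
      then have "tanh (- (6 * \<beta>)) \<le> tanh (\<beta> * edge_sum N \<sigma> e)" "tanh (\<beta> * edge_sum N \<sigma> e) \<le> tanh (6 * \<beta>)"
        by (simp_all only: tanh_real_le_iff)
      then show ?thesis unfolding tanh_minus by linarith
    qed
    then have "\<bar>\<Prod>e\<in>straight_edges \<gamma>. tanh (\<beta> * edge_sum N \<sigma> e)\<bar> \<le> (\<Prod>e\<in>straight_edges \<gamma>. tanh (6 * \<beta>))"
      unfolding abs_prod by (intro prod_mono) auto
    then have "\<bar>(\<Prod>e\<in>\<gamma>. \<sigma> e) * (\<Prod>e\<in>straight_edges \<gamma>. tanh (\<beta> * edge_sum N \<sigma> e))\<bar> \<le> tanh (6 * \<beta>) ^ card (straight_edges \<gamma>)"
      unfolding abs_mult W by simp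
    then show ?thesis by linarith
  qed
  then have "(\<Sum>\<sigma>\<in>configs N. wilson_loop \<gamma> \<sigma> * boltzmann_weight N \<beta> \<sigma>)
    \<le> (\<Sum>\<sigma>\<in>configs N. tanh (6 * \<beta>) ^ card (straight_edges \<gamma>) * boltzmann_weight N \<beta> \<sigma>)"
    by (subst wilson_loop_heat_bath[OF cyc inN], unfold configs_eq, intro sum_mono mult_right_mono)
       (simp_all add: boltzmann_weight_def)
  also have "\<dots> = tanh (6 * \<beta>) ^ card (straight_edges \<gamma>) * partition_fn N \<beta>"
    by (simp add: partition_fn_def sum_distrib_left)
  finally show ?thesis
    unfolding box_expectation_eq using partition_fn_pos[of N \<beta>] by (simp add: pos_divide_le_eq)
qed

text \<open>The pointwise bound is averaged with the Peierls bound for each indicator. An edge has at most 24 adjacent edges, whence the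
constant 48.\<close>

lemma box_expectation_lower:
  fixes \<beta> :: real
  assumes cyc: "mod2_cycle \<gamma>" and ne: "\<gamma> \<noteq> {}" and inM: "\<gamma> \<subseteq> box_edges M" and MN: "M + 100 \<le> N"
    and \<beta>: "\<beta> \<ge> 1"
  shows "box_expectation N \<beta> (wilson_loop \<gamma>) \<ge> tanh (6 * \<beta>) ^ card (straight_edges \<gamma>)
    - 2 * ((\<Sum>V\<in>large_vortices N \<gamma>. exp (- 2 * \<beta> * card V)) + card (corner_edges \<gamma>) * exp (- 12 * \<beta>))
    - 48 * card (straight_edges \<gamma>) * exp (- 20 * \<beta>)"
proof -
  let ?Z = "partition_fn N \<beta>"
  let ?w = "boltzmann_weight N \<beta>"
  let ?T = "tanh (6 * \<beta>) ^ card (straight_edges \<gamma>)"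
  define E where "E V = (\<Sum>\<sigma>\<in>configs N. all_excited V \<sigma> * ?w \<sigma>)" for V
  have inN: "\<gamma> \<subseteq> box_edges N" using inM box_edges_mono[of M N] MN by auto
  have fin: "finite \<gamma>" and \<gamma>E: "\<gamma> \<subseteq> edges" using cyc by (auto simp: mod2_cycle_def)
  have cor: "corner_edges \<gamma> \<subseteq> \<gamma>" "straight_edges \<gamma> \<subseteq> \<gamma>" by (auto simp: corner_edges_def straight_edges_def)
  have E_star: "E (star e) \<le> exp (- 12 * \<beta>) * ?Z" if e: "e \<in> box_edges (M + 1)" for e
  proof -
    have "e \<in> edges" using e by (simp add: box_edges_def)
    have "star e \<subseteq> box_plaquettes N"
      using star_in_box[OF e] box_plaquettes_mono[of "Suc (M + 1)" N] MN by auto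
    then have "star e = excited N (flip e)" unfolding excited_flip by auto
    from sum_all_excited_le[OF flip_sign this, of \<beta>] show ?thesis
      unfolding E_def card_star(2)[OF \<open>e \<in> edges\<close>] by simp
  qed
  have E_large: "E V \<le> exp (- 2 * \<beta> * card V) * ?Z" if "V \<in> large_vortices N \<gamma>" for V
  proof -
    have V: "closed_on_box N V" "V \<subseteq> box_plaquettes N" using that by (auto simp: large_vortices_def)
    have "\<exists>\<tau>. (\<forall>e. \<tau> e \<in> {-1, 1}) \<and> excited N \<tau> = V" by (rule closed_on_box_exact[OF V])
    then obtain \<tau> where t: "(\<forall>e. \<tau> e \<in> {-1, 1}) \<and> excited N \<tau> = V" by (rule exE)
    show ?thesis unfolding E_def
      by (rule sum_all_excited_le[of \<tau>]) (use t in \<open>blast+\<close>)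
  qed
  have adjM: "adjacent_edges e \<subseteq> box_edges (M + 1)" if "e \<in> \<gamma>" for e
    using adjacent_edges_in_box[of e M] inM that by auto
  have 1: "(\<Sum>V\<in>large_vortices N \<gamma>. E V) \<le> (\<Sum>V\<in>large_vortices N \<gamma>. exp (- 2 * \<beta> * card V)) * ?Z"
    unfolding sum_distrib_right by (rule sum_mono[OF E_large])
  have 2: "(\<Sum>e\<in>corner_edges \<gamma>. E (star e)) \<le> card (corner_edges \<gamma>) * exp (- 12 * \<beta>) * ?Z"
  proof -
    have "(\<Sum>e\<in>corner_edges \<gamma>. E (star e)) \<le> (\<Sum>e\<in>corner_edges \<gamma>. exp (- 12 * \<beta>) * ?Z)"
      using cor inM box_edges_mono[of M "M + 1"] by (intro sum_mono E_star) auto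
    then show ?thesis by (simp add: mult.assoc)
  qed
  have 3: "(\<Sum>e\<in>straight_edges \<gamma>. \<Sum>e'\<in>adjacent_edges e. E (star e')) \<le> card (straight_edges \<gamma>) * 24 * exp (- 12 * \<beta>) * ?Z"
  proof -
    have "(\<Sum>e'\<in>adjacent_edges e. E (star e')) \<le> 24 * (exp (- 12 * \<beta>) * ?Z)" if e: "e \<in> straight_edges \<gamma>" for e
    proof -
      have e: "e \<in> \<gamma>" "e \<in> edges" using e cor \<gamma>E by auto
      have "(\<Sum>e'\<in>adjacent_edges e. E (star e')) \<le> (\<Sum>e'\<in>adjacent_edges e. exp (- 12 * \<beta>) * ?Z)"
        using adjM[OF e(1)] by (intro sum_mono E_star) auto
      also have "\<dots> = real (card (adjacent_edges e)) * (exp (- 12 * \<beta>) * ?Z)" by simp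
      also have "\<dots> \<le> 24 * (exp (- 12 * \<beta>) * ?Z)"
        using adjacent_edges(2)[OF e(2)] partition_fn_pos[of N \<beta>] by (intro mult_right_mono) auto
      finally show ?thesis .
    qed
    then have "(\<Sum>e\<in>straight_edges \<gamma>. \<Sum>e'\<in>adjacent_edges e. E (star e')) \<le> (\<Sum>e\<in>straight_edges \<gamma>. 24 * (exp (- 12 * \<beta>) * ?Z))"
      by (rule sum_mono)
    then show ?thesis by (simp add: mult.assoc)
  qed
  have swapL: "(\<Sum>\<sigma>\<in>configs N. (\<Sum>V\<in>large_vortices N \<gamma>. all_excited V \<sigma>) * ?w \<sigma>) = (\<Sum>V\<in>large_vortices N \<gamma>. E V)"
    unfolding E_def sum_distrib_right by (rule sum.swap)
  have swapC: "(\<Sum>\<sigma>\<in>configs N. (\<Sum>e\<in>A. all_excited (star e) \<sigma>) * ?w \<sigma>) = (\<Sum>e\<in>A. E (star e))" for A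
    unfolding E_def sum_distrib_right by (rule sum.swap)
  have "?T * ?Z - 2 * ((\<Sum>V\<in>large_vortices N \<gamma>. E V) + (\<Sum>e\<in>corner_edges \<gamma>. E (star e)))
      - 2 * exp (- 8 * \<beta>) * (\<Sum>e\<in>straight_edges \<gamma>. \<Sum>e'\<in>adjacent_edges e. E (star e'))
    = (\<Sum>\<sigma>\<in>configs N. (?T - 2 * ((\<Sum>V\<in>large_vortices N \<gamma>. all_excited V \<sigma>) + (\<Sum>e\<in>corner_edges \<gamma>. all_excited (star e) \<sigma>))
      - 2 * exp (- 8 * \<beta>) * (\<Sum>e\<in>straight_edges \<gamma>. \<Sum>e'\<in>adjacent_edges e. all_excited (star e') \<sigma>)) * ?w \<sigma>)"
  proof -
    have "sum ?w (configs N) = ?Z" by (simp add: partition_fn_def)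
    moreover have "(\<Sum>\<sigma>\<in>configs N. (\<Sum>e\<in>straight_edges \<gamma>. \<Sum>e'\<in>adjacent_edges e. all_excited (star e') \<sigma>) * ?w \<sigma>)
        = (\<Sum>e\<in>straight_edges \<gamma>. \<Sum>e'\<in>adjacent_edges e. E (star e'))"
    proof -
      have "(\<Sum>\<sigma>\<in>configs N. (\<Sum>e\<in>straight_edges \<gamma>. \<Sum>e'\<in>adjacent_edges e. all_excited (star e') \<sigma>) * ?w \<sigma>)
        = (\<Sum>e\<in>straight_edges \<gamma>. \<Sum>\<sigma>\<in>configs N. (\<Sum>e'\<in>adjacent_edges e. all_excited (star e') \<sigma>) * ?w \<sigma>)"
        unfolding sum_distrib_right by (rule sum.swap)
      then show ?thesis unfolding swapC .
    qed
    ultimately show ?thesis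
      using swapL swapC[of "corner_edges \<gamma>"]
      by (simp add: left_diff_distrib distrib_right sum_subtractf sum.distrib mult.assoc sum_distrib_left[symmetric])
  qed
  also have "\<dots> \<le> (\<Sum>\<sigma>\<in>configs N. (\<Prod>e\<in>\<gamma>. \<sigma> e) * (\<Prod>e\<in>straight_edges \<gamma>. tanh (\<beta> * edge_sum N \<sigma> e)) * ?w \<sigma>)"
  proof (intro sum_mono mult_right_mono)
    show "0 \<le> ?w \<sigma>" for \<sigma> by (simp add: boltzmann_weight_def)
  qed (rule pointwise_lower_bound[OF cyc ne inM MN \<beta>], simp add: configs_eq)
  also have "\<dots> = (\<Sum>\<sigma>\<in>configs N. wilson_loop \<gamma> \<sigma> * ?w \<sigma>)"
    by (rule wilson_loop_heat_bath[OF cyc inN, symmetric])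
  finally have main: "?T * ?Z - 2 * ((\<Sum>V\<in>large_vortices N \<gamma>. E V) + (\<Sum>e\<in>corner_edges \<gamma>. E (star e)))
      - 2 * exp (- 8 * \<beta>) * (\<Sum>e\<in>straight_edges \<gamma>. \<Sum>e'\<in>adjacent_edges e. E (star e'))
    \<le> (\<Sum>\<sigma>\<in>configs N. wilson_loop \<gamma> \<sigma> * ?w \<sigma>)" .
  have D3: "2 * exp (- 8 * \<beta>) * (\<Sum>e\<in>straight_edges \<gamma>. \<Sum>e'\<in>adjacent_edges e. E (star e'))
      \<le> 48 * card (straight_edges \<gamma>) * exp (- 20 * \<beta>) * ?Z"
  proof -
    have "exp (- 20 * \<beta>) = exp (- 8 * \<beta>) * exp (- 12 * \<beta>)" by (simp add: exp_add[symmetric])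
    then show ?thesis using mult_left_mono[OF 3, of "2 * exp (- 8 * \<beta>)"] by (simp add: mult_ac)
  qed
  have "(?T - 2 * ((\<Sum>V\<in>large_vortices N \<gamma>. exp (- 2 * \<beta> * card V)) + card (corner_edges \<gamma>) * exp (- 12 * \<beta>))
    - 48 * card (straight_edges \<gamma>) * exp (- 20 * \<beta>)) * ?Z \<le> (\<Sum>\<sigma>\<in>configs N. wilson_loop \<gamma> \<sigma> * ?w \<sigma>)"
  proof -
    have arith: "(t - 2 * (l + c) - d) * z \<le> x"
      if "t * z - 2 * (l' + c') - d' \<le> x" "l' \<le> l * z" "c' \<le> c * z" "d' \<le> d * z" for t l c d z l' c' d' x :: real
      using that by (simp add: algebra_simps)
    show ?thesis by (rule arith[OF main 1 2 D3])
  qed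
  then show ?thesis
    unfolding box_expectation_eq using partition_fn_pos[of N \<beta>] by (simp add: pos_le_divide_eq)
qed

section \<open>Counting large vortices\<close>

text \<open>An edge of the loop, a base plaquette at distance at most \<open>8 m\<close> from it, and a connected set that contains the base
plaquette.\<close>

lemma card_vortices_of_size_le:
  assumes \<gamma>: "finite \<gamma>" "\<gamma> \<subseteq> edges" and m: "m > 0"
  shows "card {V \<in> large_vortices N \<gamma>. card V = m} \<le> card \<gamma> * ((16 * m + 1) ^ 4 * 16) * 10000 ^ (2 * m - 2)"
proof -
  define y where "y e = (SOME x. \<exists>i. e = edge_at x i)" for e
  have y: "\<exists>i. e = edge_at (y e) i" if "e \<in> \<gamma>" for e
  proof -
    have "\<exists>x i. e = edge_at x i" using that \<gamma>(2) edges_iff by blast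
    then show ?thesis unfolding y_def by (rule someI_ex)
  qed
  define B where "B e = {x :: site. \<forall>k. \<bar>x $ k - y e $ k\<bar> \<le> int (8 * m)}" for e
  define I where "I = (SIGMA e:\<gamma>. B e \<times> (UNIV :: 4 set) \<times> (UNIV :: 4 set))"
  define An where "An u = {V. connected_from near (plaq_at (fst (snd u)) (fst (snd (snd u))) (snd (snd (snd u)))) V \<and> card V = m}"
    for u :: "edge \<times> site \<times> 4 \<times> 4"
  have B: "finite (B e)" "card (B e) \<le> (16 * m + 1) ^ 4" for e
    using card_lattice_cube_le[of "y e" "8 * m"] by (simp_all add: B_def)
  have finI: "finite I" unfolding I_def using \<gamma>(1) B by auto
  have cardI: "card I \<le> card \<gamma> * ((16 * m + 1) ^ 4 * 16)"
  proof -
    have "card I = (\<Sum>e\<in>\<gamma>. card (B e \<times> (UNIV :: 4 set) \<times> (UNIV :: 4 set)))"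
      unfolding I_def using \<gamma>(1) B by (intro card_SigmaI) auto
    also have "\<dots> \<le> (\<Sum>e\<in>\<gamma>. (16 * m + 1) ^ 4 * 16)"
      using B by (intro sum_mono) (simp add: card_cartesian_product)
    finally show ?thesis by simp
  qed
  have An: "finite (An u) \<and> card (An u) \<le> 10000 ^ (2 * m - 2)" for u
    unfolding An_def
    by (rule card_connected_from_le[OF near_sym _ _ m]) (use near_degree in blast)+
  have sub: "{V \<in> large_vortices N \<gamma>. card V = m} \<subseteq> (\<Union>u\<in>I. An u)"
  proof
    fix V assume "V \<in> {V \<in> large_vortices N \<gamma>. card V = m}"
    then obtain x i j where V: "connected_from near (plaq_at x i j) V" "card V = m" "close_to \<gamma> x (8 * m)"
      unfolding large_vortices_def by blast
    then obtain e where e: "e \<in> \<gamma>" "\<forall>a\<in>e. \<forall>k. \<bar>a $ k - x $ k\<bar> \<le> int (8 * m)"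
      unfolding close_to_def by blast
    obtain k where "e = edge_at (y e) k" using y[OF e(1)] by blast
    then have "y e \<in> e" by (metis edge_at_def insertI1)
    then have "\<bar>y e $ k - x $ k\<bar> \<le> int (8 * m)" for k using e(2) by blast
    then have "\<bar>x $ k - y e $ k\<bar> \<le> int (8 * m)" for k
      unfolding abs_minus_commute[of "x $ k"] .
    then have "x \<in> B e" by (simp add: B_def)
    then have "(e, x, i, j) \<in> I" using e(1) by (simp add: I_def)
    moreover have "V \<in> An (e, x, i, j)" using V by (simp add: An_def)
    ultimately show "V \<in> (\<Union>u\<in>I. An u)" by blast
  qed
  have finU: "finite (\<Union>u\<in>I. An u)" using finI An by blast
  have "card {V \<in> large_vortices N \<gamma>. card V = m} \<le> card (\<Union>u\<in>I. An u)"
    by (rule card_mono[OF finU sub])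
  also have "\<dots> \<le> (\<Sum>u\<in>I. card (An u))" by (rule card_UN_le[OF finI])
  also have "\<dots> \<le> (\<Sum>u\<in>I. 10000 ^ (2 * m - 2))" by (rule sum_mono) (use An in blast)
  also have "\<dots> = card I * 10000 ^ (2 * m - 2)" by simp
  also have "\<dots> \<le> card \<gamma> * ((16 * m + 1) ^ 4 * 16) * 10000 ^ (2 * m - 2)"
    using cardI by (rule mult_right_mono) simp
  finally show ?thesis .
qed

lemma geometric_tail_le:
  fixes q :: real
  assumes "0 \<le> q" "q \<le> 1 / 2"
  shows "(\<Sum>m\<in>{k..<k + n}. q ^ m) \<le> 2 * q ^ k"
proof -
  have "(1 - q) * (\<Sum>m\<in>{k..<k + n}. q ^ m) = q ^ k - q ^ (k + n)"
  proof (induction n)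
    case (Suc n)
    have "(1 - q) * (\<Sum>m\<in>{k..<k + Suc n}. q ^ m) = (1 - q) * (\<Sum>m\<in>{k..<k + n}. q ^ m) + (1 - q) * q ^ (k + n)"
      by (simp add: distrib_left)
    also have "\<dots> = q ^ k - q ^ (k + n) + (1 - q) * q ^ (k + n)" by (simp only: Suc.IH)
    also have "\<dots> = q ^ k - q ^ (k + Suc n)" by (simp add: algebra_simps)
    finally show ?case .
  qed simp
  also have "\<dots> \<le> q ^ k" using assms by simp
  finally have "(1 - q) * (\<Sum>m\<in>{k..<k + n}. q ^ m) \<le> q ^ k" .
  moreover have "1 / 2 * (\<Sum>m\<in>{k..<k + n}. q ^ m) \<le> (1 - q) * (\<Sum>m\<in>{k..<k + n}. q ^ m)"
    using assms by (intro mult_right_mono sum_nonneg) auto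
  ultimately show ?thesis by simp
qed

text \<open>The size bound is absorbed into a geometric series by \<open>(16 m + 1) ^ 4 \<le> 17 ^ 4 * 16 ^ m\<close>, and \<open>16 * 17 ^ 4 = 1336336\<close>; the factor \<open>10 ^ 8\<close> per plaquette is the
square of the degree bound, the exponent 7 is the smallest size that occurs, and the factor 2 comes from the geometric series.\<close>

definition vortex_const :: real where
  "vortex_const = 2 * 1336336 * (16 * 10 ^ 8) ^ 7"

lemma sum_large_vortices_le:
  fixes \<beta> :: real
  assumes \<gamma>: "finite \<gamma>" "\<gamma> \<subseteq> edges" and \<beta>: "16 * 10 ^ 8 * exp (- 2 * \<beta>) \<le> 1 / 2"
  shows "(\<Sum>V\<in>large_vortices N \<gamma>. exp (- 2 * \<beta> * card V)) \<le> vortex_const * card \<gamma> * exp (- 14 * \<beta>)"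
proof -
  define q where "q = 16 * 10 ^ 8 * exp (- 2 * \<beta>)"
  define K where "K = card (box_plaquettes N)"
  define LV where "LV = large_vortices N \<gamma>"
  have finLV: "finite LV" unfolding LV_def by (rule finite_large_vortices)
  have sizes: "card ` LV \<subseteq> {7..<7 + K}"
  proof
    fix m assume "m \<in> card ` LV"
    then obtain V where V: "V \<in> LV" "m = card V" by blast
    then have "7 \<le> card V" "V \<subseteq> box_plaquettes N" by (auto simp: LV_def large_vortices_def)
    moreover from this have "card V \<le> K" unfolding K_def by (intro card_mono finite_box_plaquettes)
    ultimately show "m \<in> {7..<7 + K}" using V(2) by simp
  qed
  have term_le: "real (card {V \<in> LV. card V = m}) * exp (- 2 * \<beta> * m) \<le> real (card \<gamma>) * 1336336 * q ^ m"
    if m: "m \<in> {7..<7 + K}" for m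
  proof -
    have m0: "m > 0" using m by simp
    have "m ^ 4 \<le> (2 ^ m) ^ 4" by (intro power_mono) (auto simp: less_imp_le)
    also have "(2 ^ m) ^ 4 = ((2 :: nat) ^ 4) ^ m" by (simp only: power_mult[symmetric] mult.commute)
    finally have m4: "m ^ 4 \<le> 16 ^ m" by simp
    have "(16 * m + 1) ^ 4 \<le> (17 * m) ^ 4" using m0 by (intro power_mono) auto
    also have "\<dots> = 83521 * m ^ 4" by (simp add: power_mult_distrib)
    also have "\<dots> \<le> 83521 * 16 ^ m" using m4 by simp
    finally have a: "(16 * m + 1) ^ 4 \<le> 83521 * (16 ^ m :: nat)" .
    have "(10000 :: nat) ^ (2 * m - 2) \<le> 10000 ^ (2 * m)" by (intro power_increasing) auto
    also have "\<dots> = (10 ^ 8) ^ m" by (simp add: power_mult)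
    finally have b: "(10000 :: nat) ^ (2 * m - 2) \<le> (10 ^ 8) ^ m" .
    have "card {V \<in> LV. card V = m} \<le> card \<gamma> * ((16 * m + 1) ^ 4 * 16) * 10000 ^ (2 * m - 2)"
      unfolding LV_def by (rule card_vortices_of_size_le[OF \<gamma> m0])
    also have "\<dots> \<le> card \<gamma> * (83521 * 16 ^ m * 16) * (10 ^ 8) ^ m"
      using a b by (intro mult_mono) auto
    also have "\<dots> = card \<gamma> * 1336336 * (16 ^ m * (10 ^ 8) ^ m)" by simp
    also have "(16 ^ m * (10 ^ 8) ^ m :: nat) = (16 * 10 ^ 8) ^ m" by (rule power_mult_distrib[symmetric])
    finally have "card {V \<in> LV. card V = m} \<le> card \<gamma> * 1336336 * (16 * 10 ^ 8) ^ m" .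
    then have "real (card {V \<in> LV. card V = m}) \<le> real (card \<gamma> * 1336336 * (16 * 10 ^ 8) ^ m)"
      by (simp only: of_nat_le_iff)
    also have "\<dots> = real (card \<gamma>) * 1336336 * (16 * 10 ^ 8) ^ m" by simp
    finally have le: "real (card {V \<in> LV. card V = m}) * exp (- 2 * \<beta> * m)
        \<le> real (card \<gamma>) * 1336336 * (16 * 10 ^ 8) ^ m * exp (- 2 * \<beta> * m)"
      by (rule mult_right_mono) simp
    have "exp (- 2 * \<beta> * m) = exp (- 2 * \<beta>) ^ m" by (simp add: exp_of_nat_mult[symmetric] mult.commute)
    then have "q ^ m = (16 * 10 ^ 8) ^ m * exp (- 2 * \<beta> * m)" by (simp only: q_def power_mult_distrib)
    with le show ?thesis by (simp only: mult.assoc)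
  qed
  have "(\<Sum>V\<in>LV. exp (- 2 * \<beta> * card V)) = (\<Sum>m\<in>{7..<7 + K}. \<Sum>V\<in>{V \<in> LV. card V = m}. exp (- 2 * \<beta> * card V))"
    by (rule sum.group[OF finLV _ sizes, symmetric]) simp
  also have "\<dots> = (\<Sum>m\<in>{7..<7 + K}. real (card {V \<in> LV. card V = m}) * exp (- 2 * \<beta> * m))"
    by (rule sum.cong[OF refl]) simp
  also have "\<dots> \<le> (\<Sum>m\<in>{7..<7 + K}. real (card \<gamma>) * 1336336 * q ^ m)"
    by (rule sum_mono[OF term_le])
  also have "\<dots> = real (card \<gamma>) * 1336336 * (\<Sum>m\<in>{7..<7 + K}. q ^ m)" by (rule sum_distrib_left[symmetric])
  also have "\<dots> \<le> real (card \<gamma>) * 1336336 * (2 * q ^ 7)"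
    using \<beta> by (intro mult_left_mono geometric_tail_le) (auto simp: q_def)
  also have "\<dots> = vortex_const * card \<gamma> * exp (- 14 * \<beta>)"
  proof -
    have "exp (- 2 * \<beta>) ^ 7 = exp (- 14 * \<beta>)" by (simp add: exp_of_nat_mult[symmetric])
    then show ?thesis by (simp only: q_def power_mult_distrib vortex_const_def mult_ac)
  qed
  finally show ?thesis by (simp add: LV_def)
qed

section \<open>Estimates for the hyperbolic tangent\<close>

lemma tanh_le_exp: 
  fixes x :: real
  assumes "x \<ge> 0"
  shows "tanh x \<le> exp (- 2 * exp (- 2 * x))"
proof -
  define u where "u = exp (- 2 * x)"
  have u: "0 < u" "u \<le> 1" using assms by (auto simp: u_def)
  have "1 - u \<le> exp (- 2 * u) * (1 + u)"
  proof -
    define f where "f v = exp (- 2 * v) * (1 + v) - (1 - v)" for v :: real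
    have "f 0 \<le> f u"
    proof (rule DERIV_nonneg_imp_nondecreasing[of 0 u f])
      fix v assume v: "0 \<le> v" "v \<le> u"
      have "(f has_real_derivative (1 - exp (- 2 * v) * (1 + 2 * v))) (at v)"
        unfolding f_def by (auto intro!: derivative_eq_intros simp: algebra_simps)
      moreover have "exp (- 2 * v) * (1 + 2 * v) \<le> exp (- 2 * v) * exp (2 * v)"
        using exp_ge_add_one_self[of "2 * v"] by (intro mult_left_mono) auto
      then have "exp (- 2 * v) * (1 + 2 * v) \<le> 1" by (simp add: exp_minus)
      ultimately show "\<exists>y. (f has_real_derivative y) (at v) \<and> 0 \<le> y"
        by (intro exI[of _ "1 - exp (- 2 * v) * (1 + 2 * v)"]) auto
    qed (use u in simp)
    then show ?thesis by (simp add: f_def)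
  qed
  then have "(1 - u) / (1 + u) \<le> exp (- 2 * u)" using u by (simp add: pos_divide_le_eq)
  then show ?thesis by (simp add: tanh_real_altdef u_def)
qed

text \<open>The factors \<open>1 - u\<close> and \<open>1 / (1 + u)\<close> of \<open>tanh x\<close>, where \<open>u = exp (-2 x)\<close>, are bounded separately.\<close>

lemma tanh_ge_exp:
  fixes x :: real
  assumes "exp (- 2 * x) \<le> 1 / 2"
  shows "tanh x \<ge> exp (- 2 * exp (- 2 * x) - 2 * exp (- 2 * x) ^ 2)"
proof -
  define u where "u = exp (- 2 * x)"
  have u: "0 < u" "u \<le> 1 / 2" using assms by (auto simp: u_def)
  have "exp (- u - 2 * u ^ 2) \<le> 1 - u"
  proof -
    have "- u - 2 * u ^ 2 \<le> ln (1 - u)" using u by (intro ln_one_minus_pos_lower_bound) auto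
    then have "exp (- u - 2 * u ^ 2) \<le> exp (ln (1 - u))" by simp
    then show ?thesis using u by simp
  qed
  moreover have "exp (- u) \<le> 1 / (1 + u)"
    using u exp_ge_add_one_self[of u] by (simp add: exp_minus field_simps)
  ultimately have "exp (- u - 2 * u ^ 2) * exp (- u) \<le> (1 - u) * (1 / (1 + u))"
    using u by (intro mult_mono) auto
  then show ?thesis by (simp add: tanh_real_altdef u_def exp_add[symmetric])
qed

section \<open>Generalized loops as cycles\<close>

text \<open>The holonomy of a gradient along a path telescopes.\<close>

lemma prod_path_edges:
  fixes g :: "site \<Rightarrow> real"
  assumes "xs \<noteq> []" "successively neighbors xs" and g: "\<And>x. g x \<in> {-1, 1}"
  shows "set (path_edges xs) \<subseteq> edges \<and> prod_list (map (\<lambda>e. \<Prod>x\<in>e. g x) (path_edges xs)) = g (hd xs) * g (last xs)"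
  using assms(1,2)
proof (induction xs rule: induct_list012)
  case (2 x)
  then show ?case using sign_square[OF g[of x]] by (simp add: path_edges_def)
next
  case (3 x y zs)
  have path: "path_edges (x # y # zs) = {x, y} # path_edges (y # zs)" by (simp add: path_edges_def)
  have n: "neighbors x y" "successively neighbors (y # zs)" using "3.prems" by auto
  have xy: "x \<noteq> y" using n(1) by (auto simp: neighbors_def)
  have IH: "set (path_edges (y # zs)) \<subseteq> edges"
    "prod_list (map (\<lambda>e. \<Prod>x\<in>e. g x) (path_edges (y # zs))) = g y * g (last (y # zs))"
    using "3.IH"(2) n(2) by auto
  have "{x, y} \<in> edges" using n(1) unfolding edges_def by blast
  moreover have "prod_list (map (\<lambda>e. \<Prod>x\<in>e. g x) (path_edges (x # y # zs))) = g x * g (last (x # y # zs))"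
    unfolding path using IH(2) xy sign_cancel[OF g[of y]] by (simp add: mult.assoc)
  ultimately show ?case using IH(1) unfolding path by simp
qed simp

lemma generalized_loop_mod2_cycle:
  assumes "generalized_loop \<gamma>"
  shows "mod2_cycle \<gamma>"
proof -
  obtain L where L: "finite L" "\<And>xs. xs \<in> L \<Longrightarrow> is_loop xs \<and> self_avoiding xs"
    "disjoint_family_on (\<lambda>xs. set (path_edges xs)) L" and \<gamma>: "\<gamma> = (\<Union>xs\<in>L. set (path_edges xs))"
    using assms unfolding generalized_loop_def by blast
  have "(\<Prod>e\<in>\<gamma>. \<Prod>x\<in>e. g x) = 1" if g: "\<forall>x. g x \<in> {-1, 1}" for g :: "site \<Rightarrow> real"
  proof -
    have gs: "g x \<in> {-1, 1}" for x using g by (rule spec)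
    have "(\<Prod>e\<in>\<gamma>. \<Prod>x\<in>e. g x) = (\<Prod>xs\<in>L. \<Prod>e\<in>set (path_edges xs). \<Prod>x\<in>e. g x)"
      unfolding \<gamma> using L(1,3) by (intro prod.UNION_disjoint) (auto simp: disjoint_family_on_def)
    also have "\<dots> = (\<Prod>xs\<in>L. 1)"
    proof (rule prod.cong[OF refl])
      fix xs assume xs: "xs \<in> L"
      then have loop: "xs \<noteq> []" "successively neighbors xs" "hd xs = last xs" "distinct (path_edges xs)"
        using L(2) by (auto simp: is_loop_def self_avoiding_def)
      have "(\<Prod>e\<in>set (path_edges xs). \<Prod>x\<in>e. g x) = prod_list (map (\<lambda>e. \<Prod>x\<in>e. g x) (path_edges xs))"
        by (rule prod.distinct_set_conv_list[OF loop(4)])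
      also have "\<dots> = g (hd xs) * g (last xs)"
        using prod_path_edges[OF loop(1,2), of g, OF gs] by blast
      also have "\<dots> = 1" unfolding loop(3) by (rule sign_square[OF gs])
      finally show "(\<Prod>e\<in>set (path_edges xs). \<Prod>x\<in>e. g x) = 1" .
    qed
    finally show ?thesis by simp
  qed
  moreover have "finite \<gamma>" unfolding \<gamma> using L(1) by simp
  moreover have "\<gamma> \<subseteq> edges"
  proof
    fix e assume "e \<in> \<gamma>"
    then obtain xs where xs: "xs \<in> L" "e \<in> set (path_edges xs)" unfolding \<gamma> by blast
    then have "xs \<noteq> []" "successively neighbors xs" using L(2) by (auto simp: is_loop_def)
    from prod_path_edges[OF this, of "\<lambda>_. 1"] xs(2) show "e \<in> edges" by auto
  qed
  ultimately show ?thesis unfolding mod2_cycle_def by blast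
qed

lemma finite_edges_in_box:
  assumes "finite \<gamma>" "\<gamma> \<subseteq> edges"
  shows "\<exists>M. \<gamma> \<subseteq> box_edges M"
  using assms
proof (induction \<gamma> rule: finite_induct)
  case (insert e \<gamma>)
  then obtain M where M: "\<gamma> \<subseteq> box_edges M" by auto
  obtain x i where xi: "e = edge_at x i" using insert.prems edges_iff by blast
  define K where "K = nat (Max (range (\<lambda>k. \<bar>x $ k\<bar>))) + 1"
  have le: "\<bar>x $ k\<bar> \<le> Max (range (\<lambda>k. \<bar>x $ k\<bar>))" for k by (rule Max_ge) auto
  have "int K = Max (range (\<lambda>k. \<bar>x $ k\<bar>)) + 1"
    using order_trans[OF abs_ge_zero le] by (simp add: K_def)
  then have xk: "\<bar>x $ k\<bar> \<le> int K - 1" for k using le[of k] by simp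
  have "- int K \<le> x $ k \<and> x $ k \<le> int K \<and> - int K \<le> (x + axis i 1) $ k \<and> (x + axis i 1) $ k \<le> int K" for k
    using xk[of k] by (auto simp: abs_le_iff)
  then have "x \<in> box K" "x + axis i 1 \<in> box K" by (auto simp: box_def)
  then have "e \<in> box_edges K" using edge_in_box xi by simp
  then have "insert e \<gamma> \<subseteq> box_edges (max K M)"
    using M box_edges_mono[of K "max K M"] box_edges_mono[of M "max K M"] by auto
  then show ?case by blast
qed simp

section \<open>Monotonicity in the volume\<close>

lemma wilson_loop_nonneg:
  assumes "\<gamma> \<subseteq> box_edges N" "\<beta> \<ge> 0"
  shows "0 \<le> box_expectation N \<beta> (wilson_loop \<gamma>)"
proof -
  have "0 \<le> (\<Sum>\<sigma>\<in>spins (box_edges N). (\<Prod>e\<in>\<gamma>. \<sigma> e) * exp (\<Sum>p\<in>box_plaquettes N. \<beta> * (\<Prod>e\<in>p. \<sigma> e)))"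
    by (rule griffiths_first[OF finite_box_edges finite_box_plaquettes _ assms(2) assms(1)])
       (simp add: box_plaquettes_def)
  then show ?thesis
    unfolding box_expectation_eq configs_eq boltzmann_weight_eq gibbs_weight_def wilson_loop_def sum_distrib_left
    using partition_fn_pos[of N \<beta>] by simp
qed

text \<open>On the larger box, the smaller one is obtained by removing couplings: the spins on the additional edges are then free
and cancel in the quotient.\<close>

lemma wilson_loop_mono:
  assumes \<gamma>: "\<gamma> \<subseteq> box_edges N" and \<beta>: "\<beta> \<ge> 0"
  shows "box_expectation N \<beta> (wilson_loop \<gamma>) \<le> box_expectation (Suc N) \<beta> (wilson_loop \<gamma>)"
proof -
  define E where "E = box_edges N"
  define E' where "E' = box_edges (Suc N)"
  define w where "w P \<sigma> = exp (\<Sum>p\<in>P. \<beta> * (\<Prod>e\<in>p. \<sigma> e))" for P :: "plaquette set" and \<sigma>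
  have EE': "E \<subseteq> E'" unfolding E_def E'_def by (rule box_edges_mono) simp
  have fin: "finite E'" "finite (E' - E)" unfolding E'_def by (auto simp: finite_box_edges)
  have E': "E' = E \<union> (E' - E)" using EE' by blast
  have expec: "box_expectation K \<beta> (wilson_loop \<gamma>)
      = (\<Sum>\<sigma>\<in>spins (box_edges K). (\<Prod>e\<in>\<gamma>. \<sigma> e) * w (box_plaquettes K) \<sigma>) / (\<Sum>\<sigma>\<in>spins (box_edges K). w (box_plaquettes K) \<sigma>)" for K
    unfolding box_expectation_eq partition_fn_def configs_eq boltzmann_weight_eq gibbs_weight_def wilson_loop_def w_def sum_distrib_left ..
  have upd: "(\<Prod>e\<in>A. (\<sigma>(e' := s)) e) = (\<Prod>e\<in>A. \<sigma> e)" if "A \<subseteq> E" "e' \<in> E' - E" for A and \<sigma> :: spin_config and e' s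
    using that by (intro prod.cong) auto
  have w_upd: "w (box_plaquettes N) (\<sigma>(e' := s)) = w (box_plaquettes N) \<sigma>" if "e' \<in> E' - E" for \<sigma> e' s
    unfolding w_def by (intro arg_cong[of _ _ exp] sum.cong refl arg_cong[of _ _ "\<lambda>x. \<beta> * x"] upd[OF _ that])
      (auto simp: box_plaquettes_def E_def)
  have 1: "(\<Sum>\<sigma>\<in>spins E'. w (box_plaquettes N) \<sigma>) = 2 ^ card (E' - E) * (\<Sum>\<sigma>\<in>spins E. w (box_plaquettes N) \<sigma>)"
    by (subst E', rule sum_spins_extend[OF fin(2)]) (auto simp: w_upd)
  have 2: "(\<Sum>\<sigma>\<in>spins E'. (\<Prod>e\<in>\<gamma>. \<sigma> e) * w (box_plaquettes N) \<sigma>)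
      = 2 ^ card (E' - E) * (\<Sum>\<sigma>\<in>spins E. (\<Prod>e\<in>\<gamma>. \<sigma> e) * w (box_plaquettes N) \<sigma>)"
  proof (subst E', rule sum_spins_extend[OF fin(2)])
    fix \<sigma> :: spin_config and e s assume e: "e \<in> E' - E"
    show "(\<Prod>e'\<in>\<gamma>. (\<sigma>(e := s)) e') * w (box_plaquettes N) (\<sigma>(e := s)) = (\<Prod>e\<in>\<gamma>. \<sigma> e) * w (box_plaquettes N) \<sigma>"
      unfolding w_upd[OF e] upd[OF \<gamma>[folded E_def] e] ..
  qed auto
  have "box_expectation N \<beta> (wilson_loop \<gamma>)
    = (\<Sum>\<sigma>\<in>spins E'. (\<Prod>e\<in>\<gamma>. \<sigma> e) * w (box_plaquettes N) \<sigma>) / (\<Sum>\<sigma>\<in>spins E'. w (box_plaquettes N) \<sigma>)"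
    unfolding expec 1 2 E_def by simp
  also have "\<dots> \<le> (\<Sum>\<sigma>\<in>spins E'. (\<Prod>e\<in>\<gamma>. \<sigma> e) * w (box_plaquettes (Suc N)) \<sigma>) / (\<Sum>\<sigma>\<in>spins E'. w (box_plaquettes (Suc N)) \<sigma>)"
    unfolding w_def
  proof (rule griffiths_mono[OF fin(1) finite_box_plaquettes])
    show "p \<subseteq> E'" if "p \<in> box_plaquettes (Suc N)" for p using that by (simp add: box_plaquettes_def E'_def)
    show "0 \<le> \<beta>" by (rule \<beta>)
    show "box_plaquettes N \<subseteq> box_plaquettes (Suc N)" by (rule box_plaquettes_mono) simp
    show "\<gamma> \<subseteq> E'" using \<gamma> EE' by (auto simp: E_def)
  qed
  also have "\<dots> = box_expectation (Suc N) \<beta> (wilson_loop \<gamma>)" unfolding expec E'_def ..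
  finally show ?thesis .
qed

section \<open>The main estimate\<close>

text \<open>With \<open>u = exp (-2 \<beta>)\<close> and \<open>t = u ^ 6\<close>, all error terms are bounded by multiples of \<open>\<ell> t u\<close> and \<open>\<ell>\<^sub>0 t\<close>.\<close>

lemma box_expectation_lower_explicit:
  fixes \<beta> :: real
  assumes cyc: "mod2_cycle \<gamma>" and ne: "\<gamma> \<noteq> {}" and inM: "\<gamma> \<subseteq> box_edges M" and MN: "M + 100 \<le> N"
    and \<beta>: "\<beta> \<ge> 1" "16 * 10 ^ 8 * exp (- 2 * \<beta>) \<le> 1 / 2"
  shows "box_expectation N \<beta> (wilson_loop \<gamma>) \<ge> exp (- 2 * real (card \<gamma>) * exp (- 12 * \<beta>))
    - (2 * vortex_const + 50) * (real (card \<gamma>) * exp (- 12 * \<beta>))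
      * (exp (- 2 * \<beta>) + real (card (corner_edges \<gamma>)) / real (card \<gamma>))"
proof -
  define u where "u = exp (- 2 * \<beta>)"
  define t where "t = exp (- 12 * \<beta>)"
  define l where "l = real (card \<gamma>)"
  define l0 where "l0 = real (card (corner_edges \<gamma>))"
  define n where "n = card (straight_edges \<gamma>)"
  have fin: "finite \<gamma>" and \<gamma>E: "\<gamma> \<subseteq> edges" using cyc by (auto simp: mod2_cycle_def)
  have l: "l > 0" using fin ne by (simp add: l_def card_gt_0_iff)
  have n: "n \<le> card \<gamma>" unfolding n_def straight_edges_def by (intro card_mono fin) auto
  have u: "0 < u" "u \<le> 1" and t: "0 < t" using \<beta> by (auto simp: u_def t_def)
  have tu6: "t = u ^ 6" by (simp add: t_def u_def exp_of_nat_mult[symmetric])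
  have "u \<le> 1 / 2" using \<beta>(2) u(1) unfolding u_def[symmetric] by simp
  have "u ^ 6 \<le> u ^ 1" using u by (intro power_decreasing) auto
  then have tu: "t \<le> u" by (simp add: tu6)
  have t_half: "t \<le> 1 / 2" using tu \<open>u \<le> 1 / 2\<close> by simp
  have e14: "exp (- 14 * \<beta>) = t * u" by (simp add: t_def u_def exp_add[symmetric])
  have e20: "exp (- 20 * \<beta>) \<le> t * u"
    unfolding e14[symmetric] using \<beta> by simp
  have tanh_ge: "tanh (6 * \<beta>) \<ge> exp (- 2 * t - 2 * t ^ 2)"
    using tanh_ge_exp[of "6 * \<beta>"] t_half by (simp add: t_def)
  have T: "tanh (6 * \<beta>) ^ n \<ge> exp (- 2 * l * t) - 2 * l * t * u"
  proof -
    have "exp (- 2 * l * t) - 2 * l * t * u \<le> exp (- 2 * l * t) * (1 - 2 * l * t ^ 2)"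
    proof -
      have "exp (- 2 * l * t) * (2 * l * t ^ 2) \<le> 1 * (2 * l * t ^ 2)"
        using l t by (intro mult_right_mono) auto
      also have "\<dots> \<le> 2 * l * t * u" using l t tu by (simp add: power2_eq_square)
      finally show ?thesis by (simp add: right_diff_distrib)
    qed
    also have "\<dots> \<le> exp (- 2 * l * t) * exp (- (2 * l * t ^ 2))"
      using exp_ge_add_one_self[of "- (2 * l * t ^ 2)"] by (intro mult_left_mono) auto
    also have "\<dots> = exp (- 2 * t - 2 * t ^ 2) ^ card \<gamma>"
      by (simp add: exp_of_nat_mult[symmetric] exp_add[symmetric] l_def algebra_simps)
    also have "\<dots> \<le> exp (- 2 * t - 2 * t ^ 2) ^ n"
    proof (rule power_decreasing[OF n])
      have "- 2 * t - 2 * t ^ 2 \<le> 0" using t zero_le_power2[of t] by linarith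
      then show "exp (- 2 * t - 2 * t ^ 2) \<le> 1" by (simp only: exp_le_one_iff)
    qed simp
    also have "\<dots> \<le> tanh (6 * \<beta>) ^ n" using tanh_ge by (intro power_mono) auto
    finally show ?thesis .
  qed
  have V: "(\<Sum>V\<in>large_vortices N \<gamma>. exp (- 2 * \<beta> * card V)) \<le> vortex_const * l * (t * u)"
    using sum_large_vortices_le[OF fin \<gamma>E \<beta>(2), of N] by (simp only: e14 l_def)
  have nl: "real (48 * n) * exp (- 20 * \<beta>) \<le> 48 * l * (t * u)"
    using n e20 by (intro mult_mono) (auto simp: l_def)
  have "exp (- 2 * l * t) - 2 * l * t * u - 2 * (vortex_const * l * (t * u) + l0 * t) - 48 * l * (t * u)
      \<le> box_expectation N \<beta> (wilson_loop \<gamma>)"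
  proof -
    \<comment> \<open>The remaining step is linear arithmetic in the error terms.\<close>
    have arith: "a - 2 * (v + c) - d \<le> x"
      if "a' - 2 * (v' + c) - d' \<le> x" "a \<le> a'" "v' \<le> v" "d' \<le> d" for a a' v v' c d d' x :: real
      using that by (simp add: algebra_simps)
    show ?thesis
      by (rule arith[OF _ T V nl])
         (use box_expectation_lower[OF cyc ne inM MN \<beta>(1)] in \<open>simp only: n_def l0_def t_def\<close>)
  qed
  moreover have "2 * l * t * u + 2 * (vortex_const * l * (t * u) + l0 * t) + 48 * l * (t * u)
      \<le> (2 * vortex_const + 50) * (l * t) * (u + l0 / l)"
  proof -
    have "(2 * vortex_const + 50) * (l * t) * (u + l0 / l)
        = (2 * vortex_const + 50) * (l * t * u) + (2 * vortex_const + 50) * (l0 * t)"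
      using l by (simp add: field_simps)
    moreover have "2 * (l0 * t) \<le> (2 * vortex_const + 50) * (l0 * t)"
      using t by (intro mult_right_mono) (auto simp: l0_def vortex_const_def)
    ultimately show ?thesis by (simp add: algebra_simps)
  qed
  ultimately have "exp (- 2 * l * t) - (2 * vortex_const + 50) * (l * t) * (u + l0 / l)
      \<le> box_expectation N \<beta> (wilson_loop \<gamma>)" by linarith
  then show ?thesis by (simp only: l_def t_def u_def l0_def)
qed

text \<open>Here \<open>L\<close> stands for \<open>\<ell> t\<close>. The lower bound distinguishes whether \<open>L\<close> is at most \<open>\<eta> powr (- 1 / 2)\<close>, where \<open>\<eta>\<close> is the
quantity below the outer root: then the error \<open>K L \<eta>\<close> is at most \<open>K sqrt \<eta>\<close>; otherwise \<open>exp (- 2 L) < 1 / L < sqrt \<eta>\<close>. In the upper bound, omitting the corner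
edges costs at most \<open>2 r\<close>, as \<open>L exp (- L) \<le> 1\<close>.\<close>

lemma two_sided_bound:
  fixes W L r u K :: real
  assumes W0: "0 \<le> W" and W1: "W \<le> exp (- 2 * L * (1 - r))" and W2: "exp (- 2 * L) - K * L * (u + r) \<le> W"
    and L: "0 < L" and r: "0 \<le> r" "r \<le> 1" and u: "0 < u" and K: "2 \<le> K"
  shows "\<bar>W - exp (- 2 * L)\<bar> \<le> K * sqrt (u + sqrt r)"
proof -
  define \<eta> where "\<eta> = u + sqrt r"
  have rs: "r \<le> sqrt r" using r by (simp add: real_le_rsqrt power2_eq_square mult_left_le)
  have \<eta>: "0 < \<eta>" "r \<le> \<eta>" "u + r \<le> \<eta>" using u r rs by (auto simp: \<eta>_def add_pos_nonneg)
  have s: "sqrt \<eta> > 0" "sqrt \<eta> * sqrt \<eta> = \<eta>" using \<eta> by auto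
  have lower: "exp (- 2 * L) - W \<le> K * sqrt \<eta>"
  proof (cases "L * sqrt \<eta> \<le> 1")
    case True
    have "K * L * (u + r) \<le> K * L * \<eta>" using K L \<eta> by (intro mult_left_mono) auto
    also have "\<dots> = K * (L * sqrt \<eta>) * sqrt \<eta>" using s(2) by (simp add: mult.assoc)
    also have "\<dots> \<le> K * 1 * sqrt \<eta>" using True K s by (intro mult_right_mono mult_left_mono) auto
    finally show ?thesis using W2 by simp
  next
    case False
    have "1 < L * sqrt \<eta>" using False by simp
    then have "1 / L < sqrt \<eta>" using L by (simp add: pos_divide_less_eq mult.commute)
    moreover have "exp (- 2 * L) \<le> 1 / L"
    proof -
      have "L \<le> exp (2 * L)" using exp_ge_add_one_self[of "2 * L"] L by linarith
      then show ?thesis using L by (simp add: exp_minus field_simps)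
    qed
    moreover have "1 * sqrt \<eta> \<le> K * sqrt \<eta>" using K s by (intro mult_right_mono) auto
    ultimately show ?thesis using W0 by linarith
  qed
  have upper: "W - exp (- 2 * L) \<le> K * sqrt \<eta>"
  proof (cases "1 \<le> \<eta>")
    case True
    have "W \<le> 1" using W1 L r by (intro order_trans[OF W1]) simp
    moreover have "1 * 1 \<le> K * sqrt \<eta>" using K True by (intro mult_mono) auto
    moreover have "0 \<le> exp (- 2 * L)" by simp
    ultimately show ?thesis by linarith
  next
    case False
    have \<eta>s: "\<eta> \<le> sqrt \<eta>" using False \<eta> by (simp add: real_le_rsqrt power2_eq_square mult_left_le)
    have "exp (- 2 * L * (1 - r)) - exp (- 2 * L) \<le> 2 * r"
    proof (cases "r \<le> 1 / 2")
      case True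
      define y where "y = exp (- 2 * L * (1 - r))"
      have "exp (- 2 * L) = y * exp (- 2 * L * r)"
        by (simp add: y_def exp_add[symmetric] algebra_simps)
      moreover have "y * (1 - 2 * L * r) \<le> y * exp (- 2 * L * r)"
        using exp_ge_add_one_self[of "- 2 * L * r"] by (intro mult_left_mono) (auto simp: y_def)
      ultimately have "y - exp (- 2 * L) \<le> y * (2 * L * r)" by (simp add: algebra_simps)
      also have "\<dots> \<le> exp (- L) * (2 * L * r)"
      proof (rule mult_right_mono)
        have "L * 1 \<le> L * (2 * (1 - r))" using L True by (intro mult_left_mono) auto
        then show "y \<le> exp (- L)" by (simp add: y_def algebra_simps)
      qed (use L r in simp)
      also have "\<dots> = (L * exp (- L)) * (2 * r)" by simp
      also have "\<dots> \<le> 1 * (2 * r)"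
      proof (rule mult_right_mono)
        have "L \<le> exp L" using exp_ge_add_one_self[of L] by linarith
        then show "L * exp (- L) \<le> 1" by (simp add: exp_minus field_simps)
      qed (use r in simp)
      finally show ?thesis by (simp add: y_def)
    next
      case False
      have "exp (- 2 * L * (1 - r)) \<le> 1" using L r by simp
      moreover have "0 \<le> exp (- 2 * L)" by simp
      ultimately show ?thesis using False by linarith
    qed
    moreover have "2 * sqrt \<eta> \<le> K * sqrt \<eta>" using K s by (intro mult_right_mono) auto
    ultimately show ?thesis using W1 \<eta> \<eta>s by linarith
  qed
  show ?thesis using lower upper unfolding \<eta>_def by (simp add: abs_le_iff)
qed

theorem theorem1p1:
  shows "\<exists>\<beta>\<^sub>0 C\<^sub>1 C\<^sub>2 :: real. \<beta>\<^sub>0 > 0 \<and> C\<^sub>1 > 0 \<and> C\<^sub>2 > 0 \<and>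
    (\<forall>\<beta> \<ge> \<beta>\<^sub>0. \<forall>\<gamma> :: edge set. generalized_loop \<gamma> \<and> \<gamma> \<noteq> {} \<longrightarrow>
       convergent (\<lambda>N. box_expectation N \<beta> (wilson_loop \<gamma>)) \<and>
       \<bar>wilson_expectation \<beta> \<gamma> - exp (- 2 * real (card \<gamma>) * exp (- 12 * \<beta>))\<bar>
         \<le> C\<^sub>1 * (exp (- 2 * \<beta>) + sqrt (real (card (corner_edges \<gamma>)) / real (card \<gamma>))) powr C\<^sub>2)"
proof -
  \<comment> \<open>The witnesses: a lower bound on \<open>\<beta>\<close> that makes the geometric series over vortex sizes converge with ratio at most \<open>1 / 2\<close>, the constant of the finite-volume error term, and the exponent \<open>1 / 2\<close>.\<close>
  define K where "K = 2 * vortex_const + 50"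
  have K: "2 \<le> K" by (simp add: K_def vortex_const_def)
  have main: "convergent (\<lambda>N. box_expectation N \<beta> (wilson_loop \<gamma>)) \<and>
       \<bar>wilson_expectation \<beta> \<gamma> - exp (- 2 * real (card \<gamma>) * exp (- 12 * \<beta>))\<bar>
         \<le> K * (exp (- 2 * \<beta>) + sqrt (real (card (corner_edges \<gamma>)) / real (card \<gamma>))) powr (1 / 2)"
    if \<beta>: "4 * 10 ^ 9 \<le> \<beta>" and \<gamma>: "generalized_loop \<gamma>" "\<gamma> \<noteq> {}" for \<beta> :: real and \<gamma> :: "edge set"
  proof -
    define f where "f N = box_expectation N \<beta> (wilson_loop \<gamma>)" for N
    have cyc: "mod2_cycle \<gamma>" by (rule generalized_loop_mod2_cycle[OF \<gamma>(1)])
    have fin: "finite \<gamma>" and \<gamma>E: "\<gamma> \<subseteq> edges" using cyc by (auto simp: mod2_cycle_def)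
    obtain M where M: "\<gamma> \<subseteq> box_edges M" using finite_edges_in_box[OF fin \<gamma>E] by blast
    have inN: "\<gamma> \<subseteq> box_edges N" if "M \<le> N" for N using M box_edges_mono[OF that] by blast
    have \<beta>1: "\<beta> \<ge> 1" using \<beta> by simp
    have small: "16 * 10 ^ 8 * exp (- 2 * \<beta>) \<le> 1 / 2"
    proof -
      have "32 * 10 ^ 8 \<le> 1 + 2 * \<beta>" using \<beta> by simp
      also have "\<dots> \<le> exp (2 * \<beta>)" by (rule exp_ge_add_one_self)
      finally have "32 * 10 ^ 8 \<le> exp (2 * \<beta>)" .
      then show ?thesis by (simp add: exp_minus field_simps)
    qed
    define L where "L = real (card \<gamma>) * exp (- 12 * \<beta>)"
    define r where "r = real (card (corner_edges \<gamma>)) / real (card \<gamma>)"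
    have cpos: "card \<gamma> > 0" using fin \<gamma>(2) by (simp add: card_gt_0_iff)
    have cor: "corner_edges \<gamma> \<subseteq> \<gamma>" by (auto simp: corner_edges_def)
    have L: "0 < L" using cpos by (simp add: L_def)
    have r: "0 \<le> r" "r \<le> 1" using cpos card_mono[OF fin cor] by (auto simp: r_def)
    have f0: "0 \<le> f N" if "M \<le> N" for N
      unfolding f_def using wilson_loop_nonneg[OF inN[OF that]] \<beta>1 by simp
    have f1: "f N \<le> exp (- 2 * L * (1 - r))" if "M \<le> N" for N
    proof -
      have n: "real (card (straight_edges \<gamma>)) = card \<gamma> * (1 - r)"
        unfolding straight_edges_def r_def using cpos card_mono[OF fin cor]
        by (simp add: card_Diff_subset[OF finite_subset[OF cor fin] cor] right_diff_distrib)
      have "f N \<le> tanh (6 * \<beta>) ^ card (straight_edges \<gamma>)"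
        unfolding f_def by (rule box_expectation_upper[OF cyc inN[OF that]]) (use \<beta>1 in simp)
      also have "\<dots> \<le> exp (- 2 * exp (- 12 * \<beta>)) ^ card (straight_edges \<gamma>)"
        using tanh_le_exp[of "6 * \<beta>"] \<beta>1 by (intro power_mono) auto
      also have "\<dots> = exp (- 2 * L * (1 - r))"
        by (simp add: exp_of_nat_mult[symmetric] n L_def mult_ac)
      finally show ?thesis .
    qed
    have f2: "exp (- 2 * L) - K * L * (exp (- 2 * \<beta>) + r) \<le> f N" if "M + 100 \<le> N" for N
      using box_expectation_lower_explicit[OF cyc \<gamma>(2) M that \<beta>1 small]
      unfolding f_def K_def L_def r_def by (simp only: mult.assoc)
    have mono: "f (N + M) \<le> f (Suc N + M)" for N
      unfolding f_def using wilson_loop_mono[OF inN, of "N + M" \<beta>] \<beta>1 by simp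
    have "convergent (\<lambda>N. f (N + M))"
    proof (rule Bseq_mono_convergent)
      show "Bseq (\<lambda>N. f (N + M))"
      proof (rule BseqI')
        have "exp (- 2 * L * (1 - r)) \<le> 1" using L r by simp
        then have "f (N + M) \<le> 1" for N using order_trans[OF f1[of "N + M"]] by simp
        then show "norm (f (N + M)) \<le> 1" for N using f0[of "N + M"] by simp
      qed
      show "\<forall>m n. m \<le> n \<longrightarrow> f (m + M) \<le> f (n + M)"
        using lift_Suc_mono_le[of "\<lambda>N. f (N + M)", OF mono] by blast
    qed
    then have conv: "convergent f" using convergent_ignore_initial_segment[of f M] by simp
    define W where "W = lim f"
    have lim: "f \<longlonglongrightarrow> W" using conv by (simp add: W_def convergent_LIMSEQ_iff)
    have "\<bar>W - exp (- 2 * L)\<bar> \<le> K * sqrt (exp (- 2 * \<beta>) + sqrt r)"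
    proof (rule two_sided_bound[OF _ _ _ L r _ K])
      show "0 \<le> W" by (rule LIMSEQ_le_const[OF lim]) (use f0 in blast)
      show "W \<le> exp (- 2 * L * (1 - r))" by (rule LIMSEQ_le_const2[OF lim]) (use f1 in blast)
      show "exp (- 2 * L) - K * L * (exp (- 2 * \<beta>) + r) \<le> W"
        by (rule LIMSEQ_le_const[OF lim]) (use f2 in blast)
    qed simp
    moreover have "(exp (- 2 * \<beta>) + sqrt r) powr (1 / 2) = sqrt (exp (- 2 * \<beta>) + sqrt r)"
      using r by (intro powr_half_sqrt add_nonneg_nonneg) auto
    ultimately have "\<bar>W - exp (- 2 * L)\<bar> \<le> K * (exp (- 2 * \<beta>) + sqrt r) powr (1 / 2)" by simp
    moreover have "wilson_expectation \<beta> \<gamma> = W"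
      unfolding wilson_expectation_def W_def f_def ..
    ultimately show ?thesis using conv unfolding f_def L_def r_def by (simp add: mult.assoc)
  qed
  show ?thesis
    by (rule exI[of _ "4 * 10 ^ 9"], rule exI[of _ K], rule exI[of _ "1 / 2"]) (use K main in auto)
qed

end
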